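(* Let $F:(M,g,J)\to(N,g')$ be a conformal anti-invariant submersion from a Kähler manifold $(M,g,J)$ to a Riemannian manifold $(N,g')$. Then $F$ is a totally geodesic map if and only if the following three conditions hold for all $X\in\Gamma((\ker F_* )^\perp)$ and $U,V\in\Gamma(\ker F_* )$: (i) $T_UJV=0$ and $\mathcal H\nabla_UJV\in\Gamma(J\ker F_* )$; (ii) $F$ is a horizontally homothetic map; (iii) $\hat\nabla_VBX+T_VCX=0$ and $T_VBX+\mathcal H\nabla_VCX\in\Gamma(J\ker F_* )$.
   Context: A Kähler manifold $(M,g,J)$ is a Riemannian manifold with a $(1,1)$-tensor field $J$ such that $J^2=-I$, $g(JX,JY)=g(X,Y)$ and $\nabla J=0$, where $\nabla$ is the Levi-Civita connection of $g$. A smooth submersion $F:(M,g)\to(N,g')$ is horizontally conformal with dilation $\lambda:M\to(0,\infty)$ if $g'(F_*X,F_*Y)=\lambda^2g(X,Y)$ for all $X,Y\in\Gamma((\ker F_* )^\perp)$. It is a conformal anti-invariant submersion if moreover $J(\ker F_* )\subseteq(\ker F_* )^\perp$. Sections of $\ker F_*$ are vertical, sections of $(\ker F_* )^\perp$ are horizontal; $\mathcal V,\mathcal H$ are the orthogonal projections onto the vertical and horizontal distributions. Let $\mu$ be the orthogonal complement of $J(\ker F_* )$ in $(\ker F_* )^\perp$ (it is $J$-invariant). For horizontal $X$ write $JX=BX+CX$ with $BX\in\Gamma(\ker F_* )$ and $CX\in\Gamma(\mu)$. O'Neill's tensor $T$ is $T_EG=\mathcal H\nabla_{\mathcal VE}\mathcal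 VG+\mathcal V\nabla_{\mathcal VE}\mathcal HG$ for vector fields $E,G$ on $M$; for vertical $V,W$, $\hat\nabla_VW=\mathcal V\nabla_VW$. $F$ is horizontally homothetic if $\mathcal H(\operatorname{grad}\lambda)=0$. $F$ is totally geodesic if $(\nabla F_* )(X,Y):=\nabla^F_XF_*Y-F_*(\nabla_XY)=0$ for all $X,Y\in\Gamma(TM)$, where $\nabla^F$ is the pullback to $F^{-1}TN$ of the Levi-Civita connection of $N$.
   Formalization: In (iii), X ranges only over basic horizontal fields (F-related to a vector field on N); for arbitrary horizontal X the claim is false, e.g. F(x,y)=x on flat C=R² is totally geodesic, but V=∂_y, X=y∂_x violates (iii). *)

theory Defs
  imports "HOL-Analysis.Analysis" "HOL-Library.Function_Algebras"
begin

text \<open>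
  Tangent vectors are operators on functions and vector fields are families of such operators,
  so all of them are functions into the reals; the pointwise operations make them vectors.
\<close>

instantiation "fun" :: (type, scaleR) scaleR
begin
definition scaleR_fun :: "real \<Rightarrow> ('a \<Rightarrow> 'b) \<Rightarrow> 'a \<Rightarrow> 'b"
  where "scaleR_fun c f = (\<lambda>x. c *\<^sub>R f x)"
instance ..
end

lemma scaleR_fun_apply [simp]: "(c *\<^sub>R f) x = c *\<^sub>R f x"
  by (simp add: scaleR_fun_def)

instance "fun" :: (type, real_vector) real_vector
  by standard (simp_all add: fun_eq_iff scaleR_right_distrib scaleR_left_distrib)


section \<open>Smooth manifolds\<close>

text \<open>The set \<open>S\<close> is open wherever these two notions are used.\<close>

fun Ck_on :: "nat \<Rightarrow> 'a::real_normed_vector set \<Rightarrow> ('a \<Rightarrow> 'b::real_normed_vector) \<Rightarrow> bool" where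
  "Ck_on 0 S f \<longleftrightarrow> continuous_on S f"
| "Ck_on (Suc k) S f \<longleftrightarrow>
     f differentiable_on S \<and> (\<forall>v. Ck_on k S (\<lambda>x. frechet_derivative f (at x) v))"

definition smooth_on :: "'a::real_normed_vector set \<Rightarrow> ('a \<Rightarrow> 'b::real_normed_vector) \<Rightarrow> bool"
  where "smooth_on S f \<longleftrightarrow> (\<forall>k. Ck_on k S f)"

text \<open>
  A manifold occupies a whole type \<open>'m\<close>; \<open>'e\<close> is the Euclidean model space. A chart is a pair of
  its domain and its coordinate map; values of the coordinate map outside the domain are irrelevant.
\<close>

type_synonym ('m, 'e) chart = "'m set \<times> ('m \<Rightarrow> 'e)"
type_synonym 'm tvec = "('m \<Rightarrow> real) \<Rightarrow> real"
type_synonym 'm field = "'m \<Rightarrow> 'm tvec"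

text \<open>
  A Riemannian manifold is carried around together with its Levi-Civita connection \<open>conn\<close>, a
  function of two vector fields; that \<open>conn\<close> is the Levi-Civita connection is part of
  \<open>riemannian_manifold\<close> below.
\<close>

record ('m, 'e) riemannian =
  atlas :: "('m, 'e) chart set"
  metric :: "'m \<Rightarrow> 'm tvec \<Rightarrow> 'm tvec \<Rightarrow> real"
  conn :: "'m field \<Rightarrow> 'm field \<Rightarrow> 'm field"

definition smooth_manifold ::
    "('m::{t2_space, second_countable_topology}, 'e::euclidean_space) riemannian \<Rightarrow> bool" where
  "smooth_manifold M \<longleftrightarrow>
     (\<forall>(U, \<phi>) \<in> atlas M. open U \<and> open (\<phi> ` U) \<and> homeomorphism U (\<phi> ` U) \<phi> (inv_into U \<phi>)) \<and>
     (\<Union>(U, \<phi>) \<in> atlas M. U) = UNIV \<and>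
     (\<forall>(U, \<phi>) \<in> atlas M. \<forall>(V, \<psi>) \<in> atlas M. smooth_on (\<phi> ` (U \<inter> V)) (\<psi> \<circ> inv_into U \<phi>))"

definition smooth_fun ::
    "('m::topological_space, 'e::euclidean_space) riemannian \<Rightarrow> ('m \<Rightarrow> real) \<Rightarrow> bool" where
  "smooth_fun M f \<longleftrightarrow> (\<forall>(U, \<phi>) \<in> atlas M. smooth_on (\<phi> ` U) (f \<circ> inv_into U \<phi>))"

definition smooth_map ::
    "('m::topological_space, 'e::euclidean_space) riemannian \<Rightarrow>
     ('n::topological_space, 'k::euclidean_space) riemannian \<Rightarrow> ('m \<Rightarrow> 'n) \<Rightarrow> bool" where
  "smooth_map M N F \<longleftrightarrow> continuous_on UNIV F \<and>
     (\<forall>(U, \<phi>) \<in> atlas M. \<forall>(V, \<psi>) \<in> atlas N.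
        smooth_on (\<phi> ` (U \<inter> F -` V)) (\<psi> \<circ> F \<circ> inv_into U \<phi>))"

text \<open>
  Tangent vectors at \<open>p\<close> are the directional derivatives of smooth functions at \<open>p\<close>, that is the
  combinations of the coordinate derivations at \<open>p\<close>. They are set to \<open>0\<close> on functions that are
  not smooth, so that equality of tangent vectors is equality of operators.
\<close>

definition dir_deriv ::
    "('m::topological_space, 'e::euclidean_space) riemannian \<Rightarrow> ('m, 'e) chart \<Rightarrow> 'm \<Rightarrow> 'e \<Rightarrow> 'm tvec"
  where
  "dir_deriv M c p w = (\<lambda>f. if smooth_fun M f
     then frechet_derivative (f \<circ> inv_into (fst c) (snd c)) (at (snd c p)) w else 0)"

definition tangent_space ::
    "('m::topological_space, 'e::euclidean_space) riemannian \<Rightarrow> 'm \<Rightarrow> 'm tvec set" where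
  "tangent_space M p = {dir_deriv M c p w | c w. c \<in> atlas M \<and> p \<in> fst c}"

text \<open>\<open>sections M D\<close> are the smooth vector fields with values in \<open>D\<close>.\<close>

definition sections ::
    "('m::topological_space, 'e::euclidean_space) riemannian \<Rightarrow> ('m \<Rightarrow> 'm tvec set) \<Rightarrow> 'm field set" where
  "sections M D = {X. (\<forall>p. X p \<in> tangent_space M p \<and> X p \<in> D p) \<and>
     (\<forall>f. smooth_fun M f \<longrightarrow> smooth_fun M (\<lambda>p. X p f))}"

abbreviation vector_fields ::
    "('m::topological_space, 'e::euclidean_space) riemannian \<Rightarrow> 'm field set" where
  "vector_fields M \<equiv> sections M (tangent_space M)"

text \<open>Multiplication of a field by a function, and fibrewise application of a bundle map.\<close>

abbreviation fscale :: "('m \<Rightarrow> real) \<Rightarrow> ('m \<Rightarrow> 'v::real_vector) \<Rightarrow> 'm \<Rightarrow> 'v" (infixr "*\<^sub>F" 75)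
  where "f *\<^sub>F X \<equiv> (\<lambda>p. f p *\<^sub>R X p)"

abbreviation fibrewise :: "('m \<Rightarrow> 'v \<Rightarrow> 'w) \<Rightarrow> ('m \<Rightarrow> 'v) \<Rightarrow> 'm \<Rightarrow> 'w" (infixr "\<odot>" 80)
  where "P \<odot> X \<equiv> (\<lambda>p. P p (X p))"

text \<open>For vector fields \<open>X\<close>, \<open>Y\<close> this vanishes on functions \<open>f\<close> that are not smooth, as it should.\<close>

definition lie_bracket :: "'m field \<Rightarrow> 'm field \<Rightarrow> 'm field" where
  "lie_bracket X Y = (\<lambda>p f. X p (\<lambda>q. Y q f) - Y p (\<lambda>q. X q f))"


section \<open>Riemannian and Kaehler manifolds\<close>

definition riemannian_metric ::
    "('m::topological_space, 'e::euclidean_space) riemannian \<Rightarrow> bool" where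
  "riemannian_metric M \<longleftrightarrow>
     (\<forall>p. \<forall>u \<in> tangent_space M p. \<forall>v \<in> tangent_space M p. \<forall>w \<in> tangent_space M p. \<forall>a b.
        metric M p u v = metric M p v u \<and>
        metric M p (a *\<^sub>R u + b *\<^sub>R v) w = a * metric M p u w + b * metric M p v w) \<and>
     (\<forall>p. \<forall>u \<in> tangent_space M p. u \<noteq> 0 \<longrightarrow> metric M p u u > 0) \<and>
     (\<forall>X \<in> vector_fields M. \<forall>Y \<in> vector_fields M. smooth_fun M (\<lambda>p. metric M p (X p) (Y p)))"

definition levi_civita ::
    "('m::topological_space, 'e::euclidean_space) riemannian \<Rightarrow> bool" where
  "levi_civita M \<longleftrightarrow>
     (\<forall>X \<in> vector_fields M. \<forall>Y \<in> vector_fields M. \<forall>Z \<in> vector_fields M. \<forall>f. smooth_fun M f \<longrightarrow>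
        conn M X Y \<in> vector_fields M \<and>
        conn M (X + Y) Z = conn M X Z + conn M Y Z \<and>
        conn M (f *\<^sub>F X) Y = f *\<^sub>F conn M X Y \<and>
        conn M X (Y + Z) = conn M X Y + conn M X Z \<and>
        conn M X (f *\<^sub>F Y) = (\<lambda>p. X p f) *\<^sub>F Y + f *\<^sub>F conn M X Y \<and>
        conn M X Y - conn M Y X = lie_bracket X Y \<and>
        (\<forall>p. X p (\<lambda>q. metric M q (Y q) (Z q)) =
           metric M p (conn M X Y p) (Z p) + metric M p (Y p) (conn M X Z p)))"

definition riemannian_manifold ::
    "('m::{t2_space, second_countable_topology}, 'e::euclidean_space) riemannian \<Rightarrow> bool" where
  "riemannian_manifold M \<longleftrightarrow> smooth_manifold M \<and> riemannian_metric M \<and> levi_civita M"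

definition tensor_field_11 ::
    "('m::topological_space, 'e::euclidean_space) riemannian \<Rightarrow> ('m \<Rightarrow> 'm tvec \<Rightarrow> 'm tvec) \<Rightarrow> bool" where
  "tensor_field_11 M J \<longleftrightarrow>
     (\<forall>p. \<forall>u \<in> tangent_space M p. \<forall>v \<in> tangent_space M p. \<forall>a b.
        J p u \<in> tangent_space M p \<and> J p (a *\<^sub>R u + b *\<^sub>R v) = a *\<^sub>R J p u + b *\<^sub>R J p v) \<and>
     (\<forall>X \<in> vector_fields M. J \<odot> X \<in> vector_fields M)"

definition kaehler_manifold ::
    "('m::{t2_space, second_countable_topology}, 'e::euclidean_space) riemannian \<Rightarrow>
     ('m \<Rightarrow> 'm tvec \<Rightarrow> 'm tvec) \<Rightarrow> bool" where
  "kaehler_manifold M J \<longleftrightarrow> riemannian_manifold M \<and> tensor_field_11 M J \<and>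
     (\<forall>p. \<forall>u \<in> tangent_space M p. J p (J p u) = - u) \<and>
     (\<forall>p. \<forall>u \<in> tangent_space M p. \<forall>v \<in> tangent_space M p.
        metric M p (J p u) (J p v) = metric M p u v) \<and>
     (\<forall>X \<in> vector_fields M. \<forall>Y \<in> vector_fields M. conn M X (J \<odot> Y) - J \<odot> conn M X Y = 0)"

definition gradient ::
    "('m::topological_space, 'e::euclidean_space) riemannian \<Rightarrow> ('m \<Rightarrow> real) \<Rightarrow> 'm field" where
  "gradient M f p = (THE v. v \<in> tangent_space M p \<and> (\<forall>w \<in> tangent_space M p. metric M p v w = w f))"

definition orth_proj ::
    "('m::topological_space, 'e::euclidean_space) riemannian \<Rightarrow> ('m \<Rightarrow> 'm tvec set) \<Rightarrow>
     'm \<Rightarrow> 'm tvec \<Rightarrow> 'm tvec" where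
  "orth_proj M D p v = (THE w. w \<in> D p \<and> (\<forall>u \<in> D p. metric M p (v - w) u = 0))"


section \<open>Conformal anti-invariant submersions\<close>

definition pushforward ::
    "('n::topological_space, 'k::euclidean_space) riemannian \<Rightarrow> ('m \<Rightarrow> 'n) \<Rightarrow> 'm tvec \<Rightarrow> 'n tvec" where
  "pushforward N F v = (\<lambda>h. if smooth_fun N h then v (h \<circ> F) else 0)"

definition submersion ::
    "('m::topological_space, 'e::euclidean_space) riemannian \<Rightarrow>
     ('n::topological_space, 'k::euclidean_space) riemannian \<Rightarrow> ('m \<Rightarrow> 'n) \<Rightarrow> bool" where
  "submersion M N F \<longleftrightarrow> smooth_map M N F \<and>
     (\<forall>p. pushforward N F ` tangent_space M p = tangent_space N (F p))"

definition vert ::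
    "('m::topological_space, 'e::euclidean_space) riemannian \<Rightarrow>
     ('n::topological_space, 'k::euclidean_space) riemannian \<Rightarrow> ('m \<Rightarrow> 'n) \<Rightarrow> 'm \<Rightarrow> 'm tvec set" where
  "vert M N F p = {v \<in> tangent_space M p. pushforward N F v = 0}"

definition horiz ::
    "('m::topological_space, 'e::euclidean_space) riemannian \<Rightarrow>
     ('n::topological_space, 'k::euclidean_space) riemannian \<Rightarrow> ('m \<Rightarrow> 'n) \<Rightarrow> 'm \<Rightarrow> 'm tvec set" where
  "horiz M N F p = {v \<in> tangent_space M p. \<forall>w \<in> vert M N F p. metric M p v w = 0}"

definition horizontally_conformal ::
    "('m::topological_space, 'e::euclidean_space) riemannian \<Rightarrow>
     ('n::topological_space, 'k::euclidean_space) riemannian \<Rightarrow> ('m \<Rightarrow> 'n) \<Rightarrow> ('m \<Rightarrow> real) \<Rightarrow> bool" where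
  "horizontally_conformal M N F l \<longleftrightarrow>
     (\<forall>p. l p > 0 \<and> (\<forall>u \<in> horiz M N F p. \<forall>v \<in> horiz M N F p.
        metric N (F p) (pushforward N F u) (pushforward N F v) = (l p)\<^sup>2 * metric M p u v))"

definition conformal_anti_invariant_submersion ::
    "('m::topological_space, 'e::euclidean_space) riemannian \<Rightarrow> ('m \<Rightarrow> 'm tvec \<Rightarrow> 'm tvec) \<Rightarrow>
     ('n::topological_space, 'k::euclidean_space) riemannian \<Rightarrow> ('m \<Rightarrow> 'n) \<Rightarrow> ('m \<Rightarrow> real) \<Rightarrow> bool" where
  "conformal_anti_invariant_submersion M J N F l \<longleftrightarrow>
     submersion M N F \<and> horizontally_conformal M N F l \<and>
     (\<forall>p. J p ` vert M N F p \<subseteq> horiz M N F p)"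

abbreviation vproj ::
    "('m::topological_space, 'e::euclidean_space) riemannian \<Rightarrow>
     ('n::topological_space, 'k::euclidean_space) riemannian \<Rightarrow> ('m \<Rightarrow> 'n) \<Rightarrow> 'm \<Rightarrow> 'm tvec \<Rightarrow> 'm tvec" where
  "vproj M N F \<equiv> orth_proj M (vert M N F)"

abbreviation hproj ::
    "('m::topological_space, 'e::euclidean_space) riemannian \<Rightarrow>
     ('n::topological_space, 'k::euclidean_space) riemannian \<Rightarrow> ('m \<Rightarrow> 'n) \<Rightarrow> 'm \<Rightarrow> 'm tvec \<Rightarrow> 'm tvec" where
  "hproj M N F \<equiv> orth_proj M (horiz M N F)"

definition horizontally_homothetic ::
    "('m::topological_space, 'e::euclidean_space) riemannian \<Rightarrow>
     ('n::topological_space, 'k::euclidean_space) riemannian \<Rightarrow> ('m \<Rightarrow> 'n) \<Rightarrow> ('m \<Rightarrow> real) \<Rightarrow> bool" where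
  "horizontally_homothetic M N F l \<longleftrightarrow> hproj M N F \<odot> gradient M l = 0"

definition J_vert ::
    "('m::topological_space, 'e::euclidean_space) riemannian \<Rightarrow> ('m \<Rightarrow> 'm tvec \<Rightarrow> 'm tvec) \<Rightarrow>
     ('n::topological_space, 'k::euclidean_space) riemannian \<Rightarrow> ('m \<Rightarrow> 'n) \<Rightarrow> 'm \<Rightarrow> 'm tvec set" where
  "J_vert M J N F p = J p ` vert M N F p"

definition mu ::
    "('m::topological_space, 'e::euclidean_space) riemannian \<Rightarrow> ('m \<Rightarrow> 'm tvec \<Rightarrow> 'm tvec) \<Rightarrow>
     ('n::topological_space, 'k::euclidean_space) riemannian \<Rightarrow> ('m \<Rightarrow> 'n) \<Rightarrow> 'm \<Rightarrow> 'm tvec set" where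
  "mu M J N F p = {v \<in> horiz M N F p. \<forall>w \<in> J_vert M J N F p. metric M p v w = 0}"

text \<open>For horizontal \<open>x\<close> these are the components in \<open>J x = B x + C x\<close>.\<close>

definition B_part ::
    "('m::topological_space, 'e::euclidean_space) riemannian \<Rightarrow> ('m \<Rightarrow> 'm tvec \<Rightarrow> 'm tvec) \<Rightarrow>
     ('n::topological_space, 'k::euclidean_space) riemannian \<Rightarrow> ('m \<Rightarrow> 'n) \<Rightarrow> 'm \<Rightarrow> 'm tvec \<Rightarrow> 'm tvec" where
  "B_part M J N F p x = (THE b. b \<in> vert M N F p \<and> J p x - b \<in> mu M J N F p)"

definition C_part ::
    "('m::topological_space, 'e::euclidean_space) riemannian \<Rightarrow> ('m \<Rightarrow> 'm tvec \<Rightarrow> 'm tvec) \<Rightarrow>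
     ('n::topological_space, 'k::euclidean_space) riemannian \<Rightarrow> ('m \<Rightarrow> 'n) \<Rightarrow> 'm \<Rightarrow> 'm tvec \<Rightarrow> 'm tvec" where
  "C_part M J N F p x = (THE c. c \<in> mu M J N F p \<and> J p x - c \<in> vert M N F p)"

definition oneill_T ::
    "('m::topological_space, 'e::euclidean_space) riemannian \<Rightarrow>
     ('n::topological_space, 'k::euclidean_space) riemannian \<Rightarrow> ('m \<Rightarrow> 'n) \<Rightarrow>
     'm field \<Rightarrow> 'm field \<Rightarrow> 'm field" where
  "oneill_T M N F E G =
     hproj M N F \<odot> conn M (vproj M N F \<odot> E) (vproj M N F \<odot> G) +
     vproj M N F \<odot> conn M (vproj M N F \<odot> E) (hproj M N F \<odot> G)"

definition conn_hat ::
    "('m::topological_space, 'e::euclidean_space) riemannian \<Rightarrow>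
     ('n::topological_space, 'k::euclidean_space) riemannian \<Rightarrow> ('m \<Rightarrow> 'n) \<Rightarrow>
     'm field \<Rightarrow> 'm field \<Rightarrow> 'm field" where
  "conn_hat M N F V W = vproj M N F \<odot> conn M V W"

text \<open>
  A horizontal field is basic if it is related by \<open>F\<close> to a vector field on the target.
\<close>

definition basic ::
    "('m::topological_space, 'e::euclidean_space) riemannian \<Rightarrow>
     ('n::topological_space, 'k::euclidean_space) riemannian \<Rightarrow> ('m \<Rightarrow> 'n) \<Rightarrow> 'm field \<Rightarrow> bool" where
  "basic M N F X \<longleftrightarrow> X \<in> sections M (horiz M N F) \<and>
     (\<exists>Z \<in> vector_fields N. \<forall>p. pushforward N F (X p) = Z (F p))"


section \<open>Totally geodesic maps\<close>

definition sections_along ::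
    "('m::topological_space, 'e::euclidean_space) riemannian \<Rightarrow>
     ('n::topological_space, 'k::euclidean_space) riemannian \<Rightarrow> ('m \<Rightarrow> 'n) \<Rightarrow> ('m \<Rightarrow> 'n tvec) set" where
  "sections_along M N F = {S. (\<forall>p. S p \<in> tangent_space N (F p)) \<and>
     (\<forall>h. smooth_fun N h \<longrightarrow> smooth_fun M (\<lambda>p. S p h))}"

text \<open>
  The pullback of the Levi-Civita connection of \<open>N\<close> is the unique connection \<open>D\<close> on the pullback
  bundle whose value on \<open>Z \<circ> F\<close> in direction \<open>x\<close> at \<open>p\<close> is the derivative of \<open>Z\<close> in
  direction \<open>F\<^sub>* x\<close> at \<open>F p\<close>. As \<open>conn N\<close> takes vector fields, that direction is given by a field
  \<open>W\<close> on \<open>N\<close> with the right value at \<open>F p\<close>.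
\<close>

definition pullback_connection ::
    "('m::topological_space, 'e::euclidean_space) riemannian \<Rightarrow>
     ('n::topological_space, 'k::euclidean_space) riemannian \<Rightarrow> ('m \<Rightarrow> 'n) \<Rightarrow>
     ('m field \<Rightarrow> ('m \<Rightarrow> 'n tvec) \<Rightarrow> 'm \<Rightarrow> 'n tvec) \<Rightarrow> bool" where
  "pullback_connection M N F D \<longleftrightarrow>
     (\<forall>X \<in> vector_fields M. \<forall>Y \<in> vector_fields M.
      \<forall>S \<in> sections_along M N F. \<forall>R \<in> sections_along M N F. \<forall>f. smooth_fun M f \<longrightarrow>
        D X S \<in> sections_along M N F \<and>
        D (X + Y) S = D X S + D Y S \<and>
        D (f *\<^sub>F X) S = f *\<^sub>F D X S \<and>
        D X (S + R) = D X S + D X R \<and>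
        D X (f *\<^sub>F S) = (\<lambda>p. X p f) *\<^sub>F S + f *\<^sub>F D X S) \<and>
     (\<forall>X \<in> vector_fields M. \<forall>Z \<in> vector_fields N. \<forall>W \<in> vector_fields N. \<forall>p.
        W (F p) = pushforward N F (X p) \<longrightarrow> D X (Z \<circ> F) p = conn N W Z (F p))"

definition second_fundamental_form ::
    "('m::topological_space, 'e::euclidean_space) riemannian \<Rightarrow>
     ('n::topological_space, 'k::euclidean_space) riemannian \<Rightarrow> ('m \<Rightarrow> 'n) \<Rightarrow>
     ('m field \<Rightarrow> ('m \<Rightarrow> 'n tvec) \<Rightarrow> 'm \<Rightarrow> 'n tvec) \<Rightarrow>
     'm field \<Rightarrow> 'm field \<Rightarrow> 'm \<Rightarrow> 'n tvec" where
  "second_fundamental_form M N F D X Y =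
     D X (\<lambda>p. pushforward N F (Y p)) - (\<lambda>p. pushforward N F (conn M X Y p))"

definition totally_geodesic ::
    "('m::topological_space, 'e::euclidean_space) riemannian \<Rightarrow>
     ('n::topological_space, 'k::euclidean_space) riemannian \<Rightarrow> ('m \<Rightarrow> 'n) \<Rightarrow>
     ('m field \<Rightarrow> ('m \<Rightarrow> 'n tvec) \<Rightarrow> 'm \<Rightarrow> 'n tvec) \<Rightarrow> bool" where
  "totally_geodesic M N F D \<longleftrightarrow>
     (\<forall>X \<in> vector_fields M. \<forall>Y \<in> vector_fields M. second_fundamental_form M N F D X Y = 0)"

end

theory Submission
  imports Defs
begin

text \<open>
  The second fundamental form \<open>II X Y = \<nabla>\<^sup>F\<^sub>X F\<^sub>* Y - F\<^sub>* (\<nabla>\<^sub>X Y)\<close> of \<open>F\<close> is linear over the smooth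
  functions in both arguments. Locally all vector fields are generated by vertical fields and by
  horizontal lifts of fields on \<open>N\<close> (which are exactly the basic fields), and so \<open>II\<close> vanishes if and
  only if it vanishes on these. There are three cases.

  \<^item> \<open>II U V = - F\<^sub>* (\<nabla>\<^sub>U V)\<close> for vertical \<open>U\<close>, \<open>V\<close>. So \<open>II\<close> vanishes on such pairs iff every \<open>\<nabla>\<^sub>U V\<close> is
    vertical. As \<open>J\<close> is parallel, \<open>\<nabla>\<^sub>U (J V) = J \<nabla>\<^sub>U V\<close>, and this lies in \<open>J (ker F\<^sub>*)\<close> iff \<open>\<nabla>\<^sub>U V\<close> is
    vertical. As \<open>J (ker F\<^sub>*)\<close> is horizontal, that means the two conditions on the parts of \<open>\<nabla>\<^sub>U (J V)\<close>.

  \<^item> \<open>II X V = II V X = - F\<^sub>* (\<nabla>\<^sub>V X)\<close> for vertical \<open>V\<close> and a horizontal lift \<open>X\<close>, because \<open>F\<^sub>* X\<close> is constant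
    along the fibres and \<open>[X, V]\<close> is vertical. The same argument, applied to
    \<open>J \<nabla>\<^sub>V X = \<nabla>\<^sub>V (J X) = \<nabla>\<^sub>V (B X) + \<nabla>\<^sub>V (C X)\<close>, turns the vanishing of \<open>II\<close> into
    the conditions on \<open>B X\<close> and \<open>C X\<close>.

  \<^item> For horizontal lifts \<open>X\<close>, \<open>Y\<close>, \<open>Z\<close>, differentiating \<open>g'(F\<^sub>* Y, F\<^sub>* Z) = l\<^sup>2 g(Y, Z)\<close> along \<open>X\<close> gives
    \<open>g'(II X Y, F\<^sub>* Z) + g'(F\<^sub>* Y, II X Z) = X(l\<^sup>2) g(Y, Z)\<close>. If \<open>II = 0\<close>, then \<open>Y = Z \<noteq> 0\<close> yields \<open>X l = 0\<close>.
    If conversely \<open>l\<close> is constant in horizontal directions, the form \<open>g'(II X Y, F\<^sub>* Z)\<close> is antisymmetric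
    in \<open>Y\<close>, \<open>Z\<close>; it is also symmetric in \<open>X\<close>, \<open>Y\<close>, both connections being torsion-free, and
    a form with these two symmetries is zero.

  This is carried out in \<open>totally_geodesic_iff\<close>, \<open>fibres_condition_iff\<close> and \<open>mixed_condition_iff\<close>.

  The larger part of the work is to show that the fields which occur are smooth. Bump functions give
  local frames by global fields. Gram-Schmidt orthogonalisation makes gradients of smooth functions
  smooth. For a horizontally conformal \<open>F\<close>, the horizontal lift of \<open>grad h\<close> is \<open>l\<^sup>-\<^sup>2 grad (h \<circ> F)\<close>; comparing
  lengths shows that \<open>l\<close> is smooth, and so gradients on \<open>N\<close> have smooth lifts. As gradients generate
  all fields, all fields on \<open>N\<close> have smooth lifts, and the orthogonal projections onto the vertical and
  horizontal distributions preserve smoothness.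
\<close>


section \<open>Calculus of \<open>C\<^sup>k\<close> functions\<close>

lemma frechet_derivative_eq:
  "(f has_derivative f') (at x) \<Longrightarrow> frechet_derivative f (at x) = f'"
  by (metis frechet_derivative_at)

lemma has_frechet_derivative:
  "open S \<Longrightarrow> f differentiable_on S \<Longrightarrow> x \<in> S \<Longrightarrow>
    (f has_derivative frechet_derivative f (at x)) (at x)"
  by (metis at_within_open differentiable_on_def frechet_derivative_works)

lemma differentiable_onI_open:
  "(\<And>x. x \<in> S \<Longrightarrow> (f has_derivative f' x) (at x)) \<Longrightarrow> f differentiable_on S"
  by (meson differentiable_on_def differentiable_def has_derivative_at_withinI)

lemma frechet_derivative_cong_open:
  assumes "open S" "x \<in> S" "\<And>y. y \<in> S \<Longrightarrow> f y = g y"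
  shows "frechet_derivative f (at x) = frechet_derivative g (at x)"
proof -
  have "(f has_derivative D) (at x) \<longleftrightarrow> (g has_derivative D) (at x)" for D
    using assms by (metis has_derivative_transform_within_open)
  then show ?thesis unfolding frechet_derivative_def by simp
qed

lemma Ck_on_cong:
  "open S \<Longrightarrow> (\<And>x. x \<in> S \<Longrightarrow> f x = g x) \<Longrightarrow> Ck_on k S f \<longleftrightarrow> Ck_on k S g"
proof (induction k arbitrary: f g)
  case 0
  then show ?case by (simp cong: continuous_on_cong)
next
  case (Suc k)
  have "f differentiable_on S \<longleftrightarrow> g differentiable_on S"
    unfolding differentiable_on_def using Suc.prems(2)
    by (metis differentiable_transform_within zero_less_one)
  moreover have "Ck_on k S (\<lambda>x. frechet_derivative f (at x) v) \<longleftrightarrow>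
      Ck_on k S (\<lambda>x. frechet_derivative g (at x) v)" for v
    using Suc.prems by (intro Suc.IH) (simp_all add: frechet_derivative_cong_open[of S _ f g])
  ultimately show ?case by simp
qed

lemma Ck_on_subset: "open S \<Longrightarrow> T \<subseteq> S \<Longrightarrow> Ck_on k S f \<Longrightarrow> Ck_on k T f"
proof (induction k arbitrary: f)
  case 0
  then show ?case by (auto intro: continuous_on_subset)
next
  case (Suc k)
  then show ?case by (auto intro: differentiable_on_subset)
qed

lemma Ck_on_Suc_imp: "open S \<Longrightarrow> Ck_on (Suc k) S f \<Longrightarrow> Ck_on k S f"
proof (induction k arbitrary: f)
  case 0
  then show ?case by (auto intro: differentiable_imp_continuous_on)
next
  case (Suc k)
  then show ?case by (metis Ck_on.simps(2))
qed

text \<open>Differentiability and continuity on an open set are local properties.\<close>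

lemma Ck_on_local:
  assumes "\<And>x. x \<in> S \<Longrightarrow> \<exists>T. open T \<and> x \<in> T \<and> Ck_on k T f"
  shows "Ck_on k S f"
  using assms
proof (induction k arbitrary: f)
  case 0
  have "continuous (at x within S) f" if "x \<in> S" for x
    using 0[OF that] continuous_on_interior interior_open continuous_at_imp_continuous_at_within
    by (metis Ck_on.simps(1))
  then show ?case by (simp add: continuous_on_eq_continuous_within)
next
  case (Suc k)
  have "f differentiable (at x within S)" if "x \<in> S" for x
    using Suc.prems[OF that] differentiable_at_withinI
    by (metis Ck_on.simps(2) at_within_open differentiable_on_def)
  moreover have "Ck_on k S (\<lambda>x. frechet_derivative f (at x) v)" for v
    using Suc.prems by (intro Suc.IH) auto
  ultimately show ?case by (simp add: differentiable_on_def)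
qed

text \<open>
  Every rule of differentiation below yields its \<open>C\<^sup>k\<close> version in the same way: the derivative
  that the rule gives is built from functions to which the induction hypothesis applies.
\<close>

lemma Ck_on_SucI:
  assumes "open S" "\<And>x. x \<in> S \<Longrightarrow> (f has_derivative f' x) (at x)" "\<And>v. Ck_on k S (\<lambda>x. f' x v)"
  shows "Ck_on (Suc k) S f"
proof -
  have "f differentiable_on S"
    using assms(2) by (rule differentiable_onI_open)
  moreover have "Ck_on k S (\<lambda>x. frechet_derivative f (at x) v)" for v
    using Ck_on_cong[OF \<open>open S\<close>, of "\<lambda>x. frechet_derivative f (at x) v" "\<lambda>x. f' x v"]
      assms(2,3) by (metis frechet_derivative_eq)
  ultimately show ?thesis by simp
qed

lemma Ck_on_const: "open S \<Longrightarrow> Ck_on k S (\<lambda>x. c)"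
proof (induction k arbitrary: c)
  case (Suc k)
  then show ?case by (intro Ck_on_SucI[where f'="\<lambda>x v. 0"]) auto
qed simp

lemma Ck_on_bounded_linear:
  "bounded_linear L \<Longrightarrow> open S \<Longrightarrow> Ck_on k S f \<Longrightarrow> Ck_on k S (\<lambda>x. L (f x))"
proof (induction k arbitrary: f)
  case 0
  then show ?case by (auto intro: bounded_linear.continuous_on)
next
  case (Suc k)
  then show ?case
    by (intro Ck_on_SucI[where f'="\<lambda>x v. L (frechet_derivative f (at x) v)"])
       (auto intro: bounded_linear.has_derivative has_frechet_derivative)
qed

lemma Ck_on_id: "open S \<Longrightarrow> Ck_on k S (\<lambda>x. x)"
proof (cases k)
  case (Suc n)
  then show "open S \<Longrightarrow> ?thesis"
    by (simp del: Ck_on.simps, intro Ck_on_SucI[where f'="\<lambda>x v. v"]) (auto intro: Ck_on_const)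
qed (simp add: continuous_on_id)

lemma Ck_on_add:
  "open S \<Longrightarrow> Ck_on k S f \<Longrightarrow> Ck_on k S g \<Longrightarrow> Ck_on k S (\<lambda>x. f x + g x)"
proof (induction k arbitrary: f g)
  case 0
  then show ?case by (auto intro: continuous_on_add)
next
  case (Suc k)
  then show ?case
    by (intro Ck_on_SucI[where f'="\<lambda>x v. frechet_derivative f (at x) v + frechet_derivative g (at x) v"])
       (auto intro: has_derivative_add has_frechet_derivative)
qed

lemma Ck_on_sum:
  "open S \<Longrightarrow> (\<And>i. i \<in> I \<Longrightarrow> Ck_on k S (f i)) \<Longrightarrow> Ck_on k S (\<lambda>x. \<Sum>i\<in>I. f i x)"
  by (induction I rule: infinite_finite_induct) (auto intro: Ck_on_const Ck_on_add)

lemma Ck_on_scaleR: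
  fixes f :: "'a::real_normed_vector \<Rightarrow> real"
  shows "open S \<Longrightarrow> Ck_on k S f \<Longrightarrow> Ck_on k S g \<Longrightarrow> Ck_on k S (\<lambda>x. f x *\<^sub>R g x)"
proof (induction k arbitrary: f g)
  case 0
  then show ?case by (auto intro: continuous_on_scaleR)
next
  case (Suc k)
  show ?case
    using Suc.prems Ck_on_Suc_imp[OF Suc.prems(1,2)] Ck_on_Suc_imp[OF Suc.prems(1,3)]
    by (intro Ck_on_SucI[where
          f'="\<lambda>x v. f x *\<^sub>R frechet_derivative g (at x) v + frechet_derivative f (at x) v *\<^sub>R g x"])
       (auto intro!: Suc.IH Ck_on_add has_derivative_scaleR has_frechet_derivative)
qed

lemma Ck_on_mult:
  fixes f g :: "'a::real_normed_vector \<Rightarrow> real"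
  shows "open S \<Longrightarrow> Ck_on k S f \<Longrightarrow> Ck_on k S g \<Longrightarrow> Ck_on k S (\<lambda>x. f x * g x)"
  using Ck_on_scaleR[of S k f g] by simp

text \<open>
  The derivative of \<open>g \<circ> f\<close> in direction \<open>v\<close> is expanded in a basis, so that only derivatives of
  \<open>g\<close> in constant directions are composed with \<open>f\<close>.
\<close>

lemma Ck_on_compose:
  fixes f :: "'a::real_normed_vector \<Rightarrow> 'b::euclidean_space" and g :: "'b \<Rightarrow> 'c::real_normed_vector"
  assumes "open S" "open T"
  shows "f ` S \<subseteq> T \<Longrightarrow> Ck_on k T g \<Longrightarrow> Ck_on k S f \<Longrightarrow> Ck_on k S (\<lambda>x. g (f x))"
proof (induction k arbitrary: g)
  case 0
  then show ?case by (auto intro: continuous_on_compose2)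
next
  case (Suc k)
  define D where "D x v = (\<Sum>b\<in>Basis. (frechet_derivative f (at x) v \<bullet> b) *\<^sub>R
      frechet_derivative g (at (f x)) b)" for x v
  have "((\<lambda>x. g (f x)) has_derivative D x) (at x)" if "x \<in> S" for x
  proof -
    have f: "(f has_derivative frechet_derivative f (at x)) (at x)"
      and g: "(g has_derivative frechet_derivative g (at (f x))) (at (f x))"
      using Suc.prems that assms by (auto intro!: has_frechet_derivative)
    have "frechet_derivative g (at (f x)) (frechet_derivative f (at x) w) = D x w" for w
    proof -
      let ?w = "frechet_derivative f (at x) w"
      have "frechet_derivative g (at (f x)) ?w =
          frechet_derivative g (at (f x)) (\<Sum>b\<in>Basis. (?w \<bullet> b) *\<^sub>R b)"
        by (simp only: euclidean_representation)
      then show ?thesis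
        using has_derivative_linear[OF g] by (simp only: linear_sum linear_scale o_def D_def)
    qed
    then have "frechet_derivative g (at (f x)) \<circ> frechet_derivative f (at x) = D x"
      by (simp add: fun_eq_iff)
    then show ?thesis
      using diff_chain_at[OF f g] by (simp only: o_def)
  qed
  moreover have "Ck_on k S (\<lambda>x. D x v)" for v
    unfolding D_def using Suc.prems assms Ck_on_Suc_imp[of S k f]
    by (intro Ck_on_sum Ck_on_scaleR Suc.IH
        Ck_on_bounded_linear[OF bounded_linear_inner_left, where f="\<lambda>x. frechet_derivative f (at x) v"]) auto
  ultimately show ?case using assms by (intro Ck_on_SucI)
qed

lemma Ck_on_inverse:
  fixes f :: "'a::real_normed_vector \<Rightarrow> real"
  shows "open S \<Longrightarrow> (\<And>x. x \<in> S \<Longrightarrow> f x \<noteq> 0) \<Longrightarrow> Ck_on k S f \<Longrightarrow> Ck_on k S (\<lambda>x. inverse (f x))"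
proof (induction k)
  case 0
  then show ?case by (auto intro: continuous_on_inverse)
next
  case (Suc k)
  have "Ck_on k S (\<lambda>x. inverse (f x))"
    using Suc Ck_on_Suc_imp by blast
  then have "Ck_on k S (\<lambda>x. - (inverse (f x) * frechet_derivative f (at x) v * inverse (f x)))" for v
    using Suc.prems
    by (intro Ck_on_bounded_linear[OF bounded_linear_minus[OF bounded_linear_ident]] Ck_on_mult) auto
  then show ?case
    using Suc.prems
    by (intro Ck_on_SucI[where f'="\<lambda>x v. - (inverse (f x) * frechet_derivative f (at x) v * inverse (f x))"])
       (auto intro!: Deriv.has_derivative_inverse has_frechet_derivative)
qed

lemma Ck_on_sqrt:
  fixes f :: "'a::real_normed_vector \<Rightarrow> real"
  shows "open S \<Longrightarrow> (\<And>x. x \<in> S \<Longrightarrow> f x > 0) \<Longrightarrow> Ck_on k S f \<Longrightarrow> Ck_on k S (\<lambda>x. sqrt (f x))"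
proof (induction k)
  case 0
  then show ?case by (auto intro: continuous_on_real_sqrt)
next
  case (Suc k)
  have "Ck_on k S (\<lambda>x. sqrt (f x))"
    using Suc Ck_on_Suc_imp by blast
  moreover have "sqrt (f x) \<noteq> 0" if "x \<in> S" for x
    using Suc.prems(2)[OF that] by simp
  ultimately have "Ck_on k S (\<lambda>x. frechet_derivative f (at x) v * (inverse (sqrt (f x)) * (1/2)))" for v
    using Suc.prems by (intro Ck_on_mult Ck_on_inverse Ck_on_const) auto
  moreover have "((\<lambda>x. sqrt (f x)) has_derivative
      (\<lambda>v. frechet_derivative f (at x) v * (inverse (sqrt (f x)) * (1/2)))) (at x)" if "x \<in> S" for x
  proof -
    have "(f has_derivative frechet_derivative f (at x)) (at x)"
      using Suc.prems that by (auto intro: has_frechet_derivative)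
    moreover have "(sqrt has_derivative (\<lambda>v. v * (inverse (sqrt (f x)) * (1/2)))) (at (f x))"
      using DERIV_real_sqrt[OF Suc.prems(2)[OF that]]
      unfolding has_field_derivative_def by (elim has_derivative_eq_rhs) (auto simp: fun_eq_iff)
    ultimately show ?thesis
      using diff_chain_at[of f _ x sqrt] by (simp add: o_def)
  qed
  ultimately show ?case using Suc.prems by (intro Ck_on_SucI) auto
qed

lemma smooth_on_cong:
  "open S \<Longrightarrow> (\<And>x. x \<in> S \<Longrightarrow> f x = g x) \<Longrightarrow> smooth_on S f \<longleftrightarrow> smooth_on S g"
  unfolding smooth_on_def using Ck_on_cong by blast

lemma smooth_on_subset: "open S \<Longrightarrow> T \<subseteq> S \<Longrightarrow> smooth_on S f \<Longrightarrow> smooth_on T f"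
  unfolding smooth_on_def using Ck_on_subset by blast

lemma smooth_on_local:
  assumes "\<And>x. x \<in> S \<Longrightarrow> \<exists>T. open T \<and> x \<in> T \<and> smooth_on T f"
  shows "smooth_on S f"
  unfolding smooth_on_def using assms by (intro allI Ck_on_local) (auto simp: smooth_on_def)

lemma smooth_on_const: "open S \<Longrightarrow> smooth_on S (\<lambda>x. c)"
  unfolding smooth_on_def using Ck_on_const by blast

lemma smooth_on_id: "open S \<Longrightarrow> smooth_on S (\<lambda>x. x)"
  unfolding smooth_on_def using Ck_on_id by blast

lemma smooth_on_bounded_linear:
  "bounded_linear L \<Longrightarrow> open S \<Longrightarrow> smooth_on S f \<Longrightarrow> smooth_on S (\<lambda>x. L (f x))"
  unfolding smooth_on_def using Ck_on_bounded_linear by blast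

lemma smooth_on_add:
  "open S \<Longrightarrow> smooth_on S f \<Longrightarrow> smooth_on S g \<Longrightarrow> smooth_on S (\<lambda>x. f x + g x)"
  unfolding smooth_on_def using Ck_on_add by blast

lemma smooth_on_sum:
  "open S \<Longrightarrow> (\<And>i. i \<in> I \<Longrightarrow> smooth_on S (f i)) \<Longrightarrow> smooth_on S (\<lambda>x. \<Sum>i\<in>I. f i x)"
  unfolding smooth_on_def using Ck_on_sum[of S I _ f] by blast

lemma smooth_on_mult:
  fixes f g :: "'a::real_normed_vector \<Rightarrow> real"
  shows "open S \<Longrightarrow> smooth_on S f \<Longrightarrow> smooth_on S g \<Longrightarrow> smooth_on S (\<lambda>x. f x * g x)"
  unfolding smooth_on_def using Ck_on_mult by blast

lemma smooth_on_compose: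
  fixes f :: "'a::real_normed_vector \<Rightarrow> 'b::euclidean_space"
  shows "open S \<Longrightarrow> open T \<Longrightarrow> f ` S \<subseteq> T \<Longrightarrow> smooth_on T g \<Longrightarrow> smooth_on S f \<Longrightarrow>
    smooth_on S (\<lambda>x. g (f x))"
  unfolding smooth_on_def using Ck_on_compose by blast

lemma smooth_on_inverse:
  fixes f :: "'a::real_normed_vector \<Rightarrow> real"
  shows "open S \<Longrightarrow> (\<And>x. x \<in> S \<Longrightarrow> f x \<noteq> 0) \<Longrightarrow> smooth_on S f \<Longrightarrow> smooth_on S (\<lambda>x. inverse (f x))"
  unfolding smooth_on_def using Ck_on_inverse[of S f] by blast

lemma smooth_on_sqrt:
  fixes f :: "'a::real_normed_vector \<Rightarrow> real"
  shows "open S \<Longrightarrow> (\<And>x. x \<in> S \<Longrightarrow> f x > 0) \<Longrightarrow> smooth_on S f \<Longrightarrow> smooth_on S (\<lambda>x. sqrt (f x))"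
  unfolding smooth_on_def using Ck_on_sqrt[of S f] by blast

lemma smooth_on_differentiable:
  "open S \<Longrightarrow> smooth_on S f \<Longrightarrow> x \<in> S \<Longrightarrow> (f has_derivative frechet_derivative f (at x)) (at x)"
  unfolding smooth_on_def by (metis Ck_on.simps(2) has_frechet_derivative)

lemma smooth_on_frechet_derivative:
  "smooth_on S f \<Longrightarrow> smooth_on S (\<lambda>x. frechet_derivative f (at x) v)"
  unfolding smooth_on_def by (metis Ck_on.simps(2))

lemma smooth_on_continuous: "smooth_on S f \<Longrightarrow> continuous_on S f"
  unfolding smooth_on_def by (metis Ck_on.simps(1))


subsection \<open>Bump functions\<close>

text \<open>
  All derivatives of the flat function \<open>exp (- 1 / x)\<close> are combinations of members of this family,
  and so the whole family is smooth at once.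
\<close>

definition flat :: "nat \<Rightarrow> real \<Rightarrow> real" where
  "flat n x = (if x > 0 then exp (- (1 / x)) / x ^ n else 0)"

lemma flat_tendsto_0: "(flat n \<longlongrightarrow> 0) (at 0)"
proof -
  have "((\<lambda>t. t ^ n / exp t) \<longlongrightarrow> (0::real)) at_top"
    by (rule tendsto_power_div_exp_0)
  then have "((\<lambda>x. inverse x ^ n / exp (inverse x)) \<longlongrightarrow> (0::real)) (at_right 0)"
    using filterlim_compose filterlim_inverse_at_top_right by blast
  moreover have "flat n x = inverse x ^ n / exp (inverse x)" if "x > 0" for x
    using that by (simp add: flat_def exp_minus field_simps)
  ultimately have "(flat n \<longlongrightarrow> 0) (at_right 0)"
    by (subst tendsto_cong[of _ "\<lambda>x. inverse x ^ n / exp (inverse x)"])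
       (auto simp: eventually_at_right_field intro!: exI[of _ 1])
  moreover have "(flat n \<longlongrightarrow> 0) (at_left 0)"
    by (subst tendsto_cong[of _ "\<lambda>x. 0"])
       (auto simp: eventually_at_left_field flat_def intro!: exI[of _ "-1"])
  ultimately show ?thesis
    by (simp add: filterlim_split_at)
qed

lemma flat_has_derivative:
  "(flat n has_field_derivative flat (n + 2) x - real n * flat (n + 1) x) (at x)"
proof -
  consider "x > 0" | "x < 0" | "x = 0" by linarith
  then show ?thesis
  proof cases
    case 1
    have deriv: "((\<lambda>x. exp (- (1 / x)) / x ^ n) has_field_derivative
        flat (n + 2) x - real n * flat (n + 1) x) (at x)"
    proof (cases n)
      case 0
      then show ?thesis
        using 1 by (auto intro!: derivative_eq_intros simp: flat_def field_simps power2_eq_square)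
    next
      case (Suc m)
      have "((\<lambda>x. x ^ n) has_field_derivative real n * x ^ m) (at x)"
        using DERIV_pow[of n x] Suc by simp
      then have "((\<lambda>x. exp (- (1 / x)) / x ^ n) has_field_derivative
          ((exp (- (1 / x)) * (1 / x\<^sup>2)) * x ^ n - exp (- (1 / x)) * (real n * x ^ m)) / (x ^ n * x ^ n))
          (at x)"
        using 1 by (intro DERIV_divide)
          (auto intro!: derivative_eq_intros simp: field_simps power2_eq_square)
      also have "((exp (- (1 / x)) * (1 / x\<^sup>2)) * x ^ n - exp (- (1 / x)) * (real n * x ^ m)) / (x ^ n * x ^ n)
          = flat (n + 2) x - real n * flat (n + 1) x"
        using 1 Suc by (simp add: flat_def field_simps power2_eq_square)
      finally show ?thesis .
    qed
    show ?thesis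
      by (rule has_field_derivative_transform_within_open[OF deriv, where S="{0<..}"])
         (use 1 in \<open>auto simp: flat_def\<close>)
  next
    case 2
    have "((\<lambda>x. 0) has_field_derivative 0) (at x)" by simp
    then have "(flat n has_field_derivative 0) (at x)"
      by (rule has_field_derivative_transform_within_open[where S="{..<0}"])
         (use 2 in \<open>auto simp: flat_def\<close>)
    then show ?thesis using 2 by (simp add: flat_def)
  next
    case 3
    have "(flat n y - flat n 0) / (y - 0) = flat (Suc n) y" if "y \<noteq> 0" for y
      using that by (simp add: flat_def)
    then have "((\<lambda>y. (flat n y - flat n 0) / (y - 0)) \<longlongrightarrow> 0) (at 0)"
      using flat_tendsto_0[of "Suc n"]
      by (subst tendsto_cong[of _ "flat (Suc n)"]) (auto simp: eventually_at_filter)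
    then show ?thesis using 3 by (simp add: has_field_derivative_iff flat_def)
  qed
qed

lemma smooth_on_flat: "smooth_on UNIV (flat n)"
proof -
  have "Ck_on k UNIV (flat n)" for k
  proof (induction k arbitrary: n)
    case 0
    show ?case
      using DERIV_isCont[OF flat_has_derivative] by (auto simp: continuous_on_eq_continuous_at)
  next
    case (Suc k)
    have "Ck_on k UNIV (\<lambda>x. (flat (n + 2) x + (- real n) * flat (n + 1) x) * v)" for v
      using Suc by (intro Ck_on_mult Ck_on_add Ck_on_const) auto
    then show ?case
      using flat_has_derivative[of n]
      by (intro Ck_on_SucI[where f'="\<lambda>x v. (flat (n + 2) x + (- real n) * flat (n + 1) x) * v"])
         (auto simp: has_field_derivative_def)
  qed
  then show ?thesis by (simp add: smooth_on_def)
qed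

lemma smooth_bump_exists:
  fixes a :: "'a::euclidean_space" and r :: real
  assumes "r > 0"
  obtains \<beta> :: "'a \<Rightarrow> real"
    where "smooth_on UNIV \<beta>" "\<beta> a \<noteq> 0" "\<And>x. x \<notin> cball a r \<Longrightarrow> \<beta> x = 0"
proof
  let ?\<rho> = "\<lambda>x. r\<^sup>2 + - (\<Sum>b\<in>Basis. ((x - a) \<bullet> b) * ((x - a) \<bullet> b))"
  have "smooth_on UNIV (\<lambda>x. ((x + - a) \<bullet> b))" for b :: 'a
    by (intro smooth_on_bounded_linear[OF bounded_linear_inner_left] smooth_on_add smooth_on_id
        smooth_on_const) auto
  then have "smooth_on UNIV ?\<rho>"
    by (intro smooth_on_add smooth_on_const smooth_on_sum smooth_on_mult
        smooth_on_bounded_linear[OF bounded_linear_minus[OF bounded_linear_ident]]) auto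
  then show "smooth_on UNIV (\<lambda>x. flat 0 (?\<rho> x))"
    by (intro smooth_on_compose[OF _ _ _ smooth_on_flat]) auto
  show "flat 0 (?\<rho> a) \<noteq> 0"
    using assms by (simp add: flat_def)
  show "flat 0 (?\<rho> x) = 0" if "x \<notin> cball a r" for x
  proof -
    have "r < norm (x - a)"
      using that by (simp add: dist_norm norm_minus_commute)
    then have "r\<^sup>2 < (norm (x - a))\<^sup>2"
      using assms by (simp add: power_strict_mono)
    then show ?thesis
      by (simp add: flat_def power2_norm_eq_inner euclidean_inner[of "x - a" "x - a"])
  qed
qed


section \<open>Smooth functions and vector fields on a manifold\<close>

locale manifold =
  fixes M :: "('m::{t2_space, second_countable_topology}, 'e::euclidean_space) riemannian"
  assumes smooth_manifold: "smooth_manifold M"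
begin

lemma atlasD:
  assumes "(U, \<phi>) \<in> atlas M"
  shows "open U" "open (\<phi> ` U)" "homeomorphism U (\<phi> ` U) \<phi> (inv_into U \<phi>)"
    "inj_on \<phi> U" "continuous_on U \<phi>" "continuous_on (\<phi> ` U) (inv_into U \<phi>)"
    "\<And>q. q \<in> U \<Longrightarrow> inv_into U \<phi> (\<phi> q) = q"
proof -
  show "open U" "open (\<phi> ` U)" and h: "homeomorphism U (\<phi> ` U) \<phi> (inv_into U \<phi>)"
    using smooth_manifold assms by (auto simp: smooth_manifold_def)
  show "continuous_on U \<phi>" "continuous_on (\<phi> ` U) (inv_into U \<phi>)"
    and inv: "\<And>q. q \<in> U \<Longrightarrow> inv_into U \<phi> (\<phi> q) = q"
    using h by (auto simp: homeomorphism_def)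
  then show "inj_on \<phi> U" by (metis inj_onI)
qed

lemma open_chart_image:
  assumes "(U, \<phi>) \<in> atlas M" "open W" "W \<subseteq> U"
  shows "open (\<phi> ` W)"
  using homeomorphism_imp_open_map[OF atlasD(3)[OF assms(1)], of W] assms atlasD(1,2)[OF assms(1)]
  by (simp add: openin_open_eq)

lemma chart_at: obtains U \<phi> where "(U, \<phi>) \<in> atlas M" "p \<in> U"
proof -
  have "p \<in> (\<Union>(U, \<phi>) \<in> atlas M. U)"
    using smooth_manifold by (simp add: smooth_manifold_def)
  then show thesis using that by blast
qed

lemma transition_smooth:
  assumes "(U, \<phi>) \<in> atlas M" "(V, \<psi>) \<in> atlas M"
  shows "smooth_on (\<phi> ` (U \<inter> V)) (\<lambda>x. \<psi> (inv_into U \<phi> x))"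
proof -
  have "smooth_on (\<phi> ` (U \<inter> V)) (\<psi> \<circ> inv_into U \<phi>)"
    using smooth_manifold assms by (auto simp: smooth_manifold_def)
  then show ?thesis by (simp add: o_def)
qed

lemma smooth_fun_chart:
  "smooth_fun M f \<Longrightarrow> (U, \<phi>) \<in> atlas M \<Longrightarrow> smooth_on (\<phi> ` U) (\<lambda>x. f (inv_into U \<phi> x))"
  by (auto simp: smooth_fun_def o_def)

lemma smooth_funI:
  "(\<And>U \<phi>. (U, \<phi>) \<in> atlas M \<Longrightarrow> smooth_on (\<phi> ` U) (\<lambda>x. f (inv_into U \<phi> x))) \<Longrightarrow> smooth_fun M f"
  by (auto simp: smooth_fun_def o_def)

lemma smooth_funI_local:
  assumes "\<And>p. \<exists>U \<phi> W. (U, \<phi>) \<in> atlas M \<and> open W \<and> p \<in> W \<and> W \<subseteq> U \<and>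
    smooth_on (\<phi> ` W) (\<lambda>x. f (inv_into U \<phi> x))"
  shows "smooth_fun M f"
proof (rule smooth_funI, rule smooth_on_local)
  fix V \<psi> x assume V: "(V, \<psi>) \<in> atlas M" and "x \<in> \<psi> ` V"
  then obtain p where p: "p \<in> V" "x = \<psi> p" by blast
  obtain U \<phi> W where U: "(U, \<phi>) \<in> atlas M" "open W" "p \<in> W" "W \<subseteq> U"
    and f: "smooth_on (\<phi> ` W) (\<lambda>x. f (inv_into U \<phi> x))"
    using assms by meson
  let ?T = "\<psi> ` (V \<inter> W)" and ?t = "\<lambda>x. \<phi> (inv_into V \<psi> x)"
  have "open ?T" "open (\<psi> ` (V \<inter> U))" "open (\<phi> ` W)"
    using open_chart_image[OF V] open_chart_image[OF U(1)] atlasD(1)[OF V] atlasD(1)[OF U(1)] U(2,4)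
    by (auto intro: open_Int)
  moreover have "smooth_on ?T ?t"
    using transition_smooth[OF V U(1)] \<open>open (\<psi> ` (V \<inter> U))\<close> U(4)
    by (auto intro: smooth_on_subset)
  moreover have "?t ` ?T \<subseteq> \<phi> ` W"
    using atlasD(7)[OF V] by auto
  ultimately have "smooth_on ?T (\<lambda>x. f (inv_into U \<phi> (?t x)))"
    using f smooth_on_compose[of ?T "\<phi> ` W" ?t "\<lambda>x. f (inv_into U \<phi> x)"] by blast
  moreover have "f (inv_into V \<psi> y) = f (inv_into U \<phi> (?t y))" if "y \<in> ?T" for y
    using that atlasD(7)[OF V] atlasD(7)[OF U(1)] U(4) by auto
  ultimately have "smooth_on ?T (\<lambda>x. f (inv_into V \<psi> x))"
    using smooth_on_cong[OF \<open>open ?T\<close>, of "\<lambda>x. f (inv_into V \<psi> x)" "\<lambda>x. f (inv_into U \<phi> (?t x))"]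
    by simp
  then show "\<exists>T. open T \<and> x \<in> T \<and> smooth_on T (\<lambda>x. f (inv_into V \<psi> x))"
    using \<open>open ?T\<close> p U(3) by blast
qed

lemma smooth_fun_const [intro, simp]: "smooth_fun M (\<lambda>p. c)"
  by (intro smooth_funI smooth_on_const) (rule atlasD(2))

lemma smooth_fun_add [intro]:
  "smooth_fun M f \<Longrightarrow> smooth_fun M g \<Longrightarrow> smooth_fun M (\<lambda>p. f p + g p)"
  by (rule smooth_funI, rule smooth_on_add) (auto intro: smooth_fun_chart dest: atlasD(2))

lemma smooth_fun_mult [intro]:
  "smooth_fun M f \<Longrightarrow> smooth_fun M g \<Longrightarrow> smooth_fun M (\<lambda>p. f p * g p)"
  by (rule smooth_funI, rule smooth_on_mult) (auto intro: smooth_fun_chart dest: atlasD(2))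

lemma smooth_fun_diff [intro]:
  "smooth_fun M f \<Longrightarrow> smooth_fun M g \<Longrightarrow> smooth_fun M (\<lambda>p. f p - g p)"
  using smooth_fun_add[of f "\<lambda>p. (- 1) * g p"] smooth_fun_mult[of "\<lambda>p. - 1" g] by simp

lemma smooth_fun_power [intro]: "smooth_fun M f \<Longrightarrow> smooth_fun M (\<lambda>p. f p ^ n)"
  by (induction n) auto

lemma smooth_fun_sum [intro]:
  "(\<And>i. i \<in> I \<Longrightarrow> smooth_fun M (f i)) \<Longrightarrow> smooth_fun M (\<lambda>p. \<Sum>i\<in>I. f i p)"
  by (induction I rule: infinite_finite_induct) auto

lemma smooth_fun_prod [intro]:
  "(\<And>i. i \<in> I \<Longrightarrow> smooth_fun M (f i)) \<Longrightarrow> smooth_fun M (\<lambda>p. \<Prod>i\<in>I. f i p)"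
  by (induction I rule: infinite_finite_induct) auto

text \<open>
  Smoothness is local, but with this rule it can be proved without ever leaving the ring of global
  smooth functions.
\<close>

lemma smooth_funI_quotient:
  assumes "\<And>p. \<exists>c u. smooth_fun M c \<and> smooth_fun M u \<and> c p \<noteq> 0 \<and> (\<forall>q. c q \<noteq> 0 \<longrightarrow> c q * f q = u q)"
  shows "smooth_fun M f"
proof (rule smooth_funI, rule smooth_on_local)
  fix U \<phi> x assume U: "(U, \<phi>) \<in> atlas M" and "x \<in> \<phi> ` U"
  obtain c u where c: "smooth_fun M c" "smooth_fun M u" "c (inv_into U \<phi> x) \<noteq> 0"
    and eq: "\<And>q. c q \<noteq> 0 \<Longrightarrow> c q * f q = u q"
    using assms by metis
  let ?c = "\<lambda>x. c (inv_into U \<phi> x)" and ?u = "\<lambda>x. u (inv_into U \<phi> x)"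
  let ?T = "{y \<in> \<phi> ` U. ?c y \<noteq> 0}"
  have smooth: "smooth_on (\<phi> ` U) ?c" "smooth_on (\<phi> ` U) ?u"
    using c U by (auto intro: smooth_fun_chart)
  have "open ?T"
  proof -
    have "open (\<phi> ` U \<inter> ?c -` (- {0}))"
      using smooth_on_continuous[OF smooth(1)] atlasD(2)[OF U]
      by (rule continuous_open_preimage) auto
    then show ?thesis by (simp add: vimage_def Int_def)
  qed
  have "smooth_on ?T (\<lambda>x. inverse (?c x) * ?u x)"
    using \<open>open ?T\<close> smooth atlasD(2)[OF U]
    by (intro smooth_on_mult smooth_on_inverse) (auto intro: smooth_on_subset[of "\<phi> ` U"])
  moreover have "f (inv_into U \<phi> y) = inverse (?c y) * ?u y" if "y \<in> ?T" for y
    using that eq[of "inv_into U \<phi> y"] by (auto simp: field_simps)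
  ultimately have "smooth_on ?T (\<lambda>x. f (inv_into U \<phi> x))"
    using \<open>open ?T\<close> by (subst smooth_on_cong[where g="\<lambda>x. inverse (?c x) * ?u x"]) auto
  then show "\<exists>T. open T \<and> x \<in> T \<and> smooth_on T (\<lambda>x. f (inv_into U \<phi> x))"
    using \<open>open ?T\<close> \<open>x \<in> \<phi> ` U\<close> c(3) by blast
qed

lemma smooth_fun_inverse:
  "smooth_fun M f \<Longrightarrow> (\<And>p. f p \<noteq> 0) \<Longrightarrow> smooth_fun M (\<lambda>p. inverse (f p))"
  by (rule smooth_funI_quotient, intro exI[of _ f] exI[of _ "\<lambda>p. 1"]) auto

lemma smooth_fun_sqrt:
  assumes "smooth_fun M f" "\<And>p. f p > 0"
  shows "smooth_fun M (\<lambda>p. sqrt (f p))"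
proof (rule smooth_funI)
  fix U \<phi> assume "(U, \<phi>) \<in> atlas M"
  then show "smooth_on (\<phi> ` U) (\<lambda>x. sqrt (f (inv_into U \<phi> x)))"
    using assms by (intro smooth_on_sqrt smooth_fun_chart) (auto dest: atlasD(2))
qed

text \<open>
  The image of \<open>K\<close> in \<open>M\<close> is compact and hence closed, since \<open>M\<close> is Hausdorff; so \<open>M\<close> is covered
  by \<open>U\<close> and an open set on which the function is zero.
\<close>

lemma smooth_fun_extend_by_0:
  assumes U: "(U, \<phi>) \<in> atlas M" and u: "smooth_on (\<phi> ` U) u"
    and K: "compact K" "K \<subseteq> \<phi> ` U" "\<And>x. x \<in> \<phi> ` U \<Longrightarrow> x \<notin> K \<Longrightarrow> u x = 0"
  shows "smooth_fun M (\<lambda>q. if q \<in> U then u (\<phi> q) else 0)"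
proof (rule smooth_funI_local)
  let ?f = "\<lambda>q. if q \<in> U then u (\<phi> q) else 0"
  fix p
  show "\<exists>U' \<phi>' W. (U', \<phi>') \<in> atlas M \<and> open W \<and> p \<in> W \<and> W \<subseteq> U' \<and>
      smooth_on (\<phi>' ` W) (\<lambda>x. ?f (inv_into U' \<phi>' x))"
  proof (cases "p \<in> U")
    case True
    have "smooth_on (\<phi> ` U) (\<lambda>x. ?f (inv_into U \<phi> x))"
      using u atlasD(2,7)[OF U] by (subst smooth_on_cong[where g=u]) auto
    then show ?thesis using True U atlasD(1)[OF U] by blast
  next
    case False
    obtain V \<psi> where V: "(V, \<psi>) \<in> atlas M" "p \<in> V" using chart_at .
    let ?K = "inv_into U \<phi> ` K" and ?W = "V - inv_into U \<phi> ` K"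
    have "compact ?K"
      using K(1,2) atlasD(6)[OF U] by (intro compact_continuous_image) (auto intro: continuous_on_subset)
    then have "open ?W"
      using atlasD(1)[OF V(1)] by (intro open_Diff compact_imp_closed)
    have "?K \<subseteq> U"
      using K(2) atlasD(7)[OF U] by auto
    have "?f q = 0" if "q \<in> ?W" for q
    proof (cases "q \<in> U")
      case True
      then have "\<phi> q \<notin> K"
        using that atlasD(7)[OF U True] by (metis DiffD2 imageI)
      then show ?thesis using True K(3) by simp
    qed simp
    then have "?f (inv_into V \<psi> y) = 0" if "y \<in> \<psi> ` ?W" for y
    proof -
      obtain q where "q \<in> ?W" "y = \<psi> q" using \<open>y \<in> \<psi> ` ?W\<close> by blast
      moreover have "inv_into V \<psi> (\<psi> q) = q"
        using \<open>q \<in> ?W\<close> by (intro atlasD(7)[OF V(1)]) simp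
      ultimately show ?thesis
        using \<open>\<And>q. q \<in> ?W \<Longrightarrow> ?f q = 0\<close> by (simp only:)
    qed
    moreover have W: "open (\<psi> ` ?W)"
      using \<open>open ?W\<close> by (intro open_chart_image[OF V(1)]) auto
    ultimately have "smooth_on (\<psi> ` ?W) (\<lambda>x. ?f (inv_into V \<psi> x))"
      using smooth_on_cong[OF W, of "\<lambda>x. ?f (inv_into V \<psi> x)" "\<lambda>x. 0"] smooth_on_const[OF W]
      by simp
    moreover have "p \<in> ?W" "?W \<subseteq> V"
      using False V(2) \<open>?K \<subseteq> U\<close> by auto
    ultimately show ?thesis
      using V(1) \<open>open ?W\<close> by blast
  qed
qed


subsection \<open>Tangent vectors\<close>

lemma dir_deriv_has_derivative:
  assumes "smooth_fun M f" "(U, \<phi>) \<in> atlas M" "p \<in> U"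
  shows "((\<lambda>x. f (inv_into U \<phi> x)) has_derivative (\<lambda>w. dir_deriv M (U, \<phi>) p w f)) (at (\<phi> p))"
  using smooth_on_differentiable[OF atlasD(2) smooth_fun_chart] assms
  by (auto simp: dir_deriv_def o_def)

lemma dir_deriv_not_smooth: "\<not> smooth_fun M f \<Longrightarrow> dir_deriv M c p w f = 0"
  by (simp add: dir_deriv_def)

lemma dir_deriv_eqI:
  assumes "smooth_fun M f" "(U, \<phi>) \<in> atlas M" "p \<in> U"
    "((\<lambda>x. f (inv_into U \<phi> x)) has_derivative D) (at (\<phi> p))"
  shows "dir_deriv M (U, \<phi>) p w f = D w"
  using has_derivative_unique[OF dir_deriv_has_derivative[OF assms(1-3)] assms(4)]
  by (simp add: fun_eq_iff)

lemma linear_dir_deriv: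
  assumes "(U, \<phi>) \<in> atlas M" "p \<in> U"
  shows "linear (dir_deriv M (U, \<phi>) p)"
proof -
  have lin: "linear (\<lambda>w. dir_deriv M (U, \<phi>) p w f)" if "smooth_fun M f" for f
    using dir_deriv_has_derivative[OF that assms] by (rule has_derivative_linear)
  show ?thesis
  proof (rule linearI; rule ext)
    fix v w f
    show "dir_deriv M (U, \<phi>) p (v + w) f = (dir_deriv M (U, \<phi>) p v + dir_deriv M (U, \<phi>) p w) f"
      using linear_add[OF lin] dir_deriv_not_smooth by (cases "smooth_fun M f") auto
  next
    fix r w f
    show "dir_deriv M (U, \<phi>) p (r *\<^sub>R w) f = (r *\<^sub>R dir_deriv M (U, \<phi>) p w) f"
      using linear_scale[OF lin] dir_deriv_not_smooth by (cases "smooth_fun M f") auto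
  qed
qed

lemma dir_deriv_change_chart:
  assumes U: "(U, \<phi>) \<in> atlas M" "p \<in> U" and V: "(V, \<psi>) \<in> atlas M" "p \<in> V"
  shows "dir_deriv M (V, \<psi>) p w =
    dir_deriv M (U, \<phi>) p (frechet_derivative (\<lambda>x. \<phi> (inv_into V \<psi> x)) (at (\<psi> p)) w)"
proof (rule ext)
  fix f
  let ?t = "\<lambda>x. \<phi> (inv_into V \<psi> x)"
  let ?T = "\<psi> ` (V \<inter> U)"
  show "dir_deriv M (V, \<psi>) p w f = dir_deriv M (U, \<phi>) p (frechet_derivative ?t (at (\<psi> p)) w) f"
  proof (cases "smooth_fun M f")
    case True
    have "open ?T"
      using open_chart_image[OF V(1)] atlasD(1)[OF V(1)] atlasD(1)[OF U(1)] by (auto intro: open_Int)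
    then have t: "(?t has_derivative frechet_derivative ?t (at (\<psi> p))) (at (\<psi> p))"
      using transition_smooth[OF V(1) U(1)] U V by (auto intro: smooth_on_differentiable)
    have "((\<lambda>x. f (inv_into U \<phi> x)) has_derivative (\<lambda>w. dir_deriv M (U, \<phi>) p w f)) (at (?t (\<psi> p)))"
      using dir_deriv_has_derivative[OF True U] atlasD(7)[OF V(1)] V by simp
    from diff_chain_at[OF t this]
    have "((\<lambda>x. f (inv_into U \<phi> (?t x))) has_derivative
        (\<lambda>w. dir_deriv M (U, \<phi>) p (frechet_derivative ?t (at (\<psi> p)) w) f)) (at (\<psi> p))"
      by (simp add: o_def)
    then have "((\<lambda>x. f (inv_into V \<psi> x)) has_derivative
        (\<lambda>w. dir_deriv M (U, \<phi>) p (frechet_derivative ?t (at (\<psi> p)) w) f)) (at (\<psi> p))"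
    proof (rule has_derivative_transform_within_open[OF _ \<open>open ?T\<close>])
      show "\<psi> p \<in> ?T" using U V by blast
      show "f (inv_into U \<phi> (?t x)) = f (inv_into V \<psi> x)" if "x \<in> ?T" for x
        using that atlasD(7)[OF V(1)] atlasD(7)[OF U(1)] by auto
    qed
    then show ?thesis by (rule dir_deriv_eqI[OF True V])
  qed (simp add: dir_deriv_not_smooth)
qed

text \<open>
  A tangent vector may come from any chart at its point. By the chain rule a single chart
  yields all of them, which is why they form a vector space.
\<close>

lemma tangent_space_eq_range:
  assumes "(U, \<phi>) \<in> atlas M" "p \<in> U"
  shows "tangent_space M p = range (dir_deriv M (U, \<phi>) p)"
proof
  show "range (dir_deriv M (U, \<phi>) p) \<subseteq> tangent_space M p"
    using assms by (force simp: tangent_space_def)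
  show "tangent_space M p \<subseteq> range (dir_deriv M (U, \<phi>) p)"
    using dir_deriv_change_chart[OF assms] by (auto simp: tangent_space_def)
qed

lemma subspace_tangent: "subspace (tangent_space M p)"
  using chart_at[of p] linear_dir_deriv tangent_space_eq_range
  by (metis linear_subspace_image subspace_UNIV)

lemma tangentE:
  assumes "v \<in> tangent_space M p"
  obtains U \<phi> w where "(U, \<phi>) \<in> atlas M" "p \<in> U" "v = dir_deriv M (U, \<phi>) p w"
  using assms by (auto simp: tangent_space_def)

lemma tangent_not_smooth: "v \<in> tangent_space M p \<Longrightarrow> \<not> smooth_fun M f \<Longrightarrow> v f = 0"
  by (auto simp: tangent_space_def dir_deriv_not_smooth)

lemma tangent_const: "v \<in> tangent_space M p \<Longrightarrow> v (\<lambda>q. c) = 0"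
  by (elim tangentE) (simp add: dir_deriv_eqI[where D="\<lambda>w. 0"])

lemma tangent_mult:
  assumes "v \<in> tangent_space M p" "smooth_fun M f" "smooth_fun M g"
  shows "v (\<lambda>q. f q * g q) = f p * v g + v f * g p"
  using assms(1)
proof (rule tangentE)
  fix U \<phi> w assume U: "(U, \<phi>) \<in> atlas M" "p \<in> U" and v: "v = dir_deriv M (U, \<phi>) p w"
  have "dir_deriv M (U, \<phi>) p w (\<lambda>q. f q * g q) =
      f (inv_into U \<phi> (\<phi> p)) * dir_deriv M (U, \<phi>) p w g + dir_deriv M (U, \<phi>) p w f * g (inv_into U \<phi> (\<phi> p))"
    using U smooth_fun_mult[OF assms(2,3)] dir_deriv_has_derivative[OF assms(2) U]
      dir_deriv_has_derivative[OF assms(3) U]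
    by (intro dir_deriv_eqI[where D="\<lambda>w. f (inv_into U \<phi> (\<phi> p)) * dir_deriv M (U, \<phi>) p w g +
          dir_deriv M (U, \<phi>) p w f * g (inv_into U \<phi> (\<phi> p))"]
        has_derivative_mult)
  then show ?thesis using atlasD(7)[OF U] v by simp
qed

lemma tangent_power2:
  "v \<in> tangent_space M p \<Longrightarrow> smooth_fun M f \<Longrightarrow> v (\<lambda>q. (f q)\<^sup>2) = 2 * f p * v f"
  using tangent_mult[of v p f f] by (simp add: power2_eq_square)

lemmas tangent_simps_closed =
  subspace_add[OF subspace_tangent] subspace_diff[OF subspace_tangent]
  subspace_scale[OF subspace_tangent] subspace_neg[OF subspace_tangent]
  subspace_0[OF subspace_tangent] subspace_sum[OF subspace_tangent]


subsection \<open>Vector fields\<close>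

lemma sections_iff: "X \<in> sections M D \<longleftrightarrow> X \<in> vector_fields M \<and> (\<forall>p. X p \<in> D p)"
  by (auto simp: sections_def)

lemma fieldI:
  "(\<And>p. X p \<in> tangent_space M p) \<Longrightarrow> (\<And>f. smooth_fun M f \<Longrightarrow> smooth_fun M (\<lambda>p. X p f)) \<Longrightarrow>
    X \<in> vector_fields M"
  by (auto simp: sections_def)

lemma field_tangent [simp]: "X \<in> vector_fields M \<Longrightarrow> X p \<in> tangent_space M p"
  by (auto simp: sections_def)

lemma field_smooth: "X \<in> vector_fields M \<Longrightarrow> smooth_fun M f \<Longrightarrow> smooth_fun M (\<lambda>p. X p f)"
  by (simp add: sections_def del: field_tangent)

lemma field_0 [intro, simp]: "0 \<in> vector_fields M"
  by (rule fieldI) (simp_all add: tangent_simps_closed)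

lemma field_scale [intro]:
  assumes "smooth_fun M f" "X \<in> vector_fields M"
  shows "f *\<^sub>F X \<in> vector_fields M"
proof (rule fieldI)
  show "smooth_fun M (\<lambda>p. (f p *\<^sub>R X p) g)" if "smooth_fun M g" for g
    using smooth_fun_mult[OF assms(1) field_smooth[OF assms(2) that]] by simp
qed (use assms in \<open>simp add: tangent_simps_closed\<close>)

lemma field_diff [intro]:
  assumes "X \<in> vector_fields M" "Y \<in> vector_fields M"
  shows "X - Y \<in> vector_fields M"
proof (rule fieldI)
  show "smooth_fun M (\<lambda>p. (X - Y) p f)" if "smooth_fun M f" for f
    using smooth_fun_diff[OF field_smooth field_smooth] assms that by simp
qed (use assms in \<open>simp add: tangent_simps_closed\<close>)

lemma field_add [intro]:
  assumes "X \<in> vector_fields M" "Y \<in> vector_fields M"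
  shows "X + Y \<in> vector_fields M"
proof (rule fieldI)
  show "smooth_fun M (\<lambda>p. (X + Y) p f)" if "smooth_fun M f" for f
    using smooth_fun_add[OF field_smooth field_smooth] assms that by simp
qed (use assms in \<open>simp add: tangent_simps_closed\<close>)

lemma field_sum [intro]:
  "(\<And>i. i \<in> I \<Longrightarrow> X i \<in> vector_fields M) \<Longrightarrow> (\<Sum>i\<in>I. X i) \<in> vector_fields M"
  by (induction I rule: infinite_finite_induct) auto

text \<open>
  Fields defined point by point, such as gradients and horizontal lifts, are shown to be smooth by
  this rule: near each point a multiple of them is a global smooth field.
\<close>

lemma fieldI_quotient:
  assumes "\<And>p. X p \<in> tangent_space M p"
    and "\<And>p. \<exists>c Y. smooth_fun M c \<and> Y \<in> vector_fields M \<and> c p \<noteq> 0 \<and> (\<forall>q. c q \<noteq> 0 \<longrightarrow> c q *\<^sub>R X q = Y q)"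
  shows "X \<in> vector_fields M"
proof (rule fieldI[OF assms(1)], rule smooth_funI_quotient)
  fix f p assume f: "smooth_fun M f"
  obtain c Y where c: "smooth_fun M c" "c p \<noteq> 0" and Y: "Y \<in> vector_fields M"
    and eq: "\<And>q. c q \<noteq> 0 \<Longrightarrow> c q *\<^sub>R X q = Y q"
    using assms(2)[of p] by blast
  have "c q * X q f = Y q f" if "c q \<noteq> 0" for q
    using fun_cong[OF eq[OF that], of f] by simp
  then show "\<exists>c u. smooth_fun M c \<and> smooth_fun M u \<and> c p \<noteq> 0 \<and> (\<forall>q. c q \<noteq> 0 \<longrightarrow> c q * X q f = u q)"
    using c field_smooth[OF Y f] by blast
qed

end


lemma sum_fun_apply: "(\<Sum>i\<in>I. f i) x = (\<Sum>i\<in>I. f i x)"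
  by (induction I rule: infinite_finite_induct) auto

context manifold
begin

subsection \<open>Local frames\<close>

text \<open>
  With a bump function \<open>\<beta>\<close> at \<open>p\<close> and coordinates \<open>y\<^sub>b\<close>, the functions \<open>u\<^sub>b = \<beta> y\<^sub>b\<close> and the
  fields \<open>E\<^sub>b = \<beta> \<partial>\<^sub>b\<close> are global. The coefficient of \<open>E\<^sub>b\<close> below is \<open>\<beta>\<^sup>2 v(y\<^sub>b)\<close>, written by
  means of \<open>\<beta>\<close> and \<open>u\<^sub>b\<close> only, so that the expansion of a tangent vector is a global identity whose
  coefficients are smooth along every vector field.
\<close>

lemma local_frame:
  obtains \<beta> :: "'m \<Rightarrow> real" and u :: "'e \<Rightarrow> 'm \<Rightarrow> real" and E :: "'e \<Rightarrow> 'm field"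
  where "smooth_fun M \<beta>" "\<beta> p \<noteq> 0" "\<And>b. smooth_fun M (u b)" "\<And>b. E b \<in> vector_fields M"
    "\<And>q v. v \<in> tangent_space M q \<Longrightarrow>
       (\<beta> q) ^ 3 *\<^sub>R v = (\<Sum>b\<in>Basis. (\<beta> q * v (u b) - u b q * v \<beta>) *\<^sub>R E b q)"
    "inj (\<lambda>w. \<Sum>b\<in>Basis. (w \<bullet> b) *\<^sub>R E b p)"
proof -
  obtain U \<phi> where U: "(U, \<phi>) \<in> atlas M" and p: "p \<in> U" using chart_at .
  note inv = atlasD(7)[OF U] and open_image = atlasD(2)[OF U]
  obtain r where r: "r > 0" "cball (\<phi> p) r \<subseteq> \<phi> ` U"
    using open_image p open_contains_cball by blast
  obtain \<beta>0 :: "'e \<Rightarrow> real" where \<beta>0: "smooth_on UNIV \<beta>0" "\<beta>0 (\<phi> p) \<noteq> 0" "\<And>x. x \<notin> cball (\<phi> p) r \<Longrightarrow> \<beta>0 x = 0"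
    by (rule smooth_bump_exists[OF r(1), of "\<phi> p"]) blast
  have \<beta>U: "smooth_on (\<phi> ` U) \<beta>0"
    using \<beta>0(1) by (rule smooth_on_subset[rotated 2]) auto
  define ext where "ext w q = (if q \<in> U then \<beta>0 (\<phi> q) * w (\<phi> q) else 0)" for w q
  have ext_smooth: "smooth_fun M (ext w)" if "smooth_on (\<phi> ` U) w" for w
    unfolding ext_def
    using U smooth_on_mult[OF open_image \<beta>U that] compact_cball r(2)
    by (rule smooth_fun_extend_by_0) (simp add: \<beta>0(3))
  define \<beta> where "\<beta> = ext (\<lambda>x. 1)"
  define u where "u b = ext (\<lambda>x. x \<bullet> b)" for b
  define E where "E b q = (if q \<in> U then \<beta>0 (\<phi> q) *\<^sub>R dir_deriv M (U, \<phi>) q b else 0)" for b q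
  have \<beta>: "smooth_fun M \<beta>"
    unfolding \<beta>_def by (intro ext_smooth smooth_on_const open_image)
  have u: "smooth_fun M (u b)" for b
    unfolding u_def
    by (intro ext_smooth smooth_on_bounded_linear[OF bounded_linear_inner_left] smooth_on_id open_image)
  have E: "E b \<in> vector_fields M" for b
  proof (rule fieldI)
    show "E b q \<in> tangent_space M q" for q
    proof (cases "q \<in> U")
      case True
      then have "dir_deriv M (U, \<phi>) q b \<in> tangent_space M q"
        by (simp add: tangent_space_eq_range[OF U])
      then show ?thesis by (simp add: E_def tangent_simps_closed)
    qed (simp add: E_def tangent_simps_closed)
    fix f assume f: "smooth_fun M f"
    have "(\<lambda>q. E b q f) = ext (\<lambda>x. frechet_derivative (\<lambda>x. f (inv_into U \<phi> x)) (at x) b)"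
      using f by (auto simp: E_def ext_def dir_deriv_def o_def)
    then show "smooth_fun M (\<lambda>q. E b q f)"
      by (simp add: ext_smooth smooth_on_frechet_derivative smooth_fun_chart[OF f U])
  qed
  have coeff: "\<beta> q * dir_deriv M (U, \<phi>) q w (u b) - u b q * dir_deriv M (U, \<phi>) q w \<beta> =
      (\<beta> q)\<^sup>2 * (w \<bullet> b)" if q: "q \<in> U" for q w b
  proof -
    let ?D = "frechet_derivative \<beta>0 (at (\<phi> q))"
    have D: "(\<beta>0 has_derivative ?D) (at (\<phi> q))"
      using \<beta>0(1) by (rule smooth_on_differentiable[rotated]) auto
    have "((\<lambda>x. \<beta> (inv_into U \<phi> x)) has_derivative ?D) (at (\<phi> q))"
      by (rule has_derivative_transform_within_open[OF D open_image])
        (use q inv in \<open>auto simp: \<beta>_def ext_def\<close>)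
    then have \<beta>': "dir_deriv M (U, \<phi>) q w \<beta> = ?D w"
      by (rule dir_deriv_eqI[OF \<beta> U q])
    have "((\<lambda>x. \<beta>0 x * (x \<bullet> b)) has_derivative (\<lambda>w. \<beta>0 (\<phi> q) * (w \<bullet> b) + ?D w * (\<phi> q \<bullet> b))) (at (\<phi> q))"
      by (intro has_derivative_mult D has_derivative_inner_left has_derivative_ident)
    then have "((\<lambda>x. u b (inv_into U \<phi> x)) has_derivative
        (\<lambda>w. \<beta>0 (\<phi> q) * (w \<bullet> b) + ?D w * (\<phi> q \<bullet> b))) (at (\<phi> q))"
      by (rule has_derivative_transform_within_open[OF _ open_image])
        (use q inv in \<open>auto simp: u_def ext_def\<close>)
    then have "dir_deriv M (U, \<phi>) q w (u b) = \<beta>0 (\<phi> q) * (w \<bullet> b) + ?D w * (\<phi> q \<bullet> b)"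
      by (rule dir_deriv_eqI[OF u U q])
    then show ?thesis
      unfolding \<beta>' using q
      by (simp add: \<beta>_def u_def ext_def power2_eq_square algebra_simps)
  qed
  have combination: "(\<Sum>b\<in>Basis. (w \<bullet> b) *\<^sub>R E b q) = \<beta> q *\<^sub>R dir_deriv M (U, \<phi>) q w"
    if q: "q \<in> U" for q w
  proof -
    note lin = linear_dir_deriv[OF U q]
    have "dir_deriv M (U, \<phi>) q w = dir_deriv M (U, \<phi>) q (\<Sum>b\<in>Basis. (w \<bullet> b) *\<^sub>R b)"
      by (simp only: euclidean_representation)
    also have "\<dots> = (\<Sum>b\<in>Basis. (w \<bullet> b) *\<^sub>R dir_deriv M (U, \<phi>) q b)"
      using lin by (simp only: linear_sum linear_scale o_def)
    finally show ?thesis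
      using q by (simp add: E_def \<beta>_def ext_def scaleR_sum_right mult.commute)
  qed
  have expansion: "(\<beta> q) ^ 3 *\<^sub>R v = (\<Sum>b\<in>Basis. (\<beta> q * v (u b) - u b q * v \<beta>) *\<^sub>R E b q)"
    if v: "v \<in> tangent_space M q" for q v
  proof (cases "q \<in> U")
    case True
    then obtain w where w: "v = dir_deriv M (U, \<phi>) q w"
      using tangent_space_eq_range[OF U] v by auto
    have "(\<Sum>b\<in>Basis. (\<beta> q * v (u b) - u b q * v \<beta>) *\<^sub>R E b q) =
        (\<beta> q)\<^sup>2 *\<^sub>R (\<Sum>b\<in>Basis. (w \<bullet> b) *\<^sub>R E b q)"
      by (simp only: w coeff[OF True] scaleR_sum_right scaleR_scaleR)
    also have "\<dots> = (\<beta> q) ^ 3 *\<^sub>R v"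
      by (simp only: combination[OF True] w scaleR_scaleR) (simp add: power2_eq_square power3_eq_cube)
    finally show ?thesis by simp
  qed (simp add: \<beta>_def ext_def E_def)
  have "\<beta> p \<noteq> 0"
    using \<beta>0(2) p by (simp add: \<beta>_def ext_def)
  have "inj (\<lambda>w. \<beta> p *\<^sub>R dir_deriv M (U, \<phi>) p w)"
  proof (rule linear_injective_0[THEN iffD2, rule_format])
    show "linear (\<lambda>w. \<beta> p *\<^sub>R dir_deriv M (U, \<phi>) p w)"
      by (intro linear_compose_scale_right linear_dir_deriv U p)
    fix w assume "\<beta> p *\<^sub>R dir_deriv M (U, \<phi>) p w = 0"
    then have "dir_deriv M (U, \<phi>) p w = 0"
      using \<open>\<beta> p \<noteq> 0\<close> by simp
    then show "w = 0"
      using coeff[OF p, of w] \<open>\<beta> p \<noteq> 0\<close> by (simp add: euclidean_eq_iff[of w 0])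
  qed
  then have "inj (\<lambda>w. \<Sum>b\<in>Basis. (w \<bullet> b) *\<^sub>R E b p)"
    by (simp only: combination[OF p])
  then show thesis
    using that \<beta> \<open>\<beta> p \<noteq> 0\<close> u E expansion by blast
qed

lemma nonvanishing_field: obtains X where "X \<in> vector_fields M" "X p \<noteq> 0"
proof -
  obtain \<beta> u and E :: "'e \<Rightarrow> 'm field" where E: "\<And>b. E b \<in> vector_fields M"
    "inj (\<lambda>w. \<Sum>b\<in>Basis. (w \<bullet> b) *\<^sub>R E b p)"
    by (rule local_frame[of p]) blast
  obtain b :: 'e where b: "b \<in> Basis" using nonempty_Basis by blast
  have "(\<Sum>c\<in>Basis. (b \<bullet> c) *\<^sub>R E c p) = (\<Sum>c\<in>Basis. if c = b then E b p else 0)"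
    using b by (intro sum.cong) (auto simp: inner_Basis)
  then have "(\<Sum>c\<in>Basis. (b \<bullet> c) *\<^sub>R E c p) = E b p"
    using b by simp
  moreover have "(\<Sum>c\<in>Basis. (b \<bullet> c) *\<^sub>R E c p) \<noteq> (\<Sum>c\<in>Basis. (0 \<bullet> c) *\<^sub>R E c p)"
    using inj_eq[OF E(2), of b 0] nonzero_Basis[OF b] by simp
  ultimately show thesis using that E(1) by fastforce
qed

lemma field_through:
  assumes v: "v \<in> tangent_space M p"
  obtains X where "X \<in> vector_fields M" "X p = v"
proof -
  obtain \<beta> u and E :: "'e \<Rightarrow> 'm field" where \<beta>: "\<beta> p \<noteq> 0" and E: "\<And>b. E b \<in> vector_fields M"
    and expansion: "\<And>q v. v \<in> tangent_space M q \<Longrightarrow>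
       (\<beta> q) ^ 3 *\<^sub>R v = (\<Sum>b\<in>Basis. (\<beta> q * v (u b) - u b q * v \<beta>) *\<^sub>R E b q)"
    by (rule local_frame[of p]) blast
  define k where "k b = (\<beta> p * v (u b) - u b p * v \<beta>) / (\<beta> p) ^ 3" for b
  let ?X = "\<Sum>b\<in>Basis. (\<lambda>q. k b) *\<^sub>F E b"
  have "?X p = (\<Sum>b\<in>Basis. k b *\<^sub>R E b p)"
    by (simp only: sum_fun_apply[of _ Basis p])
  also have "\<dots> = inverse ((\<beta> p) ^ 3) *\<^sub>R (\<Sum>b\<in>Basis. (\<beta> p * v (u b) - u b p * v \<beta>) *\<^sub>R E b p)"
    by (simp add: k_def scaleR_sum_right divide_inverse mult.commute)
  also have "\<dots> = v"
    using \<beta> by (simp flip: expansion[OF v])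
  finally have "?X p = v" .
  moreover have "?X \<in> vector_fields M"
    by (intro field_sum field_scale smooth_fun_const E)
  ultimately show thesis using that by blast
qed

lemma finite_span_tangent: obtains B where "finite B" "tangent_space M p = span B"
proof -
  obtain U \<phi> where U: "(U, \<phi>) \<in> atlas M" "p \<in> U" by (rule chart_at[of p])
  have "tangent_space M p = dir_deriv M (U, \<phi>) p ` span Basis"
    by (simp add: tangent_space_eq_range[OF U])
  also have "\<dots> = span (dir_deriv M (U, \<phi>) p ` Basis)"
    by (rule linear_span_image[OF linear_dir_deriv[OF U], symmetric])
  finally show thesis by (intro that[of "dir_deriv M (U, \<phi>) p ` Basis"]) simp_all
qed

end


section \<open>Riemannian manifolds\<close>

locale riemannian_mfd = manifold M
  for M :: "('m::{t2_space, second_countable_topology}, 'e::euclidean_space) riemannian" +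
  assumes riemannian_metric: "riemannian_metric M"
    and levi_civita: "levi_civita M"
begin

lemma metric_sym:
  "u \<in> tangent_space M p \<Longrightarrow> v \<in> tangent_space M p \<Longrightarrow> metric M p u v = metric M p v u"
  using riemannian_metric by (simp add: riemannian_metric_def)

lemma metric_comb:
  assumes "u \<in> tangent_space M p" "v \<in> tangent_space M p" "w \<in> tangent_space M p"
  shows "metric M p (a *\<^sub>R u + b *\<^sub>R v) w = a * metric M p u w + b * metric M p v w"
  using riemannian_metric assms by (simp add: riemannian_metric_def)

lemma metric_add_left:
  "u \<in> tangent_space M p \<Longrightarrow> v \<in> tangent_space M p \<Longrightarrow> w \<in> tangent_space M p \<Longrightarrow>
    metric M p (u + v) w = metric M p u w + metric M p v w"
  using metric_comb[of u p v w 1 1] by simp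

lemma metric_diff_left:
  "u \<in> tangent_space M p \<Longrightarrow> v \<in> tangent_space M p \<Longrightarrow> w \<in> tangent_space M p \<Longrightarrow>
    metric M p (u - v) w = metric M p u w - metric M p v w"
  using metric_comb[of u p v w 1 "-1"] by simp

lemma metric_scale_left:
  "u \<in> tangent_space M p \<Longrightarrow> w \<in> tangent_space M p \<Longrightarrow>
    metric M p (a *\<^sub>R u) w = a * metric M p u w"
  using metric_comb[of u p u w a 0] by simp

lemma metric_minus_left:
  "u \<in> tangent_space M p \<Longrightarrow> w \<in> tangent_space M p \<Longrightarrow> metric M p (- u) w = - metric M p u w"
  using metric_scale_left[of u p w "-1"] by simp

lemma metric_zero_left: "w \<in> tangent_space M p \<Longrightarrow> metric M p 0 w = 0"
  using metric_scale_left[of w p w 0] by simp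

lemmas metric_linear_left =
  metric_add_left metric_diff_left metric_scale_left metric_minus_left metric_zero_left

lemma metric_add_right:
  "u \<in> tangent_space M p \<Longrightarrow> v \<in> tangent_space M p \<Longrightarrow> w \<in> tangent_space M p \<Longrightarrow>
    metric M p w (u + v) = metric M p w u + metric M p w v"
  using metric_sym[of w p "u + v"] metric_sym[of w p u] metric_sym[of w p v]
  by (simp add: metric_add_left tangent_simps_closed)

lemma metric_scale_right:
  "u \<in> tangent_space M p \<Longrightarrow> w \<in> tangent_space M p \<Longrightarrow>
    metric M p w (a *\<^sub>R u) = a * metric M p w u"
  using metric_sym[of w p "a *\<^sub>R u"] metric_sym[of w p u]
  by (simp add: metric_scale_left tangent_simps_closed)

lemma metric_minus_right:
  "u \<in> tangent_space M p \<Longrightarrow> w \<in> tangent_space M p \<Longrightarrow> metric M p w (- u) = - metric M p w u"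
  using metric_scale_right[of u p w "-1"] by simp

lemma metric_diff_right:
  "u \<in> tangent_space M p \<Longrightarrow> v \<in> tangent_space M p \<Longrightarrow> w \<in> tangent_space M p \<Longrightarrow>
    metric M p w (u - v) = metric M p w u - metric M p w v"
  using metric_add_right[of u p "- v" w] by (simp add: metric_minus_right tangent_simps_closed)

lemma metric_zero_right: "w \<in> tangent_space M p \<Longrightarrow> metric M p w 0 = 0"
  using metric_scale_right[of w p w 0] by simp

lemmas metric_linear_right =
  metric_add_right metric_diff_right metric_scale_right metric_minus_right metric_zero_right

lemma metric_sum_left:
  assumes "\<And>i. i \<in> I \<Longrightarrow> u i \<in> tangent_space M p" "w \<in> tangent_space M p"
  shows "metric M p (\<Sum>i\<in>I. u i) w = (\<Sum>i\<in>I. metric M p (u i) w)"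
  using assms(1)
proof (induction I rule: infinite_finite_induct)
  case (insert x F)
  have "metric M p (u x + sum u F) w = metric M p (u x) w + metric M p (sum u F) w"
    using assms(2) insert.prems by (intro metric_add_left) (auto intro: tangent_simps_closed)
  then show ?case
    using insert.IH insert.prems by (simp only: sum.insert[OF insert.hyps]) simp
qed (use metric_zero_left[OF assms(2)] in auto)

lemma metric_self_eq_0_iff: "u \<in> tangent_space M p \<Longrightarrow> metric M p u u = 0 \<longleftrightarrow> u = 0"
  using riemannian_metric metric_zero_left[of u p]
  by (auto simp: riemannian_metric_def) (metis less_irrefl)

lemma metric_smooth:
  "X \<in> vector_fields M \<Longrightarrow> Y \<in> vector_fields M \<Longrightarrow> smooth_fun M (\<lambda>p. metric M p (X p) (Y p))"
  using riemannian_metric by (simp add: riemannian_metric_def)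

lemma metric_eqI:
  assumes "u \<in> tangent_space M p" "v \<in> tangent_space M p"
    "\<And>w. w \<in> tangent_space M p \<Longrightarrow> metric M p u w = metric M p v w"
  shows "u = v"
proof -
  have "u - v \<in> tangent_space M p" using assms by (simp add: tangent_simps_closed)
  then have "metric M p (u - v) (u - v) = 0"
    using assms by (simp add: metric_linear_left)
  then show ?thesis
    using metric_self_eq_0_iff[OF \<open>u - v \<in> _\<close>] by simp
qed


subsection \<open>The gradient\<close>

text \<open>
  Orthogonality is demanded at every point, but the fields in \<open>Q\<close> may vanish away from \<open>p\<close>, and
  they need to span the fields \<open>E i\<close> only where \<open>c\<close> is nonzero. This leaves room for a construction
  by global fields.
\<close>

definition orthogonalises ::
    "'m \<Rightarrow> ('i \<Rightarrow> 'm field) \<Rightarrow> 'i set \<Rightarrow> ('m \<Rightarrow> real) \<Rightarrow> 'm field set \<Rightarrow> bool" where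
  "orthogonalises p E I c Q \<longleftrightarrow>
     smooth_fun M c \<and> c p \<noteq> 0 \<and> finite Q \<and> (\<forall>X\<in>Q. X \<in> vector_fields M) \<and>
     (\<forall>X\<in>Q. \<forall>Y\<in>Q. \<forall>q. X \<noteq> Y \<longrightarrow> metric M q (X q) (Y q) = 0) \<and>
     (\<forall>X\<in>Q. X p \<noteq> 0) \<and> (\<forall>X\<in>Q. X p \<in> span ((\<lambda>i. E i p) ` I)) \<and>
     (\<forall>q. \<forall>i\<in>I. c q *\<^sub>R E i q \<in> span ((\<lambda>X. X q) ` Q))"

text \<open>
  Gram-Schmidt orthogonalisation, with denominators cleared so that it stays among global vector
  fields. The factor \<open>c\<close> collects the squared lengths that would be divided by; they are nonzero at
  \<open>p\<close> because the \<open>E i p\<close> are independent.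
\<close>

lemma gram_schmidt:
  assumes "finite I"
  shows "(\<And>i. i \<in> I \<Longrightarrow> E i \<in> vector_fields M) \<Longrightarrow> inj_on (\<lambda>i. E i p) I \<Longrightarrow>
    independent ((\<lambda>i. E i p) ` I) \<Longrightarrow> \<exists>c Q. orthogonalises p E I c Q"
  using assms
proof (induction I)
  case empty
  show ?case
    by (intro exI[of _ "\<lambda>p. 1"] exI[of _ "{}"]) (simp add: orthogonalises_def)
next
  case (insert i I)
  have indep: "independent ((\<lambda>i. E i p) ` I)"
    using insert.prems(3) by (rule independent_mono) auto
  have inj: "inj_on (\<lambda>i. E i p) I"
    using insert.prems(2) by (rule inj_on_subset) auto
  obtain c Q where cQ: "orthogonalises p E I c Q"
    using insert.IH[OF _ inj indep] insert.prems(1) by auto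
  then have c: "smooth_fun M c" "c p \<noteq> 0"
    and Q: "finite Q" "\<And>X. X \<in> Q \<Longrightarrow> X \<in> vector_fields M"
      "\<And>X Y q. X \<in> Q \<Longrightarrow> Y \<in> Q \<Longrightarrow> X \<noteq> Y \<Longrightarrow> metric M q (X q) (Y q) = 0"
      "\<And>X. X \<in> Q \<Longrightarrow> X p \<noteq> 0" "\<And>X. X \<in> Q \<Longrightarrow> X p \<in> span ((\<lambda>i. E i p) ` I)"
    and spans: "\<And>q j. j \<in> I \<Longrightarrow> c q *\<^sub>R E j q \<in> span ((\<lambda>X. X q) ` Q)"
    by (simp_all add: orthogonalises_def)
  have Ei: "E i \<in> vector_fields M" using insert.prems(1) by simp
  have not_in_span: "E i p \<notin> span ((\<lambda>i. E i p) ` I)"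
  proof -
    have "E i p \<notin> (\<lambda>i. E i p) ` I"
      using insert.prems(2) insert.hyps(2) by (auto simp: inj_on_def)
    then show ?thesis
      using insert.prems(3) by (simp add: independent_insert)
  qed
  define n where "n X q = metric M q (X q) (X q)" for X q
  define m where "m q = (\<Prod>X\<in>Q. n X q)" for q
  define k where "k X q = (\<Prod>Y\<in>Q - {X}. n Y q) * metric M q (E i q) (X q)" for X q
  define X' where "X' = m *\<^sub>F E i - (\<Sum>X\<in>Q. k X *\<^sub>F X)"
  have n: "smooth_fun M (n X)" if "X \<in> Q" for X
    unfolding n_def using that Q(2) by (intro metric_smooth)
  have m: "smooth_fun M m"
    unfolding m_def using n by (intro smooth_fun_prod)
  have k: "smooth_fun M (k X)" if "X \<in> Q" for X
    unfolding k_def using n that Q(2) Ei by (intro smooth_fun_mult smooth_fun_prod metric_smooth) auto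
  have X': "X' \<in> vector_fields M"
    unfolding X'_def using m k Q(2) Ei by (intro field_diff field_sum field_scale)
  have X'_eq: "X' q = m q *\<^sub>R E i q - (\<Sum>X\<in>Q. k X q *\<^sub>R X q)" for q
    by (simp add: X'_def sum_fun_apply)
  have m_eq: "m q = n X q * (\<Prod>Y\<in>Q - {X}. n Y q)" if "X \<in> Q" for X q
    unfolding m_def using Q(1) that by (rule prod.remove)
  have orth: "metric M q (X' q) (Y q) = 0" if Y: "Y \<in> Q" for Y q
  proof -
    have "metric M q (\<Sum>X\<in>Q. k X q *\<^sub>R X q) (Y q) = (\<Sum>X\<in>Q. k X q * metric M q (X q) (Y q))"
      using Q(2) Y by (simp add: metric_sum_left tangent_simps_closed metric_linear_left)
    also have "\<dots> = (\<Sum>X\<in>Q. if X = Y then k Y q * n Y q else 0)"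
      using Q(3) Y by (intro sum.cong) (auto simp: n_def)
    also have "\<dots> = k Y q * n Y q"
      using Q(1) Y by simp
    finally show ?thesis
      using Q(2) Y Ei m_eq[OF Y, of q]
      by (simp add: X'_eq metric_linear_left tangent_simps_closed k_def)
  qed
  have "m p \<noteq> 0"
    unfolding m_def n_def using Q(1,2,4) by (simp add: metric_self_eq_0_iff)
  have combination_in_span: "(\<Sum>X\<in>Q. k X p *\<^sub>R X p) \<in> span ((\<lambda>i. E i p) ` I)"
    using Q(5) by (intro span_sum span_scale)
  have "X' p \<noteq> 0"
  proof
    assume "X' p = 0"
    then have "m p *\<^sub>R E i p \<in> span ((\<lambda>i. E i p) ` I)"
      using combination_in_span by (simp add: X'_eq)
    then have "inverse (m p) *\<^sub>R (m p *\<^sub>R E i p) \<in> span ((\<lambda>i. E i p) ` I)"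
      by (rule span_scale)
    then show False using not_in_span \<open>m p \<noteq> 0\<close> by simp
  qed
  let ?c = "\<lambda>q. c q * m q" and ?Q = "insert X' Q"
  have mono: "span ((\<lambda>i. E i p) ` I) \<subseteq> span ((\<lambda>i. E i p) ` insert i I)"
    by (intro span_mono) auto
  have X'_span: "X' p \<in> span ((\<lambda>i. E i p) ` insert i I)"
    unfolding X'_eq using combination_in_span mono
    by (intro span_diff span_scale) (auto intro: span_base)
  have spans': "?c q *\<^sub>R E j q \<in> span ((\<lambda>X. X q) ` ?Q)" if j: "j \<in> insert i I" for q j
  proof (cases "j = i")
    case True
    have "?c q *\<^sub>R E i q = c q *\<^sub>R (X' q + (\<Sum>X\<in>Q. k X q *\<^sub>R X q))"
      by (simp add: X'_eq)
    also have "\<dots> \<in> span ((\<lambda>X. X q) ` ?Q)"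
      by (intro span_scale span_add span_sum span_base) auto
    finally show ?thesis using True by simp
  next
    case False
    have "m q *\<^sub>R (c q *\<^sub>R E j q) \<in> span ((\<lambda>X. X q) ` Q)"
      by (rule span_scale, rule spans) (use False j in auto)
    moreover have "span ((\<lambda>X. X q) ` Q) \<subseteq> span ((\<lambda>X. X q) ` ?Q)"
      by (intro span_mono) auto
    ultimately show ?thesis by (simp add: mult.commute subset_iff)
  qed
  have "metric M q (X q) (Y q) = 0" if "X \<in> ?Q" "Y \<in> ?Q" "X \<noteq> Y" for X Y q
    using that orth Q(2,3) X' metric_sym[of "X q" q "Y q"] by auto
  moreover have "X p \<in> span ((\<lambda>i. E i p) ` insert i I)" if "X \<in> ?Q" for X
    using that Q(5) X'_span mono by auto
  moreover have "smooth_fun M ?c" using c m by (intro smooth_fun_mult)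
  moreover have "?c p \<noteq> 0" using c \<open>m p \<noteq> 0\<close> by simp
  moreover have "X \<in> vector_fields M" "X p \<noteq> 0" if "X \<in> ?Q" for X
    using that Q(2,4) X' \<open>X' p \<noteq> 0\<close> by auto
  ultimately have "orthogonalises p E (insert i I) ?c ?Q"
    unfolding orthogonalises_def using Q(1) spans' by simp
  then show ?case by blast
qed

text \<open>
  In an orthogonal frame the gradient is given by Fourier coefficients. The formula shows both that
  the gradient exists and that it is smooth.
\<close>

lemma gradient_local_formula:
  obtains \<beta> Q where "smooth_fun M \<beta>" "\<beta> p \<noteq> 0" "finite Q" "\<And>X. X \<in> Q \<Longrightarrow> X \<in> vector_fields M"
    "\<And>X. X \<in> Q \<Longrightarrow> X p \<noteq> 0"
    "\<And>q f w. \<beta> q \<noteq> 0 \<Longrightarrow> \<forall>X\<in>Q. X q \<noteq> 0 \<Longrightarrow> w \<in> tangent_space M q \<Longrightarrow>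
      metric M q (\<Sum>X\<in>Q. (X q f / metric M q (X q) (X q)) *\<^sub>R X q) w = w f"
proof -
  obtain \<beta> u and E :: "'e \<Rightarrow> 'm field" where \<beta>: "smooth_fun M \<beta>" "\<beta> p \<noteq> 0"
    and E: "\<And>b. E b \<in> vector_fields M"
    and expansion: "\<And>q v. v \<in> tangent_space M q \<Longrightarrow>
       (\<beta> q) ^ 3 *\<^sub>R v = (\<Sum>b\<in>Basis. (\<beta> q * v (u b) - u b q * v \<beta>) *\<^sub>R E b q)"
    and inj: "inj (\<lambda>w. \<Sum>b\<in>Basis. (w \<bullet> b) *\<^sub>R E b p)"
    by (rule local_frame[of p]) blast
  let ?L = "\<lambda>w. \<Sum>b\<in>Basis. (w \<bullet> b) *\<^sub>R E b p"
  have lin: "linear ?L"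
    by (auto intro!: linearI simp: inner_add_left scaleR_left_distrib sum.distrib scaleR_sum_right)
  have L: "?L b = E b p" if "b \<in> Basis" for b
  proof -
    have "?L b = (\<Sum>c\<in>Basis. if c = b then E b p else 0)"
      using that by (intro sum.cong) (auto simp: inner_Basis)
    then show ?thesis using that by simp
  qed
  have "independent (?L ` Basis)"
    using linear_independent_injective_image[OF lin independent_Basis] inj by simp
  then have "independent ((\<lambda>b. E b p) ` Basis)"
    using L by (metis (no_types, lifting) image_cong)
  moreover have "inj_on (\<lambda>b. E b p) Basis"
    using L inj by (auto simp: inj_on_def)
  ultimately obtain c Q where "orthogonalises p E Basis c Q"
    using gram_schmidt[OF finite_Basis, of E p] E by blast
  then have c: "smooth_fun M c" "c p \<noteq> 0" and Q: "finite Q" "\<And>X. X \<in> Q \<Longrightarrow> X \<in> vector_fields M"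
      "\<And>X Y q. X \<in> Q \<Longrightarrow> Y \<in> Q \<Longrightarrow> X \<noteq> Y \<Longrightarrow> metric M q (X q) (Y q) = 0"
      "\<And>X. X \<in> Q \<Longrightarrow> X p \<noteq> 0"
    and spans: "\<And>q b. b \<in> Basis \<Longrightarrow> c q *\<^sub>R E b q \<in> span ((\<lambda>X. X q) ` Q)"
    by (simp_all add: orthogonalises_def subset_iff)
  have "metric M q (\<Sum>X\<in>Q. (X q f / metric M q (X q) (X q)) *\<^sub>R X q) w = w f"
    if q: "\<beta> q * c q \<noteq> 0" "\<forall>X\<in>Q. X q \<noteq> 0" and w: "w \<in> tangent_space M q" for q f w
  proof -
    let ?G = "\<Sum>X\<in>Q. (X q f / metric M q (X q) (X q)) *\<^sub>R X q"
    have tangent: "X q \<in> tangent_space M q" if "X \<in> Q" for X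
      using that Q(2) by auto
    have G: "?G \<in> tangent_space M q"
      using tangent by (auto intro: tangent_simps_closed)
    have "metric M q ?G (Y q) = Y q f" if Y: "Y \<in> Q" for Y
    proof -
      have "metric M q ?G (Y q) = (\<Sum>X\<in>Q. X q f / metric M q (X q) (X q) * metric M q (X q) (Y q))"
        using tangent Y by (simp add: metric_sum_left tangent_simps_closed metric_linear_left)
      also have "\<dots> = (\<Sum>X\<in>Q. if X = Y then Y q f else 0)"
        using Q(3) Y q(2) tangent by (intro sum.cong) (auto simp: metric_self_eq_0_iff)
      finally show ?thesis using Y Q(1) by simp
    qed
    moreover have "subspace {w \<in> tangent_space M q. metric M q ?G w = w f}"
      using G by (auto simp: subspace_def tangent_simps_closed metric_linear_right)
    ultimately have "span ((\<lambda>X. X q) ` Q) \<subseteq> {w \<in> tangent_space M q. metric M q ?G w = w f}"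
      using tangent by (intro span_minimal) auto
    moreover have "w \<in> span ((\<lambda>X. X q) ` Q)"
    proof -
      have "(c q * \<beta> q ^ 3) *\<^sub>R w = (\<Sum>b\<in>Basis. (\<beta> q * w (u b) - u b q * w \<beta>) *\<^sub>R (c q *\<^sub>R E b q))"
        using expansion[OF w] by (simp add: scaleR_sum_right scaleR_scaleR[symmetric] del: scaleR_scaleR)
          (simp add: scaleR_sum_right mult.commute)
      also have "\<dots> \<in> span ((\<lambda>X. X q) ` Q)"
        by (rule span_sum, rule span_scale, rule spans)
      finally have "inverse (c q * \<beta> q ^ 3) *\<^sub>R ((c q * \<beta> q ^ 3) *\<^sub>R w) \<in> span ((\<lambda>X. X q) ` Q)"
        by (rule span_scale)
      moreover have "inverse (c q * \<beta> q ^ 3) * (c q * \<beta> q ^ 3) = 1"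
        using q(1) by (intro left_inverse) simp
      ultimately show ?thesis by (simp only: scaleR_scaleR scaleR_one)
    qed
    ultimately show ?thesis by blast
  qed
  moreover have "smooth_fun M (\<lambda>q. \<beta> q * c q)" using \<beta> c by (intro smooth_fun_mult)
  ultimately show thesis
    using that[of "\<lambda>q. \<beta> q * c q" Q] \<beta>(2) c(2) Q by auto
qed

lemma gradient_eqI:
  assumes "v \<in> tangent_space M p" "\<And>w. w \<in> tangent_space M p \<Longrightarrow> metric M p v w = w f"
  shows "gradient M f p = v"
  unfolding gradient_def
  using assms by (intro the_equality) (auto intro: metric_eqI)

lemma
  shows gradient_tangent: "gradient M f p \<in> tangent_space M p"
    and gradient_metric: "w \<in> tangent_space M p \<Longrightarrow> metric M p (gradient M f p) w = w f"
proof -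
  obtain \<beta> :: "'m \<Rightarrow> real" and Q where Q: "\<beta> p \<noteq> 0" "\<And>X. X \<in> Q \<Longrightarrow> X \<in> vector_fields M" "\<And>X. X \<in> Q \<Longrightarrow> X p \<noteq> 0"
    "\<And>q f w. \<beta> q \<noteq> 0 \<Longrightarrow> \<forall>X\<in>Q. X q \<noteq> 0 \<Longrightarrow> w \<in> tangent_space M q \<Longrightarrow>
      metric M q (\<Sum>X\<in>Q. (X q f / metric M q (X q) (X q)) *\<^sub>R X q) w = w f"
    by (rule gradient_local_formula[of p]) blast
  let ?G = "\<Sum>X\<in>Q. (X p f / metric M p (X p) (X p)) *\<^sub>R X p"
  have G: "?G \<in> tangent_space M p" "\<And>w. w \<in> tangent_space M p \<Longrightarrow> metric M p ?G w = w f"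
    using Q by (auto intro!: tangent_simps_closed)
  then have "gradient M f p = ?G" by (rule gradient_eqI)
  then show "gradient M f p \<in> tangent_space M p"
    "w \<in> tangent_space M p \<Longrightarrow> metric M p (gradient M f p) w = w f"
    using G by simp_all
qed

lemma gradient_field:
  assumes f: "smooth_fun M f"
  shows "gradient M f \<in> vector_fields M"
proof (rule fieldI[OF gradient_tangent], rule smooth_funI_quotient)
  fix h p assume h: "smooth_fun M h"
  obtain \<beta> Q where \<beta>: "smooth_fun M \<beta>" "\<beta> p \<noteq> 0" and Q: "finite Q" "\<And>X. X \<in> Q \<Longrightarrow> X \<in> vector_fields M"
    "\<And>X. X \<in> Q \<Longrightarrow> X p \<noteq> 0"
    "\<And>q f w. \<beta> q \<noteq> 0 \<Longrightarrow> \<forall>X\<in>Q. X q \<noteq> 0 \<Longrightarrow> w \<in> tangent_space M q \<Longrightarrow>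
      metric M q (\<Sum>X\<in>Q. (X q f / metric M q (X q) (X q)) *\<^sub>R X q) w = w f"
    using gradient_local_formula[of p] by blast
  define n where "n X q = metric M q (X q) (X q)" for X q
  let ?c = "\<lambda>q. \<beta> q * (\<Prod>X\<in>Q. n X q)"
  let ?u = "\<lambda>q. \<Sum>X\<in>Q. \<beta> q * (\<Prod>Y\<in>Q - {X}. n Y q) * (X q f * X q h)"
  have n: "smooth_fun M (n X)" if "X \<in> Q" for X
    unfolding n_def using that Q(2) by (intro metric_smooth)
  have "smooth_fun M ?c"
    using n \<beta> by (intro smooth_fun_mult smooth_fun_prod)
  moreover have "smooth_fun M ?u"
  proof (rule smooth_fun_sum)
    fix X assume "X \<in> Q"
    then have "smooth_fun M (\<lambda>q. X q f * X q h)"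
      using Q(2) f h by (intro smooth_fun_mult[OF field_smooth field_smooth])
    then show "smooth_fun M (\<lambda>q. \<beta> q * (\<Prod>Y\<in>Q - {X}. n Y q) * (X q f * X q h))"
      using n by (intro smooth_fun_mult[OF smooth_fun_mult[OF \<beta>(1) smooth_fun_prod]]) auto
  qed
  moreover have "?c p \<noteq> 0"
    using \<beta>(2) Q(1-3) by (simp add: n_def metric_self_eq_0_iff)
  moreover have "?c q * gradient M f q h = ?u q" if q: "?c q \<noteq> 0" for q
  proof -
    have n0: "n X q \<noteq> 0" if "X \<in> Q" for X
      using q that Q(1) by auto
    have "X q \<noteq> 0" if "X \<in> Q" for X
      using n0[OF that] Q(2)[OF that] metric_self_eq_0_iff[of "X q" q] by (auto simp: n_def)
    then have "gradient M f q = (\<Sum>X\<in>Q. (X q f / n X q) *\<^sub>R X q)"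
      unfolding n_def using q Q(2) by (intro gradient_eqI Q(4)) (auto intro!: tangent_simps_closed)
    then have "?c q * gradient M f q h = (\<Sum>X\<in>Q. ?c q * (X q f / n X q * X q h))"
      by (simp add: sum_fun_apply sum_distrib_left)
    also have "\<dots> = ?u q"
    proof (rule sum.cong)
      fix X assume X: "X \<in> Q"
      show "?c q * (X q f / n X q * X q h) = \<beta> q * (\<Prod>Y\<in>Q - {X}. n Y q) * (X q f * X q h)"
        using prod.remove[OF Q(1) X, of "\<lambda>X. n X q"] n0[OF X] by simp
    qed simp
    finally show ?thesis .
  qed
  ultimately show "\<exists>c u. smooth_fun M c \<and> smooth_fun M u \<and> c p \<noteq> 0 \<and>
      (\<forall>q. c q \<noteq> 0 \<longrightarrow> c q * gradient M f q h = u q)"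
    by blast
qed

text \<open>
  Lowering the index in the expansion of a vector along a local frame gives an expansion along
  gradients.
\<close>

lemma gradient_frame:
  obtains \<beta> :: "'m \<Rightarrow> real" and u :: "'e \<Rightarrow> 'm \<Rightarrow> real" and E :: "'e \<Rightarrow> 'm field"
  where "smooth_fun M \<beta>" "\<beta> p \<noteq> 0" "\<And>b. smooth_fun M (u b)" "\<And>b. E b \<in> vector_fields M"
    "\<And>q w. w \<in> tangent_space M q \<Longrightarrow> (\<beta> q) ^ 3 *\<^sub>R w =
       (\<Sum>b\<in>Basis. metric M q (E b q) w *\<^sub>R (\<beta> q *\<^sub>R gradient M (u b) q - u b q *\<^sub>R gradient M \<beta> q))"
proof -
  obtain \<beta> u and E :: "'e \<Rightarrow> 'm field" where \<beta>: "smooth_fun M \<beta>" "\<beta> p \<noteq> 0"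
    and u: "\<And>b. smooth_fun M (u b)" and E: "\<And>b. E b \<in> vector_fields M"
    and expansion: "\<And>q v. v \<in> tangent_space M q \<Longrightarrow>
       (\<beta> q) ^ 3 *\<^sub>R v = (\<Sum>b\<in>Basis. (\<beta> q * v (u b) - u b q * v \<beta>) *\<^sub>R E b q)"
    by (rule local_frame[of p]) blast
  have "(\<beta> q) ^ 3 *\<^sub>R w =
       (\<Sum>b\<in>Basis. metric M q (E b q) w *\<^sub>R (\<beta> q *\<^sub>R gradient M (u b) q - u b q *\<^sub>R gradient M \<beta> q))"
    (is "_ = ?R") if w: "w \<in> tangent_space M q" for q w
  proof (rule metric_eqI)
    have T: "\<beta> q *\<^sub>R gradient M (u b) q - u b q *\<^sub>R gradient M \<beta> q \<in> tangent_space M q" for b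
      by (simp add: tangent_simps_closed gradient_tangent)
    show "(\<beta> q) ^ 3 *\<^sub>R w \<in> tangent_space M q" "?R \<in> tangent_space M q"
      using w T by (simp_all add: tangent_simps_closed)
    fix v assume v: "v \<in> tangent_space M q"
    have "metric M q ?R v = (\<Sum>b\<in>Basis. metric M q (E b q) w * (\<beta> q * v (u b) - u b q * v \<beta>))"
      using v T by (simp add: metric_sum_left metric_linear_left tangent_simps_closed
          gradient_tangent gradient_metric)
    also have "\<dots> = metric M q (\<Sum>b\<in>Basis. (\<beta> q * v (u b) - u b q * v \<beta>) *\<^sub>R E b q) w"
      using w E by (simp add: metric_sum_left metric_linear_left tangent_simps_closed mult.commute)
    also have "\<dots> = metric M q ((\<beta> q) ^ 3 *\<^sub>R w) v"
      using expansion[OF v] v w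
      by (simp add: metric_linear_left metric_sym[of w q v] flip: expansion)
    finally show "metric M q ((\<beta> q) ^ 3 *\<^sub>R w) v = metric M q ?R v" ..
  qed
  then show thesis using that \<beta> u E by blast
qed


subsection \<open>Orthogonal projections\<close>

lemma projection_on_span_exists:
  assumes "finite B"
  shows "B \<subseteq> tangent_space M p \<Longrightarrow> v \<in> tangent_space M p \<Longrightarrow>
    \<exists>w\<in>span B. \<forall>u\<in>span B. metric M p (v - w) u = 0"
  using assms
proof (induction B arbitrary: v)
  case empty
  have "metric M p v 0 = 0"
    using empty(2) by (intro metric_zero_right)
  then show ?case by (simp del: zero_fun_apply)
next
  case (insert b B)
  have span_tangent: "span A \<subseteq> tangent_space M p" if "A \<subseteq> tangent_space M p" for A
    using that subspace_tangent by (rule span_minimal)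
  have b: "b \<in> tangent_space M p" using insert.prems by simp
  obtain w where w: "w \<in> span B" "\<And>u. u \<in> span B \<Longrightarrow> metric M p (v - w) u = 0"
    using insert.IH[of v] insert.prems by blast
  obtain b1 where b1: "b1 \<in> span B" "\<And>u. u \<in> span B \<Longrightarrow> metric M p (b - b1) u = 0"
    using insert.IH[of b] insert.prems by blast
  define b2 where "b2 = b - b1"
  \<comment> \<open>If \<open>b\<close> lies in the span of \<open>B\<close>, then \<open>b2 = 0\<close> and \<open>k = 0 / 0 = 0\<close>, so that \<open>w\<close> is kept.\<close>
  define k where "k = metric M p (v - w) b2 / metric M p b2 b2"
  have T: "w \<in> tangent_space M p" "b1 \<in> tangent_space M p" "v \<in> tangent_space M p"
    using w(1) b1(1) span_tangent[of B] insert.prems by auto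
  have T2: "b2 \<in> tangent_space M p" "v - w \<in> tangent_space M p"
    using T b by (simp_all add: b2_def tangent_simps_closed)
  have span_B: "u \<in> tangent_space M p" if "u \<in> span B" for u
    using that span_tangent[of B] insert.prems by blast
  have mono: "span B \<subseteq> span (insert b B)"
    by (intro span_mono) auto
  show ?case
  proof (intro bexI[of _ "w + k *\<^sub>R b2"] ballI)
    have "b \<in> span (insert b B)" by (simp add: span_base)
    then show "w + k *\<^sub>R b2 \<in> span (insert b B)"
      unfolding b2_def using w(1) b1(1) mono by (intro span_add span_scale span_diff) auto
    fix u assume "u \<in> span (insert b B)"
    then obtain a where a: "u - a *\<^sub>R b \<in> span B"
      using span_breakdown_eq by blast
    define u' where "u' = u - a *\<^sub>R b + a *\<^sub>R b1"
    have u': "u' \<in> span B" "u = u' + a *\<^sub>R b2"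
      unfolding u'_def using span_add[OF a span_scale[OF b1(1)]]
      by (simp_all add: b2_def algebra_simps)
    have "metric M p (v - w) b2 = k * metric M p b2 b2"
      using T2 metric_self_eq_0_iff[OF T2(1)] metric_zero_right[OF T2(2)]
      by (cases "b2 = 0") (auto simp: k_def)
    then show "metric M p (v - (w + k *\<^sub>R b2)) u = 0"
      using T2 span_B[OF u'(1)] w(2)[OF u'(1)] b1(2)[OF u'(1)]
      by (simp add: u'(2) diff_diff_eq[symmetric] metric_linear_left metric_linear_right
          tangent_simps_closed b2_def[symmetric])
  qed
qed

lemma projection_exists:
  assumes S: "subspace S" "S \<subseteq> tangent_space M p" and v: "v \<in> tangent_space M p"
  shows "\<exists>w\<in>S. \<forall>u\<in>S. metric M p (v - w) u = 0"
proof -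
  obtain B where B: "B \<subseteq> S" "independent B" "S \<subseteq> span B"
    using maximal_independent_subset by blast
  obtain A where A: "finite A" "tangent_space M p = span A"
    using finite_span_tangent .
  have "finite B"
    using independent_span_bound[OF A(1) B(2)] B(1) S(2) A(2) by auto
  moreover have "span B = S"
    using B span_minimal[OF B(1) S(1)] by blast
  ultimately show ?thesis
    using projection_on_span_exists[of B p v] B(1) S(2) v by auto
qed

lemma orth_proj_eqI:
  assumes "subspace (D p)" "D p \<subseteq> tangent_space M p" "v \<in> tangent_space M p"
    "w \<in> D p" "\<And>u. u \<in> D p \<Longrightarrow> metric M p (v - w) u = 0"
  shows "orth_proj M D p v = w"
  unfolding orth_proj_def
proof (rule the_equality)
  fix w' assume w': "w' \<in> D p \<and> (\<forall>u\<in>D p. metric M p (v - w') u = 0)"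
  have "w - w' \<in> D p" using assms w' by (auto intro: subspace_diff)
  moreover have "metric M p ((v - w') - (v - w)) u = 0" if "u \<in> D p" for u
    using that assms w' by (subst metric_linear_left) (auto intro!: tangent_simps_closed)
  ultimately have "metric M p (w - w') (w - w') = 0"
    by simp
  then show "w' = w"
    using metric_self_eq_0_iff[of "w - w'" p] \<open>w - w' \<in> D p\<close> assms(2) by auto
qed (use assms in auto)

lemma orth_proj:
  assumes "subspace (D p)" "D p \<subseteq> tangent_space M p" "v \<in> tangent_space M p"
  shows "orth_proj M D p v \<in> D p" "u \<in> D p \<Longrightarrow> metric M p (v - orth_proj M D p v) u = 0"
proof -
  obtain w where "w \<in> D p" "\<And>u. u \<in> D p \<Longrightarrow> metric M p (v - w) u = 0"
    using projection_exists[OF assms] by blast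
  moreover from this have "orth_proj M D p v = w"
    using assms by (intro orth_proj_eqI)
  ultimately show "orth_proj M D p v \<in> D p" "u \<in> D p \<Longrightarrow> metric M p (v - orth_proj M D p v) u = 0"
    by auto
qed


subsection \<open>The Levi-Civita connection\<close>

lemma conn_rules:
  assumes "X \<in> vector_fields M" "Y \<in> vector_fields M" "Z \<in> vector_fields M" "smooth_fun M f"
  shows "conn M X Y \<in> vector_fields M"
    "conn M (X + Y) Z = conn M X Z + conn M Y Z"
    "conn M (f *\<^sub>F X) Y = f *\<^sub>F conn M X Y"
    "conn M X (Y + Z) = conn M X Y + conn M X Z"
    "conn M X (f *\<^sub>F Y) = (\<lambda>p. X p f) *\<^sub>F Y + f *\<^sub>F conn M X Y"
    "conn M X Y - conn M Y X = lie_bracket X Y"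
    "X p (\<lambda>q. metric M q (Y q) (Z q)) =
      metric M p (conn M X Y p) (Z p) + metric M p (Y p) (conn M X Z p)"
  using levi_civita assms unfolding levi_civita_def by blast+

lemma conn_field [intro, simp]:
  "X \<in> vector_fields M \<Longrightarrow> Y \<in> vector_fields M \<Longrightarrow> conn M X Y \<in> vector_fields M"
  using conn_rules(1)[of X Y Y "\<lambda>p. 0"] by simp

lemma conn_zero_right: "X \<in> vector_fields M \<Longrightarrow> conn M X 0 = 0"
  using conn_rules(4)[of X 0 0 "\<lambda>p. 0"] by simp

end


section \<open>Horizontally conformal submersions\<close>

lemma pushforward_linear:
  "pushforward N F (u + v) = pushforward N F u + pushforward N F v"
  "pushforward N F (u - v) = pushforward N F u - pushforward N F v"
  "pushforward N F (a *\<^sub>R u) = a *\<^sub>R pushforward N F u"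
  "pushforward N F 0 = 0"
  "pushforward N F (- u) = - pushforward N F u"
  by (auto simp: pushforward_def fun_eq_iff)

lemma pushforward_sum: "pushforward N F (\<Sum>i\<in>I. u i) = (\<Sum>i\<in>I. pushforward N F (u i))"
  by (induction I rule: infinite_finite_induct)
    (simp_all only: sum.infinite sum.empty sum.insert pushforward_linear not_False_eq_True)

lemma pushforward_apply: "smooth_fun N h \<Longrightarrow> pushforward N F v h = v (\<lambda>p. h (F p))"
  by (simp add: pushforward_def o_def)

locale conformal_submersion =
  M: riemannian_mfd M + N: riemannian_mfd N
  for M :: "('m::{t2_space, second_countable_topology}, 'e::euclidean_space) riemannian"
    and N :: "('n::{t2_space, second_countable_topology}, 'k::euclidean_space) riemannian" +
  fixes F :: "'m \<Rightarrow> 'n" and l :: "'m \<Rightarrow> real"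
  assumes submersion: "submersion M N F"
    and conformal: "horizontally_conformal M N F l"
begin

lemma smooth_fun_pullback:
  assumes h: "smooth_fun N h"
  shows "smooth_fun M (\<lambda>p. h (F p))"
proof (rule M.smooth_funI_local)
  fix p
  obtain U \<phi> where U: "(U, \<phi>) \<in> atlas M" "p \<in> U" by (rule M.chart_at)
  obtain V \<psi> where V: "(V, \<psi>) \<in> atlas N" "F p \<in> V" by (rule N.chart_at)
  have F: "continuous_on UNIV F" "smooth_on (\<phi> ` (U \<inter> F -` V)) (\<lambda>x. \<psi> (F (inv_into U \<phi> x)))"
    using submersion U V unfolding submersion_def smooth_map_def by (auto simp: o_def)
  let ?W = "U \<inter> F -` V" and ?f = "\<lambda>x. \<psi> (F (inv_into U \<phi> x))"
  have "open (F -` V)"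
    using F(1) N.atlasD(1)[OF V(1)] by (simp add: continuous_on_open_vimage)
  then have W: "open ?W"
    using M.atlasD(1)[OF U(1)] by (rule open_Int[rotated])
  have \<phi>W: "open (\<phi> ` ?W)"
    using W by (intro M.open_chart_image[OF U(1)]) auto
  have "?f ` \<phi> ` ?W \<subseteq> \<psi> ` V"
    using M.atlasD(7)[OF U(1)] by auto
  then have "smooth_on (\<phi> ` ?W) (\<lambda>x. h (inv_into V \<psi> (?f x)))"
    using smooth_on_compose[OF \<phi>W N.atlasD(2)[OF V(1)] _ N.smooth_fun_chart[OF h V(1)] F(2)] by simp
  moreover have "h (F (inv_into U \<phi> x)) = h (inv_into V \<psi> (?f x))" if "x \<in> \<phi> ` ?W" for x
    using that M.atlasD(7)[OF U(1)] N.atlasD(7)[OF V(1)] by auto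
  ultimately have "smooth_on (\<phi> ` ?W) (\<lambda>x. h (F (inv_into U \<phi> x)))"
    using smooth_on_cong[OF \<phi>W, of "\<lambda>x. h (F (inv_into U \<phi> x))" "\<lambda>x. h (inv_into V \<psi> (?f x))"]
    by simp
  moreover have "p \<in> ?W" "?W \<subseteq> U" using U V by auto
  ultimately show "\<exists>U \<phi> W. (U, \<phi>) \<in> atlas M \<and> open W \<and> p \<in> W \<and> W \<subseteq> U \<and>
      smooth_on (\<phi> ` W) (\<lambda>x. h (F (inv_into U \<phi> x)))"
    using U(1) W by blast
qed

lemma pushforward_tangent:
  "v \<in> tangent_space M p \<Longrightarrow> pushforward N F v \<in> tangent_space N (F p)"
  using submersion unfolding submersion_def by blast

lemma pushforward_surj:
  assumes "w \<in> tangent_space N (F p)"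
  obtains v where "v \<in> tangent_space M p" "pushforward N F v = w"
  using submersion assms unfolding submersion_def by (metis imageE)

lemma dilation_pos: "l p > 0"
  using conformal unfolding horizontally_conformal_def by blast


subsection \<open>Vertical and horizontal vectors\<close>

lemma vert_iff: "v \<in> vert M N F p \<longleftrightarrow> v \<in> tangent_space M p \<and> pushforward N F v = 0"
  by (simp add: vert_def)

lemma horiz_tangent: "v \<in> horiz M N F p \<Longrightarrow> v \<in> tangent_space M p"
  by (simp add: horiz_def)

lemma vert_tangent: "v \<in> vert M N F p \<Longrightarrow> v \<in> tangent_space M p"
  by (simp add: vert_def)

lemma subspace_vert: "subspace (vert M N F p)"
  by (auto simp: subspace_def vert_iff pushforward_linear M.tangent_simps_closed)

lemma subspace_horiz: "subspace (horiz M N F p)"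
  by (auto simp: subspace_def horiz_def vert_tangent M.metric_linear_left M.tangent_simps_closed)

lemma metric_horiz_vert:
  "u \<in> horiz M N F p \<Longrightarrow> v \<in> vert M N F p \<Longrightarrow> metric M p u v = 0"
  "u \<in> horiz M N F p \<Longrightarrow> v \<in> vert M N F p \<Longrightarrow> metric M p v u = 0"
  using M.metric_sym[of v p u] by (auto simp: horiz_def vert_def)

lemma vproj_vert: "v \<in> tangent_space M p \<Longrightarrow> vproj M N F p v \<in> vert M N F p"
  by (intro M.orth_proj subspace_vert) (auto simp: vert_tangent)

lemma diff_vproj_horiz:
  assumes "v \<in> tangent_space M p"
  shows "v - vproj M N F p v \<in> horiz M N F p"
  using assms vert_tangent[OF vproj_vert[OF assms]]
    M.orth_proj(2)[of "vert M N F" p v] subspace_vert[of p] vert_tangent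
  by (auto simp: horiz_def M.tangent_simps_closed)

lemma hproj_eq:
  assumes v: "v \<in> tangent_space M p"
  shows "hproj M N F p v = v - vproj M N F p v"
proof (rule M.orth_proj_eqI)
  fix u assume "u \<in> horiz M N F p"
  then show "metric M p (v - (v - vproj M N F p v)) u = 0"
    using metric_horiz_vert(2)[OF _ vproj_vert[OF v]] by simp
qed (use v in \<open>auto simp: subspace_horiz horiz_tangent diff_vproj_horiz\<close>)

lemma hproj_horiz: "v \<in> tangent_space M p \<Longrightarrow> hproj M N F p v \<in> horiz M N F p"
  by (simp add: hproj_eq diff_vproj_horiz)

lemma proj_sum: "v \<in> tangent_space M p \<Longrightarrow> hproj M N F p v + vproj M N F p v = v"
  by (simp add: hproj_eq)

lemma horiz_vert_0: "v \<in> horiz M N F p \<Longrightarrow> v \<in> vert M N F p \<Longrightarrow> v = 0"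
  using metric_horiz_vert(1)[of v p v] M.metric_self_eq_0_iff[of v p] by (simp add: vert_tangent)

lemma proj_unique:
  assumes h: "h \<in> horiz M N F p" and w: "w \<in> vert M N F p"
  shows "hproj M N F p (h + w) = h" "vproj M N F p (h + w) = w"
proof -
  let ?v = "h + w"
  have v: "?v \<in> tangent_space M p"
    using assms by (simp add: M.tangent_simps_closed horiz_tangent vert_tangent)
  have eq: "hproj M N F p ?v - h = w - vproj M N F p ?v"
    by (simp add: hproj_eq[OF v])
  have "hproj M N F p ?v - h \<in> horiz M N F p"
    using hproj_horiz[OF v] h subspace_horiz by (intro subspace_diff)
  moreover have "hproj M N F p ?v - h \<in> vert M N F p"
    unfolding eq using vproj_vert[OF v] w subspace_vert by (intro subspace_diff)
  ultimately have "hproj M N F p ?v - h = 0"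
    by (rule horiz_vert_0)
  then show "hproj M N F p ?v = h" "vproj M N F p ?v = w"
    using eq by simp_all
qed

lemma proj_of_horiz:
  assumes "h \<in> horiz M N F p"
  shows "hproj M N F p h = h" "vproj M N F p h = 0"
  using proj_unique[OF assms subspace_0[OF subspace_vert]] by simp_all

lemma proj_of_vert:
  assumes "w \<in> vert M N F p"
  shows "hproj M N F p w = 0" "vproj M N F p w = w"
  using proj_unique[OF subspace_0[OF subspace_horiz] assms] by simp_all

lemma vproj_tangent: "v \<in> tangent_space M p \<Longrightarrow> vproj M N F p v \<in> tangent_space M p"
  by (simp add: vproj_vert vert_tangent)

lemma hproj_tangent: "v \<in> tangent_space M p \<Longrightarrow> hproj M N F p v \<in> tangent_space M p"
  by (simp add: hproj_horiz horiz_tangent)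

lemma
  assumes u: "u \<in> tangent_space M p" and v: "v \<in> tangent_space M p"
  shows hproj_add: "hproj M N F p (u + v) = hproj M N F p u + hproj M N F p v"
    and vproj_add: "vproj M N F p (u + v) = vproj M N F p u + vproj M N F p v"
proof -
  have "u + v = (hproj M N F p u + hproj M N F p v) + (vproj M N F p u + vproj M N F p v)"
    by (simp add: hproj_eq[OF u] hproj_eq[OF v])
  moreover have "hproj M N F p u + hproj M N F p v \<in> horiz M N F p"
    by (intro subspace_add[OF subspace_horiz] hproj_horiz u v)
  moreover have "vproj M N F p u + vproj M N F p v \<in> vert M N F p"
    by (intro subspace_add[OF subspace_vert] vproj_vert u v)
  ultimately show "hproj M N F p (u + v) = hproj M N F p u + hproj M N F p v"
    "vproj M N F p (u + v) = vproj M N F p u + vproj M N F p v"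
    using proj_unique by metis+
qed

lemma hproj_scale:
  assumes u: "u \<in> tangent_space M p"
  shows "hproj M N F p (a *\<^sub>R u) = a *\<^sub>R hproj M N F p u"
proof -
  have "a *\<^sub>R u = a *\<^sub>R hproj M N F p u + a *\<^sub>R vproj M N F p u"
    using proj_sum[OF u] by (metis scaleR_add_right)
  moreover have "a *\<^sub>R hproj M N F p u \<in> horiz M N F p"
    by (intro subspace_scale[OF subspace_horiz] hproj_horiz u)
  moreover have "a *\<^sub>R vproj M N F p u \<in> vert M N F p"
    by (intro subspace_scale[OF subspace_vert] vproj_vert u)
  ultimately show ?thesis
    using proj_unique(1) by metis
qed

lemma vert_iff_hproj:
  assumes "v \<in> tangent_space M p"
  shows "v \<in> vert M N F p \<longleftrightarrow> hproj M N F p v = 0"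
  using proj_of_vert(1) vproj_vert[OF assms] hproj_eq[OF assms] by auto

lemma pushforward_hproj:
  "v \<in> tangent_space M p \<Longrightarrow> pushforward N F (hproj M N F p v) = pushforward N F v"
  using vproj_vert[of v p] by (simp add: hproj_eq pushforward_linear vert_iff)

lemma horiz_eqI:
  assumes "u \<in> horiz M N F p" "v \<in> horiz M N F p" "pushforward N F u = pushforward N F v"
  shows "u = v"
proof -
  have "u - v \<in> horiz M N F p"
    using assms subspace_horiz by (intro subspace_diff)
  moreover from this have "u - v \<in> vert M N F p"
    using assms(3) by (simp add: vert_iff horiz_tangent pushforward_linear)
  ultimately have "u - v = 0" by (rule horiz_vert_0)
  then show ?thesis by simp
qed

lemma metric_pushforward:
  assumes "u \<in> horiz M N F p" "v \<in> tangent_space M p"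
  shows "metric N (F p) (pushforward N F u) (pushforward N F v) = (l p)\<^sup>2 * metric M p u v"
proof -
  have "metric N (F p) (pushforward N F u) (pushforward N F (hproj M N F p v)) =
      (l p)\<^sup>2 * metric M p u (hproj M N F p v)"
    using conformal assms hproj_horiz unfolding horizontally_conformal_def by blast
  moreover have "metric M p u (hproj M N F p v) = metric M p u v"
    using assms metric_horiz_vert(1)[OF assms(1) vproj_vert[OF assms(2)]]
    by (simp add: hproj_eq M.metric_linear_right horiz_tangent vproj_tangent)
  ultimately show ?thesis
    using assms(2) by (simp add: pushforward_hproj)
qed


subsection \<open>Horizontal lifts\<close>

text \<open>
  Conformality makes gradients the easiest fields to lift: up to the factor \<open>l\<^sup>2\<close>, the gradient of
  a pullback is the horizontal lift of the gradient.
\<close>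

lemma
  assumes h: "smooth_fun N h"
  shows gradient_pullback_horiz: "gradient M (\<lambda>p. h (F p)) p \<in> horiz M N F p"
    and pushforward_gradient:
      "pushforward N F (gradient M (\<lambda>p. h (F p)) p) = (l p)\<^sup>2 *\<^sub>R gradient N h (F p)"
proof -
  let ?G = "gradient M (\<lambda>p. h (F p)) p"
  have G: "metric M p ?G v = pushforward N F v h" if "v \<in> tangent_space M p" for v
    using that by (simp add: M.gradient_metric pushforward_apply[OF h])
  then show horiz: "?G \<in> horiz M N F p"
    by (auto simp: horiz_def vert_def M.gradient_tangent)
  show "pushforward N F ?G = (l p)\<^sup>2 *\<^sub>R gradient N h (F p)"
  proof (rule N.metric_eqI)
    show "pushforward N F ?G \<in> tangent_space N (F p)"
      by (intro pushforward_tangent M.gradient_tangent)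
    show "(l p)\<^sup>2 *\<^sub>R gradient N h (F p) \<in> tangent_space N (F p)"
      by (simp add: N.tangent_simps_closed N.gradient_tangent)
    fix w assume w: "w \<in> tangent_space N (F p)"
    then obtain v where v: "v \<in> tangent_space M p" "w = pushforward N F v"
      using pushforward_surj by metis
    show "metric N (F p) (pushforward N F ?G) w = metric N (F p) ((l p)\<^sup>2 *\<^sub>R gradient N h (F p)) w"
      using metric_pushforward[OF horiz v(1)] G[OF v(1)] w v(2)
      by (simp add: N.metric_linear_left N.gradient_tangent N.gradient_metric)
  qed
qed

text \<open>
  Applying the previous lemma to \<open>h\<close> itself, \<open>l\<^sup>2\<close> is the quotient of \<open>|grad (h \<circ> F)|\<^sup>2\<close> by
  \<open>|grad h|\<^sup>2 \<circ> F\<close> wherever the latter is nonzero. A function \<open>h\<close> with nonzero gradient at a given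
  point exists because the model space of \<open>N\<close> has positive dimension.
\<close>

lemma dilation_square_smooth: "smooth_fun M (\<lambda>p. (l p)\<^sup>2)"
proof (rule M.smooth_funI_quotient)
  fix p
  obtain Z where Z: "Z \<in> vector_fields N" "Z (F p) \<noteq> 0" by (rule N.nonvanishing_field)
  then obtain h where h: "Z (F p) h \<noteq> 0" by (auto simp: fun_eq_iff)
  have smooth: "smooth_fun N h"
    using h N.tangent_not_smooth[OF N.field_tangent[OF Z(1)]] by metis
  let ?G = "gradient N h" and ?c = "\<lambda>q. gradient N h (F q) h"
    and ?u = "\<lambda>q. gradient M (\<lambda>q. h (F q)) q (\<lambda>q. h (F q))"
  have "?G (F p) \<noteq> 0"
    using h N.gradient_metric[of "Z (F p)" "F p" h] Z(1) by (auto simp: N.metric_linear_left)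
  then have "?c p \<noteq> 0"
    using N.gradient_metric[OF N.gradient_tangent, of "F p" h h] N.metric_self_eq_0_iff[OF N.gradient_tangent]
    by metis
  moreover have "smooth_fun M ?c"
    using smooth_fun_pullback[OF N.field_smooth[OF N.gradient_field[OF smooth] smooth]] .
  moreover have "smooth_fun M ?u"
    using M.field_smooth[OF M.gradient_field] smooth_fun_pullback[OF smooth] by blast
  moreover have "?c q * (l q)\<^sup>2 = ?u q" for q
    using fun_cong[OF pushforward_gradient[OF smooth], of q h] by (simp add: pushforward_apply[OF smooth])
  ultimately show "\<exists>c u. smooth_fun M c \<and> smooth_fun M u \<and> c p \<noteq> 0 \<and> (\<forall>q. c q \<noteq> 0 \<longrightarrow> c q * (l q)\<^sup>2 = u q)"
    by blast
qed

lemma dilation_smooth: "smooth_fun M l"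
proof -
  have "sqrt ((l p)\<^sup>2) = l p" "(l p)\<^sup>2 > 0" for p
    using dilation_pos[of p] by simp_all
  then show ?thesis
    using M.smooth_fun_sqrt[OF dilation_square_smooth] by simp
qed

definition gradient_lift :: "('n \<Rightarrow> real) \<Rightarrow> 'm field" where
  "gradient_lift h = (\<lambda>p. inverse ((l p)\<^sup>2)) *\<^sub>F gradient M (\<lambda>p. h (F p))"

lemma gradient_lift:
  assumes "smooth_fun N h"
  shows "gradient_lift h \<in> vector_fields M" "gradient_lift h p \<in> horiz M N F p"
    "pushforward N F (gradient_lift h p) = gradient N h (F p)"
proof -
  have l: "(l p)\<^sup>2 \<noteq> 0" for p using dilation_pos[of p] by simp
  show "gradient_lift h \<in> vector_fields M"
    unfolding gradient_lift_def using l
    by (intro M.field_scale M.gradient_field M.smooth_fun_inverse dilation_square_smooth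
        smooth_fun_pullback assms)
  show "gradient_lift h p \<in> horiz M N F p"
    unfolding gradient_lift_def
    by (intro subspace_scale[OF subspace_horiz] gradient_pullback_horiz assms)
  show "pushforward N F (gradient_lift h p) = gradient N h (F p)"
    using l[of p] by (simp add: gradient_lift_def pushforward_linear pushforward_gradient[OF assms])
qed

definition hlift :: "'n field \<Rightarrow> 'm field" where
  "hlift Z p = (THE x. x \<in> horiz M N F p \<and> pushforward N F x = Z (F p))"

lemma
  assumes "Z \<in> vector_fields N"
  shows hlift_horiz: "hlift Z p \<in> horiz M N F p"
    and pushforward_hlift: "pushforward N F (hlift Z p) = Z (F p)"
proof -
  obtain v where v: "v \<in> tangent_space M p" "pushforward N F v = Z (F p)"
    using pushforward_surj[OF N.field_tangent[OF assms]] .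
  have "\<exists>!x. x \<in> horiz M N F p \<and> pushforward N F x = Z (F p)"
  proof (rule ex1I[of _ "hproj M N F p v"])
    show "hproj M N F p v \<in> horiz M N F p \<and> pushforward N F (hproj M N F p v) = Z (F p)"
      using v by (simp add: hproj_horiz pushforward_hproj)
    then show "x = hproj M N F p v" if "x \<in> horiz M N F p \<and> pushforward N F x = Z (F p)" for x
      using that by (intro horiz_eqI) auto
  qed
  from theI'[OF this] show "hlift Z p \<in> horiz M N F p" "pushforward N F (hlift Z p) = Z (F p)"
    unfolding hlift_def by blast+
qed

text \<open>Locally \<open>Z\<close> is a combination of gradients, and those have smooth lifts.\<close>

lemma hlift_field:
  assumes Z: "Z \<in> vector_fields N"
  shows "hlift Z \<in> vector_fields M"
proof (rule M.fieldI_quotient)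
  fix p
  show "hlift Z p \<in> tangent_space M p"
    using hlift_horiz[OF Z] by (rule horiz_tangent)
  obtain \<beta> u and E :: "'k \<Rightarrow> 'n field" where \<beta>: "smooth_fun N \<beta>" "\<beta> (F p) \<noteq> 0"
    and u: "\<And>b. smooth_fun N (u b)" and E: "\<And>b. E b \<in> vector_fields N"
    and expansion: "\<And>q w. w \<in> tangent_space N q \<Longrightarrow> (\<beta> q) ^ 3 *\<^sub>R w =
       (\<Sum>b\<in>Basis. metric N q (E b q) w *\<^sub>R (\<beta> q *\<^sub>R gradient N (u b) q - u b q *\<^sub>R gradient N \<beta> q))"
    by (rule N.gradient_frame[of "F p"]) blast
  let ?c = "\<lambda>p. (\<beta> (F p)) ^ 3"
  define R where "R b = (\<lambda>p. metric N (F p) (E b (F p)) (Z (F p))) *\<^sub>F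
      ((\<lambda>p. \<beta> (F p)) *\<^sub>F gradient_lift (u b) - (\<lambda>p. u b (F p)) *\<^sub>F gradient_lift \<beta>)" for b
  have R: "R b \<in> vector_fields M" for b
    unfolding R_def
    by (intro M.field_scale M.field_diff gradient_lift smooth_fun_pullback \<beta> u
        smooth_fun_pullback[OF N.metric_smooth[OF E Z]])
  have R_eq: "R b q = metric N (F q) (E b (F q)) (Z (F q)) *\<^sub>R
      (\<beta> (F q) *\<^sub>R gradient_lift (u b) q - u b (F q) *\<^sub>R gradient_lift \<beta> q)" for b q
    by (simp add: R_def)
  have R_sum: "(\<Sum>b\<in>Basis. R b) q = (\<Sum>b\<in>Basis. metric N (F q) (E b (F q)) (Z (F q)) *\<^sub>R
      (\<beta> (F q) *\<^sub>R gradient_lift (u b) q - u b (F q) *\<^sub>R gradient_lift \<beta> q))" for q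
    by (simp only: sum_fun_apply[of R Basis q] R_eq)
  have "?c q *\<^sub>R hlift Z q = (\<Sum>b\<in>Basis. R b) q" for q
  proof (rule horiz_eqI[where p=q])
    show "?c q *\<^sub>R hlift Z q \<in> horiz M N F q"
      by (intro subspace_scale[OF subspace_horiz] hlift_horiz Z)
    show "(\<Sum>b\<in>Basis. R b) q \<in> horiz M N F q"
      unfolding R_sum
      by (intro subspace_sum[OF subspace_horiz] subspace_scale[OF subspace_horiz]
          subspace_diff[OF subspace_horiz] gradient_lift \<beta> u)
    show "pushforward N F (?c q *\<^sub>R hlift Z q) = pushforward N F ((\<Sum>b\<in>Basis. R b) q)"
      unfolding R_sum
      by (simp add: pushforward_linear pushforward_sum pushforward_hlift Z gradient_lift \<beta> u expansion)
  qed
  moreover have "smooth_fun M ?c"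
    by (intro M.smooth_fun_power smooth_fun_pullback \<beta>)
  moreover have "(\<Sum>b\<in>Basis. R b) \<in> vector_fields M"
    using R by (intro M.field_sum)
  ultimately show "\<exists>c Y. smooth_fun M c \<and> Y \<in> vector_fields M \<and> c p \<noteq> 0 \<and>
      (\<forall>q. c q \<noteq> 0 \<longrightarrow> c q *\<^sub>R hlift Z q = Y q)"
    using \<beta>(2) by (intro exI[of _ ?c] exI[of _ "\<Sum>b\<in>Basis. R b"]) simp
qed

text \<open>
  A local frame of \<open>N\<close> at \<open>F p\<close> lifts to a local frame of the horizontal distribution. As the
  coefficients in \<open>N\<close> are derivatives of functions on \<open>N\<close>, those of \<open>G\<close> are derivatives of their
  pullbacks, hence smooth. The factor \<open>c\<close> keeps this a statement about global fields.
\<close>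

lemma hproj_lift_expansion:
  obtains c :: "'m \<Rightarrow> real" and a :: "'k \<Rightarrow> 'm field \<Rightarrow> 'm \<Rightarrow> real" and E :: "'k \<Rightarrow> 'n field"
  where "smooth_fun M c" "c p \<noteq> 0" "\<And>b. E b \<in> vector_fields N"
    "\<And>G b. G \<in> vector_fields M \<Longrightarrow> smooth_fun M (a b G)"
    "\<And>G q. G \<in> vector_fields M \<Longrightarrow>
      c q *\<^sub>R hproj M N F q (G q) = (\<Sum>b\<in>Basis. a b G q *\<^sub>R hlift (E b) q)"
proof -
  obtain \<beta> u and E :: "'k \<Rightarrow> 'n field" where \<beta>: "smooth_fun N \<beta>" "\<beta> (F p) \<noteq> 0"
    and u: "\<And>b. smooth_fun N (u b)" and E: "\<And>b. E b \<in> vector_fields N"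
    and expansion: "\<And>q v. v \<in> tangent_space N q \<Longrightarrow>
       (\<beta> q) ^ 3 *\<^sub>R v = (\<Sum>b\<in>Basis. (\<beta> q * v (u b) - u b q * v \<beta>) *\<^sub>R E b q)"
    by (rule N.local_frame[of "F p"]) blast
  let ?c = "\<lambda>p. (\<beta> (F p)) ^ 3"
  let ?a = "\<lambda>b G q. \<beta> (F q) * G q (\<lambda>p. u b (F p)) - u b (F q) * G q (\<lambda>p. \<beta> (F p))"
  have "smooth_fun M ?c"
    by (intro M.smooth_fun_power smooth_fun_pullback \<beta>)
  moreover have "smooth_fun M (?a b G)" if "G \<in> vector_fields M" for b and G :: "'m field"
    using M.field_smooth[OF that smooth_fun_pullback[OF u]]
      M.field_smooth[OF that smooth_fun_pullback[OF \<beta>(1)]]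
      smooth_fun_pullback[OF u] smooth_fun_pullback[OF \<beta>(1)]
    by (intro M.smooth_fun_diff M.smooth_fun_mult)
  moreover have "?c q *\<^sub>R hproj M N F q (G q) = (\<Sum>b\<in>Basis. ?a b G q *\<^sub>R hlift (E b) q)"
    if G: "G \<in> vector_fields M" for q and G :: "'m field"
  proof (rule horiz_eqI)
    note Gq = M.field_tangent[OF G, of q]
    show "?c q *\<^sub>R hproj M N F q (G q) \<in> horiz M N F q"
      by (intro subspace_scale[OF subspace_horiz] hproj_horiz Gq)
    show "(\<Sum>b\<in>Basis. ?a b G q *\<^sub>R hlift (E b) q) \<in> horiz M N F q"
      by (intro subspace_sum[OF subspace_horiz] subspace_scale[OF subspace_horiz] hlift_horiz E)
    have "?c q *\<^sub>R pushforward N F (G q) =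
        (\<Sum>b\<in>Basis. (\<beta> (F q) * pushforward N F (G q) (u b) - u b (F q) * pushforward N F (G q) \<beta>) *\<^sub>R E b (F q))"
      by (intro expansion pushforward_tangent Gq)
    then show "pushforward N F (?c q *\<^sub>R hproj M N F q (G q)) =
        pushforward N F (\<Sum>b\<in>Basis. ?a b G q *\<^sub>R hlift (E b) q)"
      by (simp add: pushforward_linear pushforward_sum pushforward_hlift[OF E] pushforward_hproj[OF Gq]
          pushforward_apply[OF u] pushforward_apply[OF \<beta>(1)])
  qed
  ultimately show thesis
    using \<beta>(2) by (intro that[of ?c E ?a] E) simp_all
qed

text \<open>That the horizontal distribution is smooth follows from the smoothness of the lifts.\<close>

lemma hproj_field:
  assumes G: "G \<in> vector_fields M"
  shows "hproj M N F \<odot> G \<in> vector_fields M"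
proof (rule M.fieldI_quotient)
  fix p
  show "hproj M N F p (G p) \<in> tangent_space M p"
    using G by (intro hproj_tangent M.field_tangent)
  obtain c :: "'m \<Rightarrow> real" and a and E :: "'k \<Rightarrow> 'n field"
    where c: "smooth_fun M c" "c p \<noteq> 0" "\<And>b. E b \<in> vector_fields N"
    and a: "\<And>G b. G \<in> vector_fields M \<Longrightarrow> smooth_fun M (a b G)"
    and eq: "\<And>G q. G \<in> vector_fields M \<Longrightarrow>
      c q *\<^sub>R hproj M N F q (G q) = (\<Sum>b\<in>Basis. a b G q *\<^sub>R hlift (E b) q)"
    by (rule hproj_lift_expansion[of p], rule that, assumption+)
  have "(\<Sum>b\<in>Basis. a b G *\<^sub>F hlift (E b)) \<in> vector_fields M"
    by (intro M.field_sum M.field_scale a G hlift_field c(3))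
  moreover have "c q *\<^sub>R hproj M N F q (G q) = (\<Sum>b\<in>Basis. a b G *\<^sub>F hlift (E b)) q" for q
    by (simp add: eq[OF G] sum_fun_apply)
  ultimately show "\<exists>c Y. smooth_fun M c \<and> Y \<in> vector_fields M \<and> c p \<noteq> 0 \<and>
      (\<forall>q. c q \<noteq> 0 \<longrightarrow> c q *\<^sub>R hproj M N F q (G q) = Y q)"
    using c(1,2) by (intro exI[of _ c] exI[of _ "\<Sum>b\<in>Basis. a b G *\<^sub>F hlift (E b)"]) simp
qed

lemma vproj_field:
  assumes G: "G \<in> vector_fields M"
  shows "vproj M N F \<odot> G \<in> vector_fields M"
proof -
  have "vproj M N F \<odot> G = G - hproj M N F \<odot> G"
    using G by (simp add: fun_eq_iff hproj_eq)
  then show ?thesis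
    using M.field_diff[OF G hproj_field[OF G]] by simp
qed

text \<open>
  The hypotheses allow \<open>Y\<close> to be vertical, with \<open>W = 0\<close>; so the lemma covers the brackets of basic
  fields with vertical fields as well as those with each other.
\<close>

lemma bracket_related:
  assumes X: "X \<in> vector_fields M" and Z: "Z \<in> vector_fields N" "\<And>q. pushforward N F (X q) = Z (F q)"
    and Y: "Y \<in> vector_fields M" and W: "W \<in> vector_fields N" "\<And>q. pushforward N F (Y q) = W (F q)"
  shows "pushforward N F (lie_bracket X Y p) = lie_bracket Z W (F p)"
proof (rule ext)
  fix h
  show "pushforward N F (lie_bracket X Y p) h = lie_bracket Z W (F p) h"
  proof (cases "smooth_fun N h")
    case True
    have "Y q (\<lambda>p. h (F p)) = W (F q) h" "X q (\<lambda>p. h (F p)) = Z (F q) h" for q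
      using Z(2)[of q] W(2)[of q] pushforward_apply[OF True, of F "Y q"]
        pushforward_apply[OF True, of F "X q"] by simp_all
    moreover have "X p (\<lambda>q. W (F q) h) = Z (F p) (\<lambda>y. W y h)"
      using Z(2)[of p] pushforward_apply[OF N.field_smooth[OF W(1) True], of F "X p"] by simp
    moreover have "Y p (\<lambda>q. Z (F q) h) = W (F p) (\<lambda>y. Z y h)"
      using W(2)[of p] pushforward_apply[OF N.field_smooth[OF Z(1) True], of F "Y p"] by simp
    ultimately show ?thesis
      by (simp add: pushforward_apply[OF True] lie_bracket_def)
  next
    case False
    then have "W y h = 0" "Z y h = 0" for y
      using Z W N.tangent_not_smooth N.field_tangent by blast+
    then show ?thesis
      using False N.tangent_const[OF N.field_tangent[OF Z(1)]] N.tangent_const[OF N.field_tangent[OF W(1)]]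
      by (simp add: pushforward_def lie_bracket_def)
  qed
qed

end


section \<open>The second fundamental form\<close>

context riemannian_mfd
begin

lemma conn_zero_left: "X \<in> vector_fields M \<Longrightarrow> conn M 0 X = 0"
  using conn_rules(2)[of 0 0 X "\<lambda>p. 0"] by simp

end

context conformal_submersion
begin

lemma sections_vert_iff:
  "V \<in> sections M (vert M N F) \<longleftrightarrow> V \<in> vector_fields M \<and> (\<forall>p. pushforward N F (V p) = 0)"
  by (auto simp: M.sections_iff[of V "vert M N F"] vert_iff)

lemma vproj_section:
  "G \<in> vector_fields M \<Longrightarrow> vproj M N F \<odot> G \<in> sections M (vert M N F)"
  by (simp add: M.sections_iff[of _ "vert M N F"] vproj_field vproj_vert)

lemma hlift_section: "Z \<in> vector_fields N \<Longrightarrow> hlift Z \<in> sections M (horiz M N F)"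
  by (simp add: M.sections_iff[of _ "horiz M N F"] hlift_field hlift_horiz)

lemma basic_iff_hlift: "basic M N F X \<longleftrightarrow> (\<exists>Z \<in> vector_fields N. X = hlift Z)"
proof
  assume "basic M N F X"
  then obtain Z where Z: "Z \<in> vector_fields N" "\<And>p. pushforward N F (X p) = Z (F p)"
    and X: "\<And>p. X p \<in> horiz M N F p"
    by (auto simp: basic_def M.sections_iff[of X "horiz M N F"])
  have "X p = hlift Z p" for p
    using X hlift_horiz[OF Z(1)] by (rule horiz_eqI) (simp add: Z pushforward_hlift)
  then show "\<exists>Z \<in> vector_fields N. X = hlift Z"
    using Z(1) by blast
qed (auto simp: basic_def hlift_section pushforward_hlift)

text \<open>
  A functional that is linear over the smooth functions is determined by its values on vertical
  fields and on lifts, since near \<open>p\<close> these generate all fields.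
\<close>

lemma field_0_if_0_on_frame:
  fixes A :: "'m field \<Rightarrow> 'v::real_vector"
  assumes add: "\<And>X Y. X \<in> vector_fields M \<Longrightarrow> Y \<in> vector_fields M \<Longrightarrow> A (X + Y) = A X + A Y"
    and scale: "\<And>f X. smooth_fun M f \<Longrightarrow> X \<in> vector_fields M \<Longrightarrow> A (f *\<^sub>F X) = f p *\<^sub>R A X"
    and vert: "\<And>V. V \<in> sections M (vert M N F) \<Longrightarrow> A V = 0"
    and lift: "\<And>Z. Z \<in> vector_fields N \<Longrightarrow> A (hlift Z) = 0"
    and G: "G \<in> vector_fields M"
  shows "A G = 0"
proof -
  obtain c :: "'m \<Rightarrow> real" and a and E :: "'k \<Rightarrow> 'n field"
    where c: "smooth_fun M c" "c p \<noteq> 0" and E: "\<And>b. E b \<in> vector_fields N"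
    and a: "\<And>G b. G \<in> vector_fields M \<Longrightarrow> smooth_fun M (a b G)"
    and eq: "\<And>G q. G \<in> vector_fields M \<Longrightarrow>
      c q *\<^sub>R hproj M N F q (G q) = (\<Sum>b\<in>Basis. a b G q *\<^sub>R hlift (E b) q)"
    by (rule hproj_lift_expansion[of p], rule that, assumption+)
  have A_sum: "A (\<Sum>b\<in>B. a b G *\<^sub>F hlift (E b)) = 0" if "finite B" for B
    using that
  proof (induction B)
    case empty
    have "(\<lambda>p. 0) *\<^sub>F 0 = (0 :: 'm field)" by (simp add: fun_eq_iff)
    then have "A 0 = 0" using scale[OF M.smooth_fun_const[of 0] M.field_0] by simp
    then show ?case by (simp only: sum.empty)
  next
    case (insert b B)
    have "a b G *\<^sub>F hlift (E b) \<in> vector_fields M" "(\<Sum>b\<in>B. a b G *\<^sub>F hlift (E b)) \<in> vector_fields M"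
      by (intro M.field_sum M.field_scale a G hlift_field E)+
    then have "A (a b G *\<^sub>F hlift (E b) + (\<Sum>b\<in>B. a b G *\<^sub>F hlift (E b))) =
        A (a b G *\<^sub>F hlift (E b)) + A (\<Sum>b\<in>B. a b G *\<^sub>F hlift (E b))"
      by (rule add)
    also have "\<dots> = 0"
      by (simp only: insert.IH scale[OF a[OF G] hlift_field[OF E]] lift[OF E] scaleR_zero_right add_0)
    finally have "A (a b G *\<^sub>F hlift (E b) + (\<Sum>b\<in>B. a b G *\<^sub>F hlift (E b))) = 0" .
    then show ?case
      using insert.hyps by (simp only: sum.insert not_False_eq_True)
  qed
  let ?V = "vproj M N F \<odot> G" and ?S = "\<Sum>b\<in>Basis. a b G *\<^sub>F hlift (E b)"
  have S: "?S \<in> vector_fields M"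
    by (intro M.field_sum M.field_scale a G hlift_field E)
  have V: "?V \<in> sections M (vert M N F)" "?V \<in> vector_fields M"
    using G by (simp_all add: vproj_section vproj_field)
  have "c *\<^sub>F G = c *\<^sub>F ?V + ?S"
  proof (rule ext)
    fix q
    have "c q *\<^sub>R G q = c q *\<^sub>R (hproj M N F q (G q) + vproj M N F q (G q))"
      using G by (simp add: proj_sum)
    also have "\<dots> = c q *\<^sub>R vproj M N F q (G q) + ?S q"
      by (simp only: scaleR_add_right eq[OF G] sum_fun_apply[of _ Basis q] add.commute)
    finally show "c q *\<^sub>R G q = (c *\<^sub>F ?V + ?S) q" by simp
  qed
  then have "c p *\<^sub>R A G = A (c *\<^sub>F ?V) + A ?S"
    using scale[OF c(1) G] add[OF M.field_scale[OF c(1) V(2)] S] by simp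
  also have "\<dots> = 0"
    using scale[OF c(1) V(2)] vert[OF V(1)] A_sum[OF finite_Basis] by simp
  finally show ?thesis using c(2) by simp
qed

lemma hlift_dilation_0_if_homothetic:
  assumes "horizontally_homothetic M N F l" "Z \<in> vector_fields N"
  shows "hlift Z p l = 0"
proof -
  have "hproj M N F p (gradient M l p) = 0"
    using fun_cong[OF assms(1)[unfolded horizontally_homothetic_def], of p] by simp
  then have "gradient M l p \<in> vert M N F p"
    by (simp add: vert_iff_hproj M.gradient_tangent)
  then have "metric M p (gradient M l p) (hlift Z p) = 0"
    using hlift_horiz[OF assms(2)] by (rule metric_horiz_vert(2)[rotated])
  then show ?thesis
    using hlift_horiz[OF assms(2)] by (simp add: M.gradient_metric horiz_tangent)
qed

text \<open>
  The horizontal part \<open>h\<close> of \<open>grad l\<close> satisfies \<open>h l = |h|\<^sup>2\<close>. As it is not itself a lift, the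
  hypothesis is extended from lifts to the horizontal parts of all fields before it is applied to \<open>h\<close>.
\<close>

lemma homothetic_if_hlift_dilation_0:
  assumes "\<And>Z p. Z \<in> vector_fields N \<Longrightarrow> hlift Z p l = 0"
  shows "horizontally_homothetic M N F l"
  unfolding horizontally_homothetic_def
proof (rule ext)
  fix p
  let ?G = "gradient M l"
  let ?h = "hproj M N F p (?G p)"
  have h: "?h \<in> horiz M N F p"
    by (intro hproj_horiz M.gradient_tangent)
  have "metric M p ?h x = x l" if x: "x \<in> horiz M N F p" for x
    using x metric_horiz_vert(2)[OF x vproj_vert[OF M.gradient_tangent]]
    by (simp add: hproj_eq[OF M.gradient_tangent] M.metric_linear_left M.gradient_tangent
        vproj_tangent horiz_tangent M.gradient_metric)
  then have "metric M p ?h (hproj M N F p (?G p)) = hproj M N F p (?G p) l"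
    using h by blast
  moreover have "hproj M N F p (?G p) l = 0"
  proof (rule field_0_if_0_on_frame[where A="\<lambda>X. hproj M N F p (X p) l" and p=p])
    fix X Y assume X: "X \<in> vector_fields M" and Y: "Y \<in> vector_fields M"
    have "hproj M N F p (X p + Y p) = hproj M N F p (X p) + hproj M N F p (Y p)"
      using X Y by (intro hproj_add M.field_tangent)
    then show "hproj M N F p ((X + Y) p) l = hproj M N F p (X p) l + hproj M N F p (Y p) l"
      by simp
  next
    fix f X assume "smooth_fun M f" and X: "X \<in> vector_fields M"
    then show "hproj M N F p (f p *\<^sub>R X p) l = f p *\<^sub>R hproj M N F p (X p) l"
      by (simp add: hproj_scale)
  next
    fix V assume "V \<in> sections M (vert M N F)"
    then show "hproj M N F p (V p) l = 0"
      by (simp add: M.sections_iff[of _ "vert M N F"] proj_of_vert)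
  next
    fix Z assume "Z \<in> vector_fields N"
    then show "hproj M N F p (hlift Z p) l = 0"
      using assms by (simp add: proj_of_horiz hlift_horiz)
  qed (intro M.gradient_field dilation_smooth)
  ultimately have "?h = 0"
    using M.metric_self_eq_0_iff[OF horiz_tangent[OF h]] by simp
  then show "hproj M N F p (?G p) = 0 p" by simp
qed

end

locale submersion_with_pullback = conformal_submersion M N F l
  for M :: "('m::{t2_space, second_countable_topology}, 'e::euclidean_space) riemannian"
    and N :: "('n::{t2_space, second_countable_topology}, 'k::euclidean_space) riemannian"
    and F :: "'m \<Rightarrow> 'n" and l :: "'m \<Rightarrow> real" +
  fixes D :: "'m field \<Rightarrow> ('m \<Rightarrow> 'n tvec) \<Rightarrow> 'm \<Rightarrow> 'n tvec"
  assumes pullback: "pullback_connection M N F D"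
begin

abbreviation II :: "'m field \<Rightarrow> 'm field \<Rightarrow> 'm \<Rightarrow> 'n tvec" where
  "II \<equiv> second_fundamental_form M N F D"

lemma pullback_rules:
  assumes "X \<in> vector_fields M" "Y \<in> vector_fields M"
    "S \<in> sections_along M N F" "R \<in> sections_along M N F" "smooth_fun M f"
  shows "D (X + Y) S = D X S + D Y S" "D (f *\<^sub>F X) S = f *\<^sub>F D X S" "D X (S + R) = D X S + D X R"
    "D X (f *\<^sub>F S) = (\<lambda>p. X p f) *\<^sub>F S + f *\<^sub>F D X S"
  using pullback assms unfolding pullback_connection_def by blast+

lemma pullback_of_field:
  assumes "X \<in> vector_fields M" "Z \<in> vector_fields N" "W \<in> vector_fields N"
    "W (F p) = pushforward N F (X p)"
  shows "D X (\<lambda>q. Z (F q)) p = conn N W Z (F p)"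
proof -
  have "D X (Z \<circ> F) p = conn N W Z (F p)"
    using pullback assms unfolding pullback_connection_def by blast
  then show ?thesis by (simp add: o_def)
qed

lemma pushforward_section:
  assumes G: "G \<in> vector_fields M"
  shows "(\<lambda>p. pushforward N F (G p)) \<in> sections_along M N F"
  using G M.field_smooth[OF G smooth_fun_pullback]
  by (simp add: sections_along_def pushforward_tangent pushforward_apply)

lemma II_apply: "II X Y p = D X (\<lambda>q. pushforward N F (Y q)) p - pushforward N F (conn M X Y p)"
  by (simp add: second_fundamental_form_def)

text \<open>
  The second fundamental form is tensorial in both arguments, so that it can be computed on fields
  adapted to \<open>F\<close>.
\<close>

lemma II_add_left:
  assumes "X \<in> vector_fields M" "Y \<in> vector_fields M" "G \<in> vector_fields M"
  shows "II (X + Y) G p = II X G p + II Y G p"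
  using pullback_rules(1)[OF assms(1,2) pushforward_section pushforward_section, of G G "\<lambda>p. 0"]
    M.conn_rules(2)[OF assms, of "\<lambda>p. 0"] assms(3)
  by (simp add: II_apply pushforward_linear)

lemma II_scale_left:
  assumes "smooth_fun M f" "X \<in> vector_fields M" "G \<in> vector_fields M"
  shows "II (f *\<^sub>F X) G p = f p *\<^sub>R II X G p"
  using pullback_rules(2)[OF assms(2,2) pushforward_section pushforward_section, of G G f]
    M.conn_rules(3)[OF assms(2,3,3,1)] assms(1,3)
  by (simp add: II_apply pushforward_linear scaleR_diff_right)

lemma II_add_right:
  assumes "G \<in> vector_fields M" "X \<in> vector_fields M" "Y \<in> vector_fields M"
  shows "II G (X + Y) p = II G X p + II G Y p"
proof -
  have "(\<lambda>q. pushforward N F ((X + Y) q)) = (\<lambda>q. pushforward N F (X q)) + (\<lambda>q. pushforward N F (Y q))"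
    by (simp add: fun_eq_iff pushforward_linear)
  then show ?thesis
    using pullback_rules(3)[OF assms(1,1) pushforward_section pushforward_section, of X Y "\<lambda>p. 0"]
      M.conn_rules(4)[OF assms, of "\<lambda>p. 0"] assms(2,3)
    by (simp only: II_apply) (simp add: pushforward_linear)
qed

text \<open>The terms that contain the derivative of \<open>f\<close> cancel.\<close>

lemma II_scale_right:
  assumes "smooth_fun M f" "G \<in> vector_fields M" "X \<in> vector_fields M"
  shows "II G (f *\<^sub>F X) p = f p *\<^sub>R II G X p"
proof -
  have "(\<lambda>q. pushforward N F (f q *\<^sub>R X q)) = f *\<^sub>F (\<lambda>q. pushforward N F (X q))"
    by (simp add: fun_eq_iff pushforward_linear)
  then show ?thesis
    using pullback_rules(4)[OF assms(2,2) pushforward_section pushforward_section, of X X f]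
      M.conn_rules(5)[OF assms(2,3,3,1)] assms(1,3)
    by (simp only: II_apply) (simp add: pushforward_linear scaleR_diff_right)
qed

text \<open>The section \<open>F\<^sub>* V\<close> is zero, and so only the second term of the definition remains.\<close>

lemma II_vert_right:
  assumes G: "G \<in> vector_fields M" and V: "V \<in> sections M (vert M N F)"
  shows "II G V p = - pushforward N F (conn M G V p)"
proof -
  let ?S = "\<lambda>q. pushforward N F (V q)"
  have "V \<in> vector_fields M" using V by (simp add: sections_vert_iff)
  then have "D G (?S + ?S) = D G ?S + D G ?S"
    using G by (intro pullback_rules(3)[where Y=G and f="\<lambda>p. 0"] pushforward_section) simp_all
  moreover have "?S + ?S = ?S"
    using V by (simp add: sections_vert_iff fun_eq_iff)
  ultimately have "D G ?S = 0" by simp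
  then show ?thesis by (simp add: II_apply)
qed

lemma II_hlift_right:
  assumes X: "X \<in> vector_fields M" and W: "W \<in> vector_fields N" "W (F p) = pushforward N F (X p)"
    and Z: "Z \<in> vector_fields N"
  shows "II X (hlift Z) p = conn N W Z (F p) - pushforward N F (conn M X (hlift Z) p)"
  using pullback_of_field[OF X Z W] by (simp add: II_apply pushforward_hlift[OF Z])

lemma II_vert_hlift:
  assumes V: "V \<in> sections M (vert M N F)" and Z: "Z \<in> vector_fields N"
  shows "II V (hlift Z) p = - pushforward N F (conn M V (hlift Z) p)"
  using II_hlift_right[of V 0 p Z] N.conn_zero_left[OF Z] V Z by (simp add: sections_vert_iff)

text \<open>
  The two values differ by \<open>F\<^sub>* [X, V]\<close>, where \<open>X\<close> is the lift, because \<open>F\<^sub>* X\<close> is constant along the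
  fibres. The bracket is vertical since \<open>V\<close> is related to \<open>0\<close>.
\<close>

lemma II_hlift_vert:
  assumes Z: "Z \<in> vector_fields N" and V: "V \<in> sections M (vert M N F)"
  shows "II (hlift Z) V p = II V (hlift Z) p"
proof -
  have V': "V \<in> vector_fields M" "\<And>q. pushforward N F (V q) = 0 (F q)"
    using V by (simp_all add: sections_vert_iff)
  have "pushforward N F (lie_bracket (hlift Z) V p) = lie_bracket Z 0 (F p)"
    by (intro bracket_related hlift_field Z pushforward_hlift N.field_0 V')
  also have "\<dots> = 0"
    using N.tangent_const[OF N.field_tangent[OF Z], of "F p" 0] by (simp add: lie_bracket_def fun_eq_iff)
  also have "lie_bracket (hlift Z) V p = conn M (hlift Z) V p - conn M V (hlift Z) p"
    using fun_cong[OF M.conn_rules(6)[OF hlift_field[OF Z] V'(1,1), of "\<lambda>p. 0"], of p] by simp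
  finally have "pushforward N F (conn M (hlift Z) V p) = pushforward N F (conn M V (hlift Z) p)"
    by (simp only: pushforward_linear right_minus_eq)
  then show ?thesis
    using II_vert_right[OF hlift_field[OF Z] V] II_vert_hlift[OF V Z] by simp
qed

lemma II_hlift_sym:
  assumes Z: "Z \<in> vector_fields N" and W: "W \<in> vector_fields N"
  shows "II (hlift Z) (hlift W) p = II (hlift W) (hlift Z) p"
proof -
  note X = hlift_field[OF Z] and Y = hlift_field[OF W]
  have "conn M (hlift Z) (hlift W) p - conn M (hlift W) (hlift Z) p = lie_bracket (hlift Z) (hlift W) p"
    using fun_cong[OF M.conn_rules(6)[OF X Y Y, of "\<lambda>p. 0"], of p] by simp
  moreover have "conn N Z W (F p) - conn N W Z (F p) = lie_bracket Z W (F p)"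
    using fun_cong[OF N.conn_rules(6)[OF Z W W, of "\<lambda>p. 0"], of "F p"] by simp
  moreover have "pushforward N F (lie_bracket (hlift Z) (hlift W) p) = lie_bracket Z W (F p)"
    by (intro bracket_related X Y Z W pushforward_hlift)
  ultimately have "pushforward N F (conn M (hlift Z) (hlift W) p) - pushforward N F (conn M (hlift W) (hlift Z) p)
      = conn N Z W (F p) - conn N W Z (F p)"
    by (simp flip: pushforward_linear(2))
  moreover have "II (hlift Z) (hlift W) p - II (hlift W) (hlift Z) p =
      (conn N Z W (F p) - conn N W Z (F p)) -
      (pushforward N F (conn M (hlift Z) (hlift W) p) - pushforward N F (conn M (hlift W) (hlift Z) p))"
    by (simp add: II_hlift_right[OF X Z _ W, of p] II_hlift_right[OF Y W _ Z, of p] pushforward_hlift Z W)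
  ultimately have "II (hlift Z) (hlift W) p - II (hlift W) (hlift Z) p = 0"
    by (simp only: diff_self)
  then show ?thesis by (simp only: right_minus_eq)
qed

text \<open>
  Both Levi-Civita connections are metric, and \<open>F\<close> scales the metric of horizontal vectors by
  \<open>l\<^sup>2\<close>. So the failure of \<open>F\<close> to preserve the connections is seen by the derivative of \<open>l\<^sup>2\<close>.
\<close>

lemma II_metric:
  assumes X: "X \<in> vector_fields N" and Y: "Y \<in> vector_fields N" and Z: "Z \<in> vector_fields N"
  shows "metric N (F p) (II (hlift X) (hlift Y) p) (Z (F p)) +
      metric N (F p) (Y (F p)) (II (hlift X) (hlift Z) p) =
    2 * l p * hlift X p l * metric M p (hlift Y p) (hlift Z p)"
proof -
  let ?X = "hlift X" and ?Y = "hlift Y" and ?Z = "hlift Z"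
  note fields = hlift_field[OF X] hlift_field[OF Y] hlift_field[OF Z]
  have Xp: "?X p \<in> tangent_space M p" using fields by simp
  have tangent: "pushforward N F (conn M ?X G p) \<in> tangent_space N (F p)" if "G \<in> vector_fields M" for G
    using fields that by (intro pushforward_tangent M.field_tangent M.conn_field)
  have scale: "metric N (F q) (Y (F q)) (Z (F q)) = (l q)\<^sup>2 * metric M q (?Y q) (?Z q)" for q
    using metric_pushforward[OF hlift_horiz[OF Y], of "?Z q" q] fields
    by (simp add: pushforward_hlift Y Z)
  have "metric N (F p) (conn N X Y (F p)) (Z (F p)) + metric N (F p) (Y (F p)) (conn N X Z (F p)) =
      X (F p) (\<lambda>y. metric N y (Y y) (Z y))"
    using N.conn_rules(7)[OF X Y Z, of "\<lambda>p. 0"] by simp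
  also have "\<dots> = ?X p (\<lambda>q. metric N (F q) (Y (F q)) (Z (F q)))"
    using pushforward_hlift[OF X, of p] pushforward_apply[OF N.metric_smooth[OF Y Z], of F "?X p"] by simp
  also have "\<dots> = ?X p (\<lambda>q. (l q)\<^sup>2 * metric M q (?Y q) (?Z q))"
    by (simp only: scale)
  also have "\<dots> = (l p)\<^sup>2 * ?X p (\<lambda>q. metric M q (?Y q) (?Z q)) +
      ?X p (\<lambda>q. (l q)\<^sup>2) * metric M p (?Y p) (?Z p)"
    using fields by (intro M.tangent_mult Xp dilation_square_smooth M.metric_smooth)
  also have "?X p (\<lambda>q. (l q)\<^sup>2) = 2 * l p * ?X p l"
    by (intro M.tangent_power2 Xp dilation_smooth)
  also have "?X p (\<lambda>q. metric M q (?Y q) (?Z q)) =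
      metric M p (conn M ?X ?Y p) (?Z p) + metric M p (?Y p) (conn M ?X ?Z p)"
    using M.conn_rules(7)[OF fields, of "\<lambda>p. 0"] by simp
  also have "(l p)\<^sup>2 * (metric M p (conn M ?X ?Y p) (?Z p) + metric M p (?Y p) (conn M ?X ?Z p)) =
      metric N (F p) (pushforward N F (conn M ?X ?Y p)) (Z (F p)) +
      metric N (F p) (Y (F p)) (pushforward N F (conn M ?X ?Z p))"
  proof -
    have "metric N (F p) (Y (F p)) (pushforward N F (conn M ?X ?Z p)) =
        (l p)\<^sup>2 * metric M p (?Y p) (conn M ?X ?Z p)"
      using metric_pushforward[OF hlift_horiz[OF Y], of "conn M ?X ?Z p" p] fields
      by (simp add: pushforward_hlift Y)
    moreover have "metric N (F p) (Z (F p)) (pushforward N F (conn M ?X ?Y p)) =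
        (l p)\<^sup>2 * metric M p (?Z p) (conn M ?X ?Y p)"
      using metric_pushforward[OF hlift_horiz[OF Z], of "conn M ?X ?Y p" p] fields
      by (simp add: pushforward_hlift Z)
    moreover have "metric N (F p) (Z (F p)) (pushforward N F (conn M ?X ?Y p)) =
        metric N (F p) (pushforward N F (conn M ?X ?Y p)) (Z (F p))"
      using fields Z by (intro N.metric_sym tangent) simp_all
    moreover have "metric M p (?Z p) (conn M ?X ?Y p) = metric M p (conn M ?X ?Y p) (?Z p)"
      using fields by (intro M.metric_sym) simp_all
    ultimately show ?thesis by (simp add: distrib_left)
  qed
  finally show ?thesis
    using II_hlift_right[OF fields(1) X _ Y, of p] II_hlift_right[OF fields(1) X _ Z, of p]
      tangent[OF fields(2)] tangent[OF fields(3)] X Y Z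
    by (simp add: pushforward_hlift N.metric_linear_left N.metric_linear_right)
qed

lemma II_hlift_tangent:
  assumes "X \<in> vector_fields N" "Y \<in> vector_fields N"
  shows "II (hlift X) (hlift Y) p \<in> tangent_space N (F p)"
  using II_hlift_right[OF hlift_field[OF assms(1)] assms(1) _ assms(2), of p] assms
  by (simp add: pushforward_hlift N.tangent_simps_closed pushforward_tangent hlift_field)

text \<open>
  Here the right-hand side of \<open>II_metric\<close> is zero, so that the trilinear form
  \<open>g'(II X Y, Z)\<close> is antisymmetric in \<open>Y\<close>, \<open>Z\<close>; it is symmetric in \<open>X\<close>, \<open>Y\<close>. Alternating the two
  exchanges three times each returns to the original arguments with the opposite sign.
\<close>

lemma II_hlift_0:
  assumes homothetic: "horizontally_homothetic M N F l"
    and X: "X \<in> vector_fields N" and Y: "Y \<in> vector_fields N"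
  shows "II (hlift X) (hlift Y) p = 0"
proof -
  let ?II = "\<lambda>X Y. II (hlift X) (hlift Y) p" and ?g = "metric N (F p)"
  have anti: "?g (?II X Y) (Z (F p)) = - ?g (?II X Z) (Y (F p))"
    if "X \<in> vector_fields N" "Y \<in> vector_fields N" "Z \<in> vector_fields N" for X Y Z
    using II_metric[OF that, of p] hlift_dilation_0_if_homothetic[OF homothetic that(1)]
      N.metric_sym[OF II_hlift_tangent[OF that(1,3)] N.field_tangent[OF that(2)]] by simp
  have "?g (?II X Y) (Z (F p)) = 0" if Z: "Z \<in> vector_fields N" for Z
  proof -
    have "?g (?II X Y) (Z (F p)) = - ?g (?II Z X) (Y (F p))"
      using anti[OF X Y Z] II_hlift_sym[OF X Z] by simp
    also have "\<dots> = ?g (?II Y Z) (X (F p))"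
      using anti[OF Z X Y] II_hlift_sym[OF Z Y] by simp
    also have "\<dots> = - ?g (?II X Y) (Z (F p))"
      using anti[OF Y Z X] II_hlift_sym[OF Y X] by simp
    finally show ?thesis by simp
  qed
  moreover obtain Z where "Z \<in> vector_fields N" "Z (F p) = ?II X Y"
    using N.field_through[OF II_hlift_tangent[OF X Y]] by blast
  ultimately have "?g (?II X Y) (?II X Y) = 0" by metis
  then show ?thesis
    using N.metric_self_eq_0_iff[OF II_hlift_tangent[OF X Y]] by simp
qed

text \<open>
  The three conditions are the vanishing of the second fundamental form on pairs of vertical fields,
  of horizontal fields, and on mixed pairs.
\<close>

lemma totally_geodesic_iff:
  "totally_geodesic M N F D \<longleftrightarrow>
    (\<forall>U \<in> sections M (vert M N F). \<forall>V \<in> sections M (vert M N F). \<forall>p. conn M U V p \<in> vert M N F p) \<and>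
    horizontally_homothetic M N F l \<and>
    (\<forall>V \<in> sections M (vert M N F). \<forall>Z \<in> vector_fields N. \<forall>p. conn M V (hlift Z) p \<in> vert M N F p)"
    (is "_ \<longleftrightarrow> ?fibres \<and> _ \<and> ?mixed")
proof
  assume geodesic: "totally_geodesic M N F D"
  then have II_0: "II X Y p = 0" if "X \<in> vector_fields M" "Y \<in> vector_fields M" for X Y p
    using that by (simp add: totally_geodesic_def)
  have ?fibres
  proof (intro ballI allI)
    fix U V p assume U: "U \<in> sections M (vert M N F)" and V: "V \<in> sections M (vert M N F)"
    then have "U \<in> vector_fields M" "V \<in> vector_fields M" by (simp_all add: sections_vert_iff)
    then show "conn M U V p \<in> vert M N F p"
      using II_vert_right[OF _ V, of U p] II_0[of U V p] by (simp add: vert_iff)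
  qed
  moreover have ?mixed
  proof (intro ballI allI)
    fix V Z p assume V: "V \<in> sections M (vert M N F)" and Z: "Z \<in> vector_fields N"
    then have "V \<in> vector_fields M" by (simp add: sections_vert_iff)
    then show "conn M V (hlift Z) p \<in> vert M N F p"
      using II_vert_hlift[OF V Z, of p] II_0[of V "hlift Z" p] hlift_field[OF Z] by (simp add: vert_iff)
  qed
  moreover have "horizontally_homothetic M N F l"
  proof (rule homothetic_if_hlift_dilation_0)
    fix X p assume X: "X \<in> vector_fields N"
    obtain Y where Y: "Y \<in> vector_fields N" "Y (F p) \<noteq> 0" by (rule N.nonvanishing_field)
    have "hlift Y p \<noteq> 0"
      using pushforward_hlift[OF Y(1), of p] Y(2) by (auto simp: pushforward_linear)
    then have "metric M p (hlift Y p) (hlift Y p) \<noteq> 0"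
      by (simp add: M.metric_self_eq_0_iff hlift_field Y(1))
    moreover have "2 * l p * hlift X p l * metric M p (hlift Y p) (hlift Y p) = 0"
      using II_metric[OF X Y(1) Y(1), of p] II_0[of "hlift X" "hlift Y" p] X Y(1)
      by (simp add: hlift_field N.metric_zero_left N.metric_zero_right)
    ultimately show "hlift X p l = 0"
      using dilation_pos[of p] by simp
  qed
  ultimately show "?fibres \<and> horizontally_homothetic M N F l \<and> ?mixed" by blast
next
  assume *: "?fibres \<and> horizontally_homothetic M N F l \<and> ?mixed"
  have vert_vert: "II U V p = 0"
    if "U \<in> sections M (vert M N F)" "V \<in> sections M (vert M N F)" for U V p
    using * that II_vert_right[OF _ that(2), of U p] by (simp add: vert_iff sections_vert_iff[of U])
  have vert_lift: "II V (hlift Z) p = 0"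
    if "V \<in> sections M (vert M N F)" "Z \<in> vector_fields N" for V Z p
    using * that II_vert_hlift[OF that, of p] by (simp add: vert_iff)
  have vert_all: "II V G p = 0" if V: "V \<in> sections M (vert M N F)" and G: "G \<in> vector_fields M" for V G p
  proof -
    have V': "V \<in> vector_fields M" using V by (simp add: sections_vert_iff)
    show ?thesis
      by (rule field_0_if_0_on_frame[where A="\<lambda>G. II V G p" and p=p, OF _ _ _ _ G];
          (rule II_add_right[OF V'] II_scale_right[OF _ V'] vert_vert[OF V] vert_lift[OF V]; assumption))
  qed
  have lift_all: "II (hlift Z) G p = 0" if Z: "Z \<in> vector_fields N" and G: "G \<in> vector_fields M" for Z G p
  proof -
    note X = hlift_field[OF Z]
    have lift_vert: "II (hlift Z) V p = 0" if "V \<in> sections M (vert M N F)" for V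
      using II_hlift_vert[OF Z that] vert_lift[OF that Z] by simp
    have lift_lift: "II (hlift Z) (hlift W) p = 0" if "W \<in> vector_fields N" for W
      using II_hlift_0[OF _ Z that] * by blast
    show ?thesis
      by (rule field_0_if_0_on_frame[where A="\<lambda>G. II (hlift Z) G p" and p=p, OF _ _ _ _ G];
          (rule II_add_right[OF X] II_scale_right[OF _ X] lift_vert lift_lift; assumption))
  qed
  have "II E G p = 0" if E: "E \<in> vector_fields M" and G: "G \<in> vector_fields M" for E G p
    by (rule field_0_if_0_on_frame[where A="\<lambda>E. II E G p" and p=p, OF _ _ _ _ E];
        (rule II_add_left[OF _ _ G] II_scale_left[OF _ _ G] vert_all[OF _ G] lift_all[OF _ G]; assumption))
  then show "totally_geodesic M N F D"
    by (simp add: totally_geodesic_def fun_eq_iff)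
qed

end


section \<open>Anti-invariance\<close>

locale anti_invariant_submersion = conformal_submersion M N F l
  for M :: "('m::{t2_space, second_countable_topology}, 'e::euclidean_space) riemannian"
    and N :: "('n::{t2_space, second_countable_topology}, 'k::euclidean_space) riemannian"
    and F :: "'m \<Rightarrow> 'n" and l :: "'m \<Rightarrow> real" +
  fixes J :: "'m \<Rightarrow> 'm tvec \<Rightarrow> 'm tvec"
  assumes kaehler: "kaehler_manifold M J"
    and anti_invariant: "\<And>p. J p ` vert M N F p \<subseteq> horiz M N F p"
begin

lemma J_tangent: "u \<in> tangent_space M p \<Longrightarrow> J p u \<in> tangent_space M p"
  using kaehler by (simp add: kaehler_manifold_def tensor_field_11_def)

lemma J_J: "u \<in> tangent_space M p \<Longrightarrow> J p (J p u) = - u"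
  using kaehler by (simp add: kaehler_manifold_def)

lemma J_isometry:
  "u \<in> tangent_space M p \<Longrightarrow> v \<in> tangent_space M p \<Longrightarrow> metric M p (J p u) (J p v) = metric M p u v"
  using kaehler by (simp add: kaehler_manifold_def)

lemma J_field: "X \<in> vector_fields M \<Longrightarrow> J \<odot> X \<in> vector_fields M"
  using kaehler unfolding kaehler_manifold_def tensor_field_11_def by simp

lemma J_parallel:
  assumes "X \<in> vector_fields M" "Y \<in> vector_fields M"
  shows "conn M X (J \<odot> Y) = J \<odot> conn M X Y"
proof -
  have "conn M X (J \<odot> Y) - J \<odot> conn M X Y = 0"
    using kaehler assms by (simp add: kaehler_manifold_def)
  then show ?thesis by simp
qed

lemma J_inj: "u \<in> tangent_space M p \<Longrightarrow> v \<in> tangent_space M p \<Longrightarrow> J p u = J p v \<Longrightarrow> u = v"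
  by (metis J_J neg_equal_iff_equal)

text \<open>
  For vertical \<open>x\<close> the vector \<open>J x\<close> is horizontal by anti-invariance, so it equals its horizontal
  part; conversely \<open>J\<close> is injective. This turns \<open>\<nabla>\<^sub>U Y\<close> being vertical into the pairs of conditions on
  \<open>J \<nabla>\<^sub>U Y = \<nabla>\<^sub>U (J Y)\<close> of which the characterisation consists.
\<close>

lemma vert_iff_J:
  assumes x: "x \<in> tangent_space M p"
  shows "x \<in> vert M N F p \<longleftrightarrow>
    vproj M N F p (J p x) = 0 \<and> hproj M N F p (J p x) \<in> J_vert M J N F p"
proof
  assume v: "x \<in> vert M N F p"
  then have "J p x \<in> horiz M N F p" using anti_invariant by blast
  then show "vproj M N F p (J p x) = 0 \<and> hproj M N F p (J p x) \<in> J_vert M J N F p"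
    using v by (simp add: proj_of_horiz J_vert_def)
next
  assume *: "vproj M N F p (J p x) = 0 \<and> hproj M N F p (J p x) \<in> J_vert M J N F p"
  then have "hproj M N F p (J p x) = J p x"
    using hproj_eq[OF J_tangent[OF x]] by simp
  then have "J p x \<in> J p ` vert M N F p"
    using * by (simp only: J_vert_def)
  then show "x \<in> vert M N F p"
    using J_inj[OF x vert_tangent] by blast
qed

text \<open>
  The horizontal part of \<open>J x\<close> is orthogonal to \<open>J v\<close> for vertical \<open>v\<close>, because \<open>J\<close> is an isometry
  and \<open>x\<close> is orthogonal to \<open>v\<close>.
\<close>

lemma hproj_J_mu:
  assumes x: "x \<in> horiz M N F p"
  shows "hproj M N F p (J p x) \<in> mu M J N F p"
proof -
  note Jx = J_tangent[OF horiz_tangent[OF x]]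
  have "metric M p (hproj M N F p (J p x)) (J p v) = 0" if v: "v \<in> vert M N F p" for v
  proof -
    have Jv: "J p v \<in> horiz M N F p" using v anti_invariant by blast
    have "metric M p (J p x) (J p v) = 0"
      using x v by (simp add: J_isometry horiz_tangent vert_tangent metric_horiz_vert)
    then show ?thesis
      using metric_horiz_vert(2)[OF Jv vproj_vert[OF Jx]]
      by (simp add: hproj_eq[OF Jx] M.metric_linear_left Jx vproj_tangent horiz_tangent[OF Jv])
  qed
  then show ?thesis
    using hproj_horiz[OF Jx] by (auto simp: mu_def J_vert_def)
qed

lemma B_part_eq:
  assumes x: "x \<in> horiz M N F p"
  shows "B_part M J N F p x = vproj M N F p (J p x)"
  unfolding B_part_def
proof (rule the_equality)
  note Jx = J_tangent[OF horiz_tangent[OF x]]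
  show "vproj M N F p (J p x) \<in> vert M N F p \<and> J p x - vproj M N F p (J p x) \<in> mu M J N F p"
    using hproj_J_mu[OF x] vproj_vert[OF Jx] by (simp add: hproj_eq[OF Jx])
  fix b assume "b \<in> vert M N F p \<and> J p x - b \<in> mu M J N F p"
  then show "b = vproj M N F p (J p x)"
    using proj_unique(2)[of "J p x - b" p b] by (simp add: mu_def)
qed

lemma C_part_eq:
  assumes x: "x \<in> horiz M N F p"
  shows "C_part M J N F p x = hproj M N F p (J p x)"
  unfolding C_part_def
proof (rule the_equality)
  note Jx = J_tangent[OF horiz_tangent[OF x]]
  show "hproj M N F p (J p x) \<in> mu M J N F p \<and> J p x - hproj M N F p (J p x) \<in> vert M N F p"
    using hproj_J_mu[OF x] vproj_vert[OF Jx] by (simp add: hproj_eq[OF Jx])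
  fix c assume "c \<in> mu M J N F p \<and> J p x - c \<in> vert M N F p"
  then show "c = hproj M N F p (J p x)"
    using proj_unique(1)[of c p "J p x - c"] by (simp add: mu_def)
qed

lemma oneill_T_vert_horiz:
  assumes "\<And>p. V p \<in> vert M N F p" "\<And>p. X p \<in> horiz M N F p" "V \<in> vector_fields M"
  shows "oneill_T M N F V X = vproj M N F \<odot> conn M V X"
proof -
  have eqs: "vproj M N F \<odot> V = V" "vproj M N F \<odot> X = 0" "hproj M N F \<odot> X = X"
    using assms by (simp_all add: fun_eq_iff proj_of_vert proj_of_horiz)
  then show ?thesis
    unfolding oneill_T_def eqs M.conn_zero_right[OF assms(3)]
    by (simp add: fun_eq_iff proj_of_vert[OF subspace_0[OF subspace_vert]])
qed

lemma oneill_T_vert_vert: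
  assumes "\<And>p. V p \<in> vert M N F p" "\<And>p. W p \<in> vert M N F p" "V \<in> vector_fields M"
  shows "oneill_T M N F V W = hproj M N F \<odot> conn M V W"
proof -
  have eqs: "vproj M N F \<odot> V = V" "hproj M N F \<odot> W = 0" "vproj M N F \<odot> W = W"
    using assms by (simp_all add: fun_eq_iff proj_of_vert)
  then show ?thesis
    unfolding oneill_T_def eqs M.conn_zero_right[OF assms(3)]
    by (simp add: fun_eq_iff proj_of_vert[OF subspace_0[OF subspace_vert]])
qed

text \<open>Here \<open>J V\<close> is horizontal, so that \<open>T\<^sub>U (J V)\<close> is the vertical part of \<open>\<nabla>\<^sub>U (J V) = J \<nabla>\<^sub>U V\<close>.\<close>

lemma fibres_condition_iff:
  assumes U: "U \<in> sections M (vert M N F)" and V: "V \<in> sections M (vert M N F)"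
  shows "oneill_T M N F U (J \<odot> V) = 0 \<and>
      hproj M N F \<odot> conn M U (J \<odot> V) \<in> sections M (J_vert M J N F) \<longleftrightarrow>
    (\<forall>p. conn M U V p \<in> vert M N F p)"
proof -
  have fields: "U \<in> vector_fields M" "V \<in> vector_fields M"
    and vert: "\<And>p. U p \<in> vert M N F p" "\<And>p. V p \<in> vert M N F p"
    using U V by (simp_all add: M.sections_iff[of _ "vert M N F"])
  have horiz: "J p (V p) \<in> horiz M N F p" for p
    using vert(2) anti_invariant by blast
  have "oneill_T M N F U (J \<odot> V) = vproj M N F \<odot> conn M U (J \<odot> V)"
    using vert(1) horiz fields(1) by (rule oneill_T_vert_horiz)
  moreover have "hproj M N F \<odot> conn M U (J \<odot> V) \<in> vector_fields M"
    using fields by (intro hproj_field M.conn_field J_field)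
  ultimately show ?thesis
    using fields by (auto simp: J_parallel fun_eq_iff vert_iff_J M.sections_iff[of _ "J_vert M J N F"])
qed

text \<open>
  Adding the derivatives of \<open>B X\<close> and \<open>C X\<close> gives \<open>\<nabla>\<^sub>V (J X) = J \<nabla>\<^sub>V X\<close>. The first condition concerns
  its vertical and the second its horizontal part.
\<close>

lemma mixed_condition_iff:
  assumes V: "V \<in> sections M (vert M N F)" and X: "X \<in> sections M (horiz M N F)"
  shows "conn_hat M N F V (B_part M J N F \<odot> X) + oneill_T M N F V (C_part M J N F \<odot> X) = 0 \<and>
      oneill_T M N F V (B_part M J N F \<odot> X) + hproj M N F \<odot> conn M V (C_part M J N F \<odot> X)
        \<in> sections M (J_vert M J N F) \<longleftrightarrow>
    (\<forall>p. conn M V X p \<in> vert M N F p)"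
proof -
  have fields: "V \<in> vector_fields M" "X \<in> vector_fields M"
    and vert: "\<And>p. V p \<in> vert M N F p" and horiz: "\<And>p. X p \<in> horiz M N F p"
    using V X by (simp_all add: M.sections_iff[of _ "vert M N F"] M.sections_iff[of _ "horiz M N F"])
  let ?B = "B_part M J N F \<odot> X" and ?C = "C_part M J N F \<odot> X"
  have JX: "J p (X p) \<in> tangent_space M p" for p
    using fields by (intro J_tangent M.field_tangent)
  have B_eq: "?B = vproj M N F \<odot> (J \<odot> X)" and C_eq: "?C = hproj M N F \<odot> (J \<odot> X)"
    using horiz by (simp_all add: fun_eq_iff B_part_eq C_part_eq)
  have BC_fields: "?B \<in> vector_fields M" "?C \<in> vector_fields M"
    unfolding B_eq C_eq
    by (rule vproj_field[OF J_field[OF fields(2)]]) (rule hproj_field[OF J_field[OF fields(2)]])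
  have B_vert: "?B p \<in> vert M N F p" and C_horiz: "?C p \<in> horiz M N F p" for p
    using horiz JX by (simp_all add: B_part_eq C_part_eq vproj_vert hproj_horiz)
  have "?B + ?C = J \<odot> X"
    using JX by (simp add: B_eq C_eq fun_eq_iff hproj_eq)
  then have sum: "conn M V ?B p + conn M V ?C p = J p (conn M V X p)" for p
    using fun_cong[OF M.conn_rules(4)[OF fields(1) BC_fields, of "\<lambda>p. 0"], of p] J_parallel[OF fields]
    by simp
  have tangent: "conn M V ?B p \<in> tangent_space M p" "conn M V ?C p \<in> tangent_space M p" for p
    using fields BC_fields by (auto intro!: M.field_tangent)
  have 1: "(conn_hat M N F V ?B + oneill_T M N F V ?C) p = vproj M N F p (J p (conn M V X p))" for p
    using oneill_T_vert_horiz[OF vert C_horiz fields(1)] vproj_add[OF tangent]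
    by (simp add: conn_hat_def sum)
  have 2: "(oneill_T M N F V ?B + hproj M N F \<odot> conn M V ?C) p = hproj M N F p (J p (conn M V X p))" for p
    using oneill_T_vert_vert[OF vert B_vert fields(1)] hproj_add[OF tangent]
    by (simp add: sum)
  have "oneill_T M N F V ?B + hproj M N F \<odot> conn M V ?C = hproj M N F \<odot> (J \<odot> conn M V X)"
    by (rule ext, rule 2)
  moreover have "hproj M N F \<odot> (J \<odot> conn M V X) \<in> vector_fields M"
    using fields by (intro hproj_field M.conn_field J_field)
  ultimately have field_iff: "(oneill_T M N F V ?B + hproj M N F \<odot> conn M V ?C \<in> sections M (J_vert M J N F)) \<longleftrightarrow>
      (\<forall>p. (oneill_T M N F V ?B + hproj M N F \<odot> conn M V ?C) p \<in> J_vert M J N F p)"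
    by (simp only: M.sections_iff[of _ "J_vert M J N F"]) blast
  have T: "conn M V X p \<in> tangent_space M p" for p
    using fields by simp
  have "(conn_hat M N F V ?B + oneill_T M N F V ?C = 0) \<longleftrightarrow>
      (\<forall>p. vproj M N F p (J p (conn M V X p)) = 0)"
    unfolding fun_eq_iff[of "conn_hat M N F V ?B + oneill_T M N F V ?C"] 1 by simp
  moreover have "(oneill_T M N F V ?B + hproj M N F \<odot> conn M V ?C \<in> sections M (J_vert M J N F)) \<longleftrightarrow>
      (\<forall>p. hproj M N F p (J p (conn M V X p)) \<in> J_vert M J N F p)"
    unfolding field_iff 2 ..
  ultimately show ?thesis
    using vert_iff_J[OF T] by blast
qed

end


theorem theorem4p7:
  fixes M :: "('m::{t2_space, second_countable_topology}, 'e::euclidean_space) riemannian"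
    and N :: "('n::{t2_space, second_countable_topology}, 'k::euclidean_space) riemannian"
    and J :: "'m \<Rightarrow> 'm tvec \<Rightarrow> 'm tvec"
    and F :: "'m \<Rightarrow> 'n"
    and l :: "'m \<Rightarrow> real"
    and D :: "'m field \<Rightarrow> ('m \<Rightarrow> 'n tvec) \<Rightarrow> 'm \<Rightarrow> 'n tvec"
  assumes "kaehler_manifold M J"
    and "riemannian_manifold N"
    and "conformal_anti_invariant_submersion M J N F l"
    and "pullback_connection M N F D"
  shows "totally_geodesic M N F D \<longleftrightarrow>
    (\<forall>U \<in> sections M (vert M N F). \<forall>V \<in> sections M (vert M N F).
        oneill_T M N F U (J \<odot> V) = 0 \<and>
        hproj M N F \<odot> conn M U (J \<odot> V) \<in> sections M (J_vert M J N F)) \<and>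
    horizontally_homothetic M N F l \<and>
    (\<forall>V \<in> sections M (vert M N F). \<forall>X \<in> sections M (horiz M N F). basic M N F X \<longrightarrow>
        conn_hat M N F V (B_part M J N F \<odot> X) + oneill_T M N F V (C_part M J N F \<odot> X) = 0 \<and>
        oneill_T M N F V (B_part M J N F \<odot> X) + hproj M N F \<odot> conn M V (C_part M J N F \<odot> X)
          \<in> sections M (J_vert M J N F))"
proof -
  have mfds: "riemannian_mfd M" "riemannian_mfd N"
    using assms(1,2)
    by (simp_all add: riemannian_mfd_def riemannian_mfd_axioms_def manifold_def
        kaehler_manifold_def riemannian_manifold_def)
  have sub: "conformal_submersion M N F l"
    using mfds assms(3)
    by (simp add: conformal_submersion_def conformal_submersion_axioms_def
        conformal_anti_invariant_submersion_def)
  interpret submersion_with_pullback M N F l D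
    using sub assms(4) by (simp add: submersion_with_pullback_def submersion_with_pullback_axioms_def)
  interpret anti_invariant_submersion M N F l J
    using sub assms(1,3)
    by (simp add: anti_invariant_submersion_def anti_invariant_submersion_axioms_def
        conformal_anti_invariant_submersion_def)
  let ?mixed = "\<lambda>V X. conn_hat M N F V (B_part M J N F \<odot> X) + oneill_T M N F V (C_part M J N F \<odot> X) = 0 \<and>
        oneill_T M N F V (B_part M J N F \<odot> X) + hproj M N F \<odot> conn M V (C_part M J N F \<odot> X)
          \<in> sections M (J_vert M J N F)"
  have fibres: "(\<forall>U \<in> sections M (vert M N F). \<forall>V \<in> sections M (vert M N F).
        oneill_T M N F U (J \<odot> V) = 0 \<and>
        hproj M N F \<odot> conn M U (J \<odot> V) \<in> sections M (J_vert M J N F)) \<longleftrightarrow>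
      (\<forall>U \<in> sections M (vert M N F). \<forall>V \<in> sections M (vert M N F). \<forall>p. conn M U V p \<in> vert M N F p)"
    by (intro ball_cong refl fibres_condition_iff)
  have "(\<forall>X \<in> sections M (horiz M N F). basic M N F X \<longrightarrow> ?mixed V X) \<longleftrightarrow>
      (\<forall>Z \<in> vector_fields N. \<forall>p. conn M V (hlift Z) p \<in> vert M N F p)"
    if V: "V \<in> sections M (vert M N F)" for V
  proof -
    have "(\<forall>X \<in> sections M (horiz M N F). basic M N F X \<longrightarrow> ?mixed V X) \<longleftrightarrow>
        (\<forall>Z \<in> vector_fields N. ?mixed V (hlift Z))"
      using hlift_section by (auto simp only: basic_iff_hlift)
    also have "\<dots> \<longleftrightarrow> (\<forall>Z \<in> vector_fields N. \<forall>p. conn M V (hlift Z) p \<in> vert M N F p)"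
      by (intro ball_cong refl mixed_condition_iff V hlift_section)
    finally show ?thesis .
  qed
  then have mixed: "(\<forall>V \<in> sections M (vert M N F). \<forall>X \<in> sections M (horiz M N F). basic M N F X \<longrightarrow> ?mixed V X) \<longleftrightarrow>
      (\<forall>V \<in> sections M (vert M N F). \<forall>Z \<in> vector_fields N. \<forall>p. conn M V (hlift Z) p \<in> vert M N F p)"
    by (intro ball_cong refl)
  show ?thesis
    unfolding totally_geodesic_iff fibres mixed ..
qed

end
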